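(* Let $n\ge1$, let $\theta$ be a real skew-symmetric $n\times n$ matrix, let $k,r\in\mathbb{N}_0$ and $1<p<\infty$. Then there exists a constant $C_{k,r,n}>0$, depending only on $k,r,n$ (independent of $\theta$ and $p$), such that for every $a\in\mathcal{A}_\theta^\infty$ and every $t>0$, $$|P_ta|_{W^{k+r,p}_\theta}\le \frac{C_{k,r,n}}{t^{r/2}}\,|a|_{W^{k,p}_\theta}.$$ Moreover, $$\|P_ta\|_{W^{k+r,p}_\theta}\le C_{k,r,n}\bigl(1+t^{-r/2}\bigr)\|a\|_{W^{k,p}_\theta}.$$ Consequently, $P_t$ extends to a bounded map from $W^{k,p}_\theta$ into $W^{k+r,p}_\theta$ for every $t>0$.
   Context: $\mathbb{N}_0=\{0,1,2,\dots\}$. Let $\theta=(\theta_{jk})$ be a real skew-symmetric $n\times n$ matrix. Let $U_1,\dots,U_n$ be unitaries with $U_kU_j=e^{2\pi i\theta_{kj}}U_jU_k$, realized in the standard representation on $\ell^2(\mathbb{Z}^n)$ (with canonical basis $(e_m)$): $U_je_m=e^{2\pi i\sum_{l<j}\theta_{jl}m_l}e_{m+\epsilon_j}$, where $\epsilon_j$ is the $j$-th unit vector. The noncommutative torus $\mathbb{T}_\theta^n$ is the von Neumann algebra they generate. For $m\in\mathbb{Z}^n$ put $U^m=U_1^{m_1}\cdots U_n^{m_n}$. The smooth algebra $\mathcal{A}_\theta^\infty$ is the set of all series $\sum_mc_mU^m$ with rapidly decreasing coefficients. The canonical trace $\tau$ is the faithful normal tracial state with $\tau(\sum c_mU^m)=c_0$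 on $\mathcal{A}_\theta^\infty$. For $1\le p<\infty$, $L^p(\mathbb{T}_\theta^n)$ is the completion of $\mathcal{A}_\theta^\infty$ for $\|a\|_{L^p(\mathbb{T}_\theta^n)}=(\tau(|a|^p))^{1/p}$. The canonical derivations act termwise on $\mathcal{A}_\theta^\infty$ by $\delta_j(U^m)=2\pi i\,m_jU^m$; $\delta^\alpha=\delta_1^{\alpha_1}\cdots\delta_n^{\alpha_n}$ and $|\alpha|=\alpha_1+\cdots+\alpha_n$ for $\alpha\in\mathbb{N}_0^n$. The heat semigroup is $P_t(U^m)=e^{-4\pi^2|m|^2t}U^m$ (termwise), $|m|^2=m_1^2+\cdots+m_n^2$; it is $e^{-tL}$ with $L=-\sum_j\delta_j^2$. For $a\in\mathcal{A}_\theta^\infty$ and $k\in\mathbb{N}_0$ set $|a|_{W^{k,p}_\theta}=\bigl(\sum_{|\alpha|=k}\|\delta^\alpha a\|_{L^p(\mathbb{T}_\theta^n)}^2\bigr)^{1/2}$ (with $\delta^0=\mathrm{Id}$) and $\|a\|_{W^{k,p}_\theta}=\sum_{j=0}^k|a|_{W^{j,p}_\theta}$. $W^{k,p}_\theta$ is the completion of $\mathcal{A}_\theta^\infty$ with respect to $\|\cdot\|_{W^{k,p}_\theta}$. *)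

theory Defs
  imports "HOL-Analysis.Analysis" "HOL-Computational_Algebra.Polynomial"
begin

section \<open>The complex Hilbert space of square-summable families\<close>

typedef 'a ell2 = "{f :: 'a \<Rightarrow> complex. (\<lambda>x. (cmod (f x))\<^sup>2) summable_on UNIV}"
  morphisms coord Abs_ell2
  by (rule exI[of _ "\<lambda>_. 0"]) simp

setup_lifting type_definition_ell2

lemma coord_summable: "(\<lambda>x. (cmod (coord f x))\<^sup>2) summable_on UNIV"
  using coord[of f] by simp

lemma cmod_mult_le_squares: "cmod (u * v) \<le> (cmod u)\<^sup>2 + (cmod v)\<^sup>2"
proof -
  have "0 \<le> (cmod u - cmod v)\<^sup>2" and "0 \<le> (cmod u)\<^sup>2 + (cmod v)\<^sup>2"
    by simp_all
  then show ?thesis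
    unfolding norm_mult power2_diff by linarith
qed

lemma square_summable_mult:
  assumes "(\<lambda>x. (cmod (f x))\<^sup>2) summable_on UNIV" "(\<lambda>x. (cmod (g x))\<^sup>2) summable_on UNIV"
  shows "(\<lambda>x. f x * cnj (g x)) summable_on UNIV"
proof (rule abs_summable_summable)
  have "(\<lambda>x. (cmod (f x))\<^sup>2 + (cmod (g x))\<^sup>2) summable_on UNIV"
    by (intro summable_on_add assms)
  then show "(\<lambda>x. norm (f x * cnj (g x))) summable_on UNIV"
    by (rule summable_on_comparison_test) (use cmod_mult_le_squares[of _ "cnj _"] in auto)
qed

lemma square_summable_add:
  assumes "(\<lambda>x. (cmod (f x))\<^sup>2) summable_on UNIV" "(\<lambda>x. (cmod (g x))\<^sup>2) summable_on UNIV"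
  shows "(\<lambda>x. (cmod (f x + g x))\<^sup>2) summable_on UNIV"
proof -
  have "(\<lambda>x. 2 * (cmod (f x))\<^sup>2 + 2 * (cmod (g x))\<^sup>2) summable_on UNIV"
    by (intro summable_on_add summable_on_cmult_right assms)
  then show ?thesis
  proof (rule summable_on_comparison_test)
    fix x
    have "(cmod (f x + g x))\<^sup>2 \<le> (cmod (f x) + cmod (g x))\<^sup>2"
      by (intro power_mono norm_triangle_ineq) simp
    also have "\<dots> \<le> 2 * (cmod (f x))\<^sup>2 + 2 * (cmod (g x))\<^sup>2"
      using zero_le_power2[of "cmod (f x) - cmod (g x)"]
      unfolding power2_diff power2_sum by linarith
    finally show "(cmod (f x + g x))\<^sup>2 \<le> 2 * (cmod (f x))\<^sup>2 + 2 * (cmod (g x))\<^sup>2" .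
  qed simp
qed

lemma square_summable_scale:
  assumes "(\<lambda>x. (cmod (f x))\<^sup>2) summable_on UNIV"
  shows "(\<lambda>x. (cmod (z * f x))\<^sup>2) summable_on UNIV"
  using summable_on_cmult_right[OF assms, of "(cmod z)\<^sup>2"]
  by (simp add: norm_mult power_mult_distrib)

lift_definition scaleC :: "complex \<Rightarrow> 'a ell2 \<Rightarrow> 'a ell2" is "\<lambda>z f x. z * f x"
  using square_summable_scale by auto

lift_definition basis_vec :: "'a \<Rightarrow> 'a ell2" is "\<lambda>m x. if x = m then 1 else 0"
proof -
  fix m :: 'a
  have "(\<lambda>x. (cmod (if x = m then 1 else 0))\<^sup>2) summable_on {m}"
    by (rule summable_on_finite) simp
  then show "(\<lambda>x. (cmod (if x = m then 1 else 0))\<^sup>2) summable_on UNIV"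
    by (subst summable_on_cong_neutral[where T = "{m}"]) auto
qed

text \<open>The inner product is linear in its first argument.\<close>

definition cinner :: "'a ell2 \<Rightarrow> 'a ell2 \<Rightarrow> complex" where
  "cinner f g = (\<Sum>\<^sub>\<infinity>x. coord f x * cnj (coord g x))"

lemma cinner_summable: "(\<lambda>x. coord f x * cnj (coord g x)) summable_on UNIV"
  by (intro square_summable_mult coord_summable)

instantiation ell2 :: (type) real_inner
begin

lift_definition zero_ell2 :: "'a ell2" is "\<lambda>_. 0" by simp
lift_definition plus_ell2 :: "'a ell2 \<Rightarrow> 'a ell2 \<Rightarrow> 'a ell2" is "\<lambda>f g x. f x + g x"
  using square_summable_add by auto
lift_definition uminus_ell2 :: "'a ell2 \<Rightarrow> 'a ell2" is "\<lambda>f x. - f x" by simp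
lift_definition minus_ell2 :: "'a ell2 \<Rightarrow> 'a ell2 \<Rightarrow> 'a ell2" is "\<lambda>f g x. f x - g x"
proof -
  fix f g :: "'a \<Rightarrow> complex"
  assume "(\<lambda>x. (cmod (f x))\<^sup>2) summable_on UNIV" "(\<lambda>x. (cmod (g x))\<^sup>2) summable_on UNIV"
  then show "(\<lambda>x. (cmod (f x - g x))\<^sup>2) summable_on UNIV"
    using square_summable_add[of f "\<lambda>x. - g x"] by simp
qed
lift_definition scaleR_ell2 :: "real \<Rightarrow> 'a ell2 \<Rightarrow> 'a ell2" is "\<lambda>r f x. of_real r * f x"
  using square_summable_scale by auto

definition inner_ell2 :: "'a ell2 \<Rightarrow> 'a ell2 \<Rightarrow> real" where
  "inner_ell2 f g = Re (cinner f g)"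
definition norm_ell2 :: "'a ell2 \<Rightarrow> real" where
  "norm_ell2 f = sqrt (inner f f)"
definition sgn_ell2 :: "'a ell2 \<Rightarrow> 'a ell2" where
  "sgn_ell2 f = scaleR (inverse (norm f)) f"
definition dist_ell2 :: "'a ell2 \<Rightarrow> 'a ell2 \<Rightarrow> real" where
  "dist_ell2 f g = norm (f - g)"
definition uniformity_ell2 :: "('a ell2 \<times> 'a ell2) filter" where
  "uniformity_ell2 = (INF e\<in>{0<..}. principal {(f, g). dist f g < e})"
definition open_ell2 :: "'a ell2 set \<Rightarrow> bool" where
  "open_ell2 U \<longleftrightarrow> (\<forall>x\<in>U. \<forall>\<^sub>F (x', y) in uniformity. x' = x \<longrightarrow> y \<in> U)"

instance
proof
  fix f g h :: "'a ell2" and r s :: real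
  show "f + g + h = f + (g + h)" "f + g = g + f" "0 + f = f" "- f + f = 0" "f - g = f + - g"
    by (transfer; force simp: algebra_simps)+
  show "scaleR r (f + g) = scaleR r f + scaleR r g" "scaleR (r + s) f = scaleR r f + scaleR s f"
    "scaleR r (scaleR s f) = scaleR (r * s) f" "scaleR 1 f = f"
    by (transfer; force simp: algebra_simps)+
  show "dist f g = norm (f - g)" "sgn f = scaleR (inverse (norm f)) f" "norm f = sqrt (inner f f)"
    by (simp_all add: dist_ell2_def sgn_ell2_def norm_ell2_def)
  show "uniformity = (INF e\<in>{0<..}. principal {(f :: 'a ell2, g). dist f g < e})"
    by (simp add: uniformity_ell2_def)
  show "open U = (\<forall>x\<in>U. \<forall>\<^sub>F (x', y) in uniformity. x' = x \<longrightarrow> y \<in> U)" for U :: "'a ell2 set"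
    by (simp add: open_ell2_def)
  have "cinner f g = cnj (cinner g f)"
    unfolding cinner_def infsum_cnj[symmetric] by (simp add: mult.commute)
  then show "inner f g = inner g f"
    by (simp add: inner_ell2_def)
  have "cinner (f + g) h = cinner f h + cinner g h"
    unfolding cinner_def
    by (subst infsum_add[symmetric]) (auto intro!: cinner_summable simp: plus_ell2.rep_eq algebra_simps)
  then show "inner (f + g) h = inner f h + inner g h"
    by (simp add: inner_ell2_def)
  have "cinner (scaleR r f) g = of_real r * cinner f g"
    unfolding cinner_def
    by (subst infsum_cmult_right[symmetric])
      (auto intro!: cinner_summable simp: scaleR_ell2.rep_eq mult.assoc)
  then show "inner (scaleR r f) g = r * inner f g"
    by (simp add: inner_ell2_def)
  have eq: "inner f f = (\<Sum>\<^sub>\<infinity>x. (cmod (coord f x))\<^sup>2)"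
  proof -
    have "cinner f f = (\<Sum>\<^sub>\<infinity>x. complex_of_real ((cmod (coord f x))\<^sup>2))"
      unfolding cinner_def by (simp add: complex_norm_square[symmetric] del: of_real_power)
    also have "\<dots> = of_real (\<Sum>\<^sub>\<infinity>x. (cmod (coord f x))\<^sup>2)"
      by (rule infsumI[OF has_sum_of_real[OF has_sum_infsum[OF coord_summable]]])
    finally show ?thesis
      by (simp add: inner_ell2_def)
  qed
  show "0 \<le> inner f f"
    unfolding eq by (rule infsum_nonneg) simp
  show "inner f f = 0 \<longleftrightarrow> f = 0"
  proof
    assume "inner f f = 0"
    then have "(cmod (coord f x))\<^sup>2 = 0" for x
      using nonneg_infsum_le_0D[of "\<lambda>x. (cmod (coord f x))\<^sup>2" UNIV x] coord_summable[of f]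
      by (simp add: eq)
    then show "f = 0"
      by (simp add: coord_inject[symmetric] fun_eq_iff zero_ell2.rep_eq)
  next
    assume "f = 0"
    then show "inner f f = 0"
      unfolding eq by (simp add: zero_ell2.rep_eq)
  qed
qed

end

lemma norm_sq_ell2: "(norm f)\<^sup>2 = (\<Sum>\<^sub>\<infinity>x. (cmod (coord f x))\<^sup>2)" for f :: "'a ell2"
proof -
  have "cinner f f = (\<Sum>\<^sub>\<infinity>x. complex_of_real ((cmod (coord f x))\<^sup>2))"
    unfolding cinner_def by (simp add: complex_norm_square[symmetric] del: of_real_power)
  also have "\<dots> = of_real (\<Sum>\<^sub>\<infinity>x. (cmod (coord f x))\<^sup>2)"
    by (rule infsumI[OF has_sum_of_real[OF has_sum_infsum[OF coord_summable]]])
  finally show ?thesis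
    by (simp add: power2_norm_eq_inner inner_ell2_def)
qed

lemma sum_coord_le_norm_sq:
  "finite F \<Longrightarrow> (\<Sum>x\<in>F. (cmod (coord f x))\<^sup>2) \<le> (norm f)\<^sup>2" for f :: "'a ell2"
  unfolding norm_sq_ell2 by (rule finite_sum_le_infsum[OF coord_summable]) auto

lemma cmod_coord_le_norm: "cmod (coord f x) \<le> norm f"
  using sum_coord_le_norm_sq[of "{x}" f] by (simp add: power2_le_iff_abs_le)

instance ell2 :: (type) banach
proof
  fix X :: "nat \<Rightarrow> 'a ell2"
  assume X: "Cauchy X"
  have "Cauchy (\<lambda>n. coord (X n) x)" for x
  proof (rule metric_CauchyI)
    fix e :: real assume "e > 0"
    then obtain M where M: "\<And>m n. m \<ge> M \<Longrightarrow> n \<ge> M \<Longrightarrow> dist (X m) (X n) < e"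
      using metric_CauchyD[OF X] by blast
    have "dist (coord (X m) x) (coord (X n) x) \<le> dist (X m) (X n)" for m n
      using cmod_coord_le_norm[of "X m - X n" x] by (simp add: dist_norm minus_ell2.rep_eq)
    then show "\<exists>M. \<forall>m\<ge>M. \<forall>n\<ge>M. dist (coord (X m) x) (coord (X n) x) < e"
      using M by (meson le_less_trans)
  qed
  then obtain g where g: "\<And>x. (\<lambda>n. coord (X n) x) \<longlonglongrightarrow> g x"
    unfolding Cauchy_convergent_iff convergent_def by metis
  have tail: "\<exists>M. \<forall>n\<ge>M. \<forall>F. finite F \<longrightarrow> (\<Sum>x\<in>F. (cmod (coord (X n) x - g x))\<^sup>2) \<le> e\<^sup>2"
    if "e > 0" for e
  proof -
    obtain M where M: "\<And>m n. m \<ge> M \<Longrightarrow> n \<ge> M \<Longrightarrow> dist (X m) (X n) < e"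
      using metric_CauchyD[OF X \<open>e > 0\<close>] by blast
    have "(\<Sum>x\<in>F. (cmod (coord (X n) x - g x))\<^sup>2) \<le> e\<^sup>2" if "n \<ge> M" "finite F" for n F
    proof (rule LIMSEQ_le_const2)
      show "(\<lambda>m. \<Sum>x\<in>F. (cmod (coord (X n) x - coord (X m) x))\<^sup>2)
          \<longlonglongrightarrow> (\<Sum>x\<in>F. (cmod (coord (X n) x - g x))\<^sup>2)"
        by (intro tendsto_intros g)
      have "(\<Sum>x\<in>F. (cmod (coord (X n) x - coord (X m) x))\<^sup>2) \<le> e\<^sup>2" if "m \<ge> M" for m
      proof -
        have "(\<Sum>x\<in>F. (cmod (coord (X n) x - coord (X m) x))\<^sup>2) \<le> (norm (X n - X m))\<^sup>2"
          using sum_coord_le_norm_sq[OF \<open>finite F\<close>, of "X n - X m"] by (simp add: minus_ell2.rep_eq)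
        also have "\<dots> \<le> e\<^sup>2"
          using M[OF \<open>n \<ge> M\<close> \<open>m \<ge> M\<close>] by (intro power_mono) (auto simp: dist_norm)
        finally show ?thesis .
      qed
      then show "\<exists>N. \<forall>m\<ge>N. (\<Sum>x\<in>F. (cmod (coord (X n) x - coord (X m) x))\<^sup>2) \<le> e\<^sup>2"
        by blast
    qed
    then show ?thesis by blast
  qed
  obtain M1 where "\<And>F. finite F \<Longrightarrow> (\<Sum>x\<in>F. (cmod (coord (X M1) x - g x))\<^sup>2) \<le> 1\<^sup>2"
    using tail[of 1] by auto
  then have "(\<lambda>x. (cmod (coord (X M1) x - g x))\<^sup>2) summable_on UNIV"
    by (intro nonneg_bdd_above_summable_on) (auto simp: bdd_above_def)
  from square_summable_add[OF coord_summable[of "X M1"], of "\<lambda>x. - (coord (X M1) x - g x)"] this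
  have "(\<lambda>x. (cmod (g x))\<^sup>2) summable_on UNIV"
    by (simp add: norm_minus_commute)
  then have coord_g: "coord (Abs_ell2 g) = g"
    by (simp add: Abs_ell2_inverse)
  have "X \<longlonglongrightarrow> Abs_ell2 g"
  proof (rule metric_LIMSEQ_I)
    fix e :: real assume "e > 0"
    then obtain M where M: "\<And>n F. n \<ge> M \<Longrightarrow> finite F \<Longrightarrow> (\<Sum>x\<in>F. (cmod (coord (X n) x - g x))\<^sup>2) \<le> (e/2)\<^sup>2"
      using tail[of "e/2"] by auto
    have "dist (X n) (Abs_ell2 g) < e" if "n \<ge> M" for n
    proof -
      have "(norm (X n - Abs_ell2 g))\<^sup>2 \<le> (e/2)\<^sup>2"
        unfolding norm_sq_ell2
        by (intro infsum_le_finite_sums coord_summable)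
          (use M[OF \<open>n \<ge> M\<close>] in \<open>auto simp: minus_ell2.rep_eq coord_g\<close>)
      then show ?thesis
        using \<open>e > 0\<close> by (simp add: dist_norm power2_le_iff_abs_le)
    qed
    then show "\<exists>M. \<forall>n\<ge>M. dist (X n) (Abs_ell2 g) < e" by blast
  qed
  then show "convergent X"
    unfolding convergent_def by blast
qed


section \<open>Bounded operators\<close>

text \<open>
  The type \<open>'a op\<close> consists of the real-linear bounded operators with the operator norm;
  the bounded operators in the usual sense form the set \<open>bounded_ops\<close>.
\<close>

type_synonym 'a op = "'a ell2 \<Rightarrow>\<^sub>L 'a ell2"

lemma scaleC_diff: "scaleC z (f - g) = scaleC z f - scaleC z g"
  by transfer (auto simp: algebra_simps)

lemma norm_scaleC: "norm (scaleC z f) = cmod z * norm f"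
proof -
  have "(norm (scaleC z f))\<^sup>2 = (cmod z * norm f)\<^sup>2"
    unfolding norm_sq_ell2 power_mult_distrib
    by (subst infsum_cmult_right[symmetric])
      (auto simp: coord_summable scaleC.rep_eq norm_mult power_mult_distrib)
  then show ?thesis
    by (simp add: power2_eq_iff_nonneg)
qed

lemma bounded_linear_scaleC: "bounded_linear (scaleC z)"
proof (rule bounded_linear_intro)
  show "scaleC z (f + g) = scaleC z f + scaleC z g" for f g
    by transfer (auto simp: algebra_simps)
  show "scaleC z (r *\<^sub>R f) = r *\<^sub>R scaleC z f" for r f
    by transfer (auto simp: algebra_simps)
  show "norm (scaleC z f) \<le> norm f * cmod z" for f
    by (simp add: norm_scaleC)
qed

definition op_scaleC :: "complex \<Rightarrow> 'a op \<Rightarrow> 'a op" where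
  "op_scaleC z A = Blinfun (scaleC z) o\<^sub>L A"

definition bounded_ops :: "'a op set" where
  "bounded_ops = {A :: 'a op. \<forall>z f. A (scaleC z f) = scaleC z (A f)}"

definition op_adj :: "'a op \<Rightarrow> 'a op" where
  "op_adj A = (THE B :: 'a op. \<forall>f g. cinner (A f) g = cinner f (B g))"

definition op_pow :: "'a op \<Rightarrow> nat \<Rightarrow> 'a op" where
  "op_pow A k = (((o\<^sub>L) A) ^^ k) id_blinfun"

text \<open>Integer powers of a unitary operator.\<close>

definition op_powi :: "'a op \<Rightarrow> int \<Rightarrow> 'a op" where
  "op_powi A k = (if 0 \<le> k then op_pow A (nat k) else op_pow (op_adj A) (nat (- k)))"

definition op_poly :: "real poly \<Rightarrow> 'a op \<Rightarrow> 'a op" where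
  "op_poly q A = (\<Sum>i\<le>degree q. coeff q i *\<^sub>R op_pow A i)"

definition op_pos :: "'a op \<Rightarrow> bool" where
  "op_pos A \<longleftrightarrow> A \<in> bounded_ops \<and> (\<forall>f. Im (cinner (A f) f) = 0 \<and> 0 \<le> Re (cinner (A f) f))"

definition op_le :: "'a op \<Rightarrow> 'a op \<Rightarrow> bool" where
  "op_le A B \<longleftrightarrow> op_pos (B - A)"

text \<open>
  Continuous functional calculus of a positive operator \<open>A\<close>, whose spectrum lies in
  \<open>[0, \<parallel>A\<parallel>]\<close>: the norm limit of \<open>q\<^sub>i(A)\<close> for polynomials \<open>q\<^sub>i\<close> converging to \<open>f\<close> uniformly on
  that interval.
\<close>

definition fun_calc :: "(real \<Rightarrow> real) \<Rightarrow> 'a op \<Rightarrow> 'a op" where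
  "fun_calc f A = (THE B. \<exists>q :: nat \<Rightarrow> real poly.
     uniform_limit {0..norm A} (\<lambda>i. poly (q i)) f sequentially \<and>
     (\<lambda>i. op_poly (q i) A) \<longlonglongrightarrow> B)"

definition op_abs :: "'a op \<Rightarrow> 'a op" where
  "op_abs A = fun_calc sqrt (op_adj A o\<^sub>L A)"

definition commutant :: "'a op set \<Rightarrow> 'a op set" where
  "commutant S = {T \<in> bounded_ops. \<forall>A\<in>S. T o\<^sub>L A = A o\<^sub>L T}"

text \<open>The von Neumann algebra generated by \<open>S\<close>, as the double commutant of the self-adjoint set \<open>S \<union> S\<^sup>*\<close>.\<close>

definition vN_generated :: "'a op set \<Rightarrow> 'a op set" where
  "vN_generated S = commutant (commutant (S \<union> op_adj ` S))"


section \<open>The noncommutative torus\<close>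

text \<open>
  The dimension \<open>n \<ge> 1\<close> is the cardinality of the finite linearly ordered index type \<open>'n\<close>;
  the order enters in the definition of \<open>U\<^sub>j\<close> and in the order of the factors of \<open>U\<^sup>m\<close>.
\<close>

definition weighted_perm :: "('a \<Rightarrow> complex) \<Rightarrow> ('a \<Rightarrow> 'a) \<Rightarrow> 'a ell2 \<Rightarrow> 'a ell2" where
  "weighted_perm w \<pi> f = Abs_ell2 (\<lambda>x. w x * coord f (\<pi> x))"

lemma coord_weighted_perm:
  assumes "\<And>x. cmod (w x) = 1" "bij \<pi>"
  shows "coord (weighted_perm w \<pi> f) = (\<lambda>x. w x * coord f (\<pi> x))"
proof -
  have "(\<lambda>x. (cmod (coord f (\<pi> x)))\<^sup>2) summable_on UNIV"
    using coord_summable[of f] summable_on_reindex_bij_betw[OF assms(2), of "\<lambda>x. (cmod (coord f x))\<^sup>2"]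
    by simp
  then have "(\<lambda>x. (cmod (w x * coord f (\<pi> x)))\<^sup>2) summable_on UNIV"
    by (simp add: norm_mult assms(1))
  then show ?thesis
    by (simp add: weighted_perm_def Abs_ell2_inverse)
qed

lemma norm_weighted_perm:
  assumes "\<And>x. cmod (w x) = 1" "bij \<pi>"
  shows "norm (weighted_perm w \<pi> f) = norm f"
proof -
  have "(norm (weighted_perm w \<pi> f))\<^sup>2 = (norm f)\<^sup>2"
    unfolding norm_sq_ell2 coord_weighted_perm[OF assms]
    using infsum_reindex_bij_betw[OF assms(2), of "\<lambda>x. (cmod (coord f x))\<^sup>2"]
    by (simp add: norm_mult assms(1))
  then show ?thesis
    by simp
qed

lemma bounded_linear_weighted_perm:
  assumes "\<And>x. cmod (w x) = 1" "bij \<pi>"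
  shows "bounded_linear (weighted_perm w \<pi>)"
  by (rule bounded_linear_intro[where K = 1])
    (simp_all add: coord_inject[symmetric] coord_weighted_perm[OF assms] plus_ell2.rep_eq
      scaleR_ell2.rep_eq norm_weighted_perm[OF assms] algebra_simps)

type_synonym 'n rmatrix = "real^'n^'n"
type_synonym 'n lattice = "int^'n"
type_synonym 'n multiindex = "nat^'n"

definition nc_phase :: "'n::{finite,linorder} rmatrix \<Rightarrow> 'n \<Rightarrow> 'n lattice \<Rightarrow> complex" where
  "nc_phase \<theta> j m = cis (2 * pi * (\<Sum>l | l < j. \<theta> $ j $ l * of_int (m $ l)))"

definition nc_U :: "'n::{finite,linorder} rmatrix \<Rightarrow> 'n \<Rightarrow> 'n lattice op" where
  "nc_U \<theta> j = Blinfun (weighted_perm (\<lambda>m. nc_phase \<theta> j (m - axis j 1)) (\<lambda>m. m - axis j 1))"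

lemma coord_nc_U: "coord (nc_U \<theta> j f) m = nc_phase \<theta> j (m - axis j 1) * coord f (m - axis j 1)"
proof -
  have w: "cmod (nc_phase \<theta> j (m - axis j 1)) = 1" for m
    by (simp add: nc_phase_def)
  have "bij (\<lambda>m :: 'a lattice. m - axis j 1)"
    by (rule bij_betw_byWitness[where f' = "\<lambda>m. m + axis j 1"]) auto
  from bounded_linear_weighted_perm[OF w this] coord_weighted_perm[OF w this] show ?thesis
    by (simp add: nc_U_def bounded_linear_Blinfun_apply)
qed

lemma nc_U_basis_vec:
  "nc_U \<theta> j (basis_vec m) = scaleC (nc_phase \<theta> j m) (basis_vec (m + axis j 1))"
  by (auto simp: coord_inject[symmetric] fun_eq_iff coord_nc_U scaleC.rep_eq basis_vec.rep_eq)

definition nc_torus :: "'n::{finite,linorder} rmatrix \<Rightarrow> 'n lattice op set" where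
  "nc_torus \<theta> = vN_generated (range (nc_U \<theta>))"

text \<open>The ordered product \<open>U\<^sub>1\<^bsup>m\<^sub>1\<^esup> \<cdots> U\<^sub>n\<^bsup>m\<^sub>n\<^esup>\<close>.\<close>

definition nc_monom :: "'n::{finite,linorder} rmatrix \<Rightarrow> 'n lattice \<Rightarrow> 'n lattice op" where
  "nc_monom \<theta> m =
     foldr (\<lambda>j B. op_powi (nc_U \<theta> j) (m $ j) o\<^sub>L B) (sorted_list_of_set UNIV) id_blinfun"

definition int_norm_sq :: "'n::finite lattice \<Rightarrow> real" where
  "int_norm_sq m = (\<Sum>j\<in>UNIV. (of_int (m $ j))\<^sup>2)"

definition rapidly_decreasing :: "('n::finite lattice \<Rightarrow> complex) \<Rightarrow> bool" where
  "rapidly_decreasing c \<longleftrightarrow>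
     (\<forall>N :: nat. \<exists>K. \<forall>m. (1 + sqrt (int_norm_sq m)) ^ N * cmod (c m) \<le> K)"

definition nc_series :: "'n::{finite,linorder} rmatrix \<Rightarrow> ('n lattice \<Rightarrow> complex) \<Rightarrow> 'n lattice op" where
  "nc_series \<theta> c = (\<Sum>\<^sub>\<infinity>m. op_scaleC (c m) (nc_monom \<theta> m))"

definition smooth_alg :: "'n::{finite,linorder} rmatrix \<Rightarrow> 'n lattice op set" where
  "smooth_alg \<theta> = nc_series \<theta> ` {c. rapidly_decreasing c}"

definition nc_coeff :: "'n::{finite,linorder} rmatrix \<Rightarrow> 'n lattice op \<Rightarrow> 'n lattice \<Rightarrow> complex" where
  "nc_coeff \<theta> a = (THE c. rapidly_decreasing c \<and> a = nc_series \<theta> c)"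

subsection \<open>The canonical trace\<close>

definition normal_functional :: "'a op set \<Rightarrow> ('a op \<Rightarrow> complex) \<Rightarrow> bool" where
  "normal_functional M \<tau> \<longleftrightarrow>
     (\<forall>D s. D \<subseteq> M \<longrightarrow> D \<noteq> {} \<longrightarrow> s \<in> M \<longrightarrow> (\<forall>A\<in>D. op_pos A \<and> op_le A s) \<longrightarrow>
        (\<forall>A\<in>D. \<forall>B\<in>D. \<exists>C\<in>D. op_le A C \<and> op_le B C) \<longrightarrow>
        (\<forall>f. Re (cinner (s f) f) = (SUP A\<in>D. Re (cinner (blinfun_apply A f) f))) \<longrightarrow>
        Re (\<tau> s) = (SUP A\<in>D. Re (\<tau> A)))"

definition faithful_normal_tracial_state :: "'a op set \<Rightarrow> ('a op \<Rightarrow> complex) \<Rightarrow> bool" where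
  "faithful_normal_tracial_state M \<tau> \<longleftrightarrow>
     (\<forall>x\<in>M. \<forall>y\<in>M. \<tau> (x + y) = \<tau> x + \<tau> y) \<and>
     (\<forall>z. \<forall>x\<in>M. \<tau> (op_scaleC z x) = z * \<tau> x) \<and>
     (\<forall>x\<in>M. op_pos x \<longrightarrow> Im (\<tau> x) = 0 \<and> 0 \<le> Re (\<tau> x)) \<and>
     \<tau> id_blinfun = 1 \<and>
     (\<forall>x\<in>M. op_pos x \<longrightarrow> \<tau> x = 0 \<longrightarrow> x = 0) \<and>
     (\<forall>x\<in>M. \<forall>y\<in>M. \<tau> (x o\<^sub>L y) = \<tau> (y o\<^sub>L x)) \<and>
     normal_functional M \<tau>"

definition is_canonical_trace ::
    "'n::{finite,linorder} rmatrix \<Rightarrow> ('n lattice op \<Rightarrow> complex) \<Rightarrow> bool" where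
  "is_canonical_trace \<theta> \<tau> \<longleftrightarrow>
     faithful_normal_tracial_state (nc_torus \<theta>) \<tau> \<and>
     (\<forall>c. rapidly_decreasing c \<longrightarrow> \<tau> (nc_series \<theta> c) = c 0)"

text \<open>
  Such a trace exists (\<open>canonical_trace_exists\<close> below). A state is norm continuous, so its values on
  the norm closure of the smooth algebra are determined by the last condition. All operators
  \<open>|a|\<^sup>p\<close> with \<open>a\<close> smooth lie in that closure.
\<close>

definition nc_trace :: "'n::{finite,linorder} rmatrix \<Rightarrow> 'n lattice op \<Rightarrow> complex" where
  "nc_trace \<theta> = (SOME \<tau>. is_canonical_trace \<theta> \<tau>)"

definition Lp_norm :: "'n::{finite,linorder} rmatrix \<Rightarrow> real \<Rightarrow> 'n lattice op \<Rightarrow> real" where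
  "Lp_norm \<theta> p a = Re (nc_trace \<theta> (fun_calc (\<lambda>x. x powr p) (op_abs a))) powr (1 / p)"

subsection \<open>Derivations, heat semigroup and Sobolev norms\<close>

definition nc_deriv ::
    "'n::{finite,linorder} rmatrix \<Rightarrow> 'n \<Rightarrow> 'n lattice op \<Rightarrow> 'n lattice op" where
  "nc_deriv \<theta> j a = nc_series \<theta> (\<lambda>m. 2 * pi * \<i> * of_int (m $ j) * nc_coeff \<theta> a m)"

definition nc_deriv_multi ::
    "'n::{finite,linorder} rmatrix \<Rightarrow> 'n multiindex \<Rightarrow> 'n lattice op \<Rightarrow> 'n lattice op" where
  "nc_deriv_multi \<theta> \<alpha> a =
     foldr (\<lambda>j. nc_deriv \<theta> j ^^ (\<alpha> $ j)) (sorted_list_of_set UNIV) a"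

definition heat :: "'n::{finite,linorder} rmatrix \<Rightarrow> real \<Rightarrow> 'n lattice op \<Rightarrow> 'n lattice op" where
  "heat \<theta> t a =
     nc_series \<theta> (\<lambda>m. of_real (exp (- 4 * pi\<^sup>2 * int_norm_sq m * t)) * nc_coeff \<theta> a m)"

definition sobolev_seminorm ::
    "'n::{finite,linorder} rmatrix \<Rightarrow> nat \<Rightarrow> real \<Rightarrow> 'n lattice op \<Rightarrow> real" where
  "sobolev_seminorm \<theta> k p a =
     sqrt (\<Sum>\<alpha> | (\<Sum>j\<in>UNIV. \<alpha> $ j) = k. (Lp_norm \<theta> p (nc_deriv_multi \<theta> \<alpha> a))\<^sup>2)"

definition sobolev_norm ::
    "'n::{finite,linorder} rmatrix \<Rightarrow> nat \<Rightarrow> real \<Rightarrow> 'n lattice op \<Rightarrow> real" where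
  "sobolev_norm \<theta> k p a = (\<Sum>j\<le>k. sobolev_seminorm \<theta> j p a)"


section \<open>Completions\<close>

text \<open>
  The completion of a vector space \<open>V\<close> of operators with respect to a norm \<open>N\<close> on it:
  \<open>N\<close>-Cauchy sequences in \<open>V\<close> modulo \<open>N\<close>-null sequences.
\<close>

definition cauchy_seqs :: "'a op set \<Rightarrow> ('a op \<Rightarrow> real) \<Rightarrow> (nat \<Rightarrow> 'a op) set" where
  "cauchy_seqs V N =
     {x. range x \<subseteq> V \<and> (\<forall>e>0. \<exists>M. \<forall>i\<ge>M. \<forall>j\<ge>M. N (x i - x j) < e)}"

definition null_rel :: "'a op set \<Rightarrow> ('a op \<Rightarrow> real) \<Rightarrow> ((nat \<Rightarrow> 'a op) \<times> (nat \<Rightarrow> 'a op)) set" where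
  "null_rel V N =
     {(x, y). x \<in> cauchy_seqs V N \<and> y \<in> cauchy_seqs V N \<and> (\<lambda>i. N (x i - y i)) \<longlonglongrightarrow> 0}"

definition completion :: "'a op set \<Rightarrow> ('a op \<Rightarrow> real) \<Rightarrow> (nat \<Rightarrow> 'a op) set set" where
  "completion V N = cauchy_seqs V N // null_rel V N"

definition compl_embed :: "'a op set \<Rightarrow> ('a op \<Rightarrow> real) \<Rightarrow> 'a op \<Rightarrow> (nat \<Rightarrow> 'a op) set" where
  "compl_embed V N a = null_rel V N `` {\<lambda>_. a}"

definition compl_add ::
    "'a op set \<Rightarrow> ('a op \<Rightarrow> real) \<Rightarrow> (nat \<Rightarrow> 'a op) set \<Rightarrow> (nat \<Rightarrow> 'a op) set \<Rightarrow> (nat \<Rightarrow> 'a op) set" where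
  "compl_add V N X Y = null_rel V N `` {\<lambda>i. x i + y i | x y. x \<in> X \<and> y \<in> Y}"

definition compl_scale ::
    "'a op set \<Rightarrow> ('a op \<Rightarrow> real) \<Rightarrow> complex \<Rightarrow> (nat \<Rightarrow> 'a op) set \<Rightarrow> (nat \<Rightarrow> 'a op) set" where
  "compl_scale V N z X = null_rel V N `` {\<lambda>i. op_scaleC z (x i) | x. x \<in> X}"

definition compl_norm :: "('a op \<Rightarrow> real) \<Rightarrow> (nat \<Rightarrow> 'a op) set \<Rightarrow> real" where
  "compl_norm N X = (THE L. \<forall>x\<in>X. (\<lambda>i. N (x i)) \<longlonglongrightarrow> L)"

definition compl_bounded_linear ::
    "'a op set \<Rightarrow> ('a op \<Rightarrow> real) \<Rightarrow> ('a op \<Rightarrow> real) \<Rightarrow>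
     ((nat \<Rightarrow> 'a op) set \<Rightarrow> (nat \<Rightarrow> 'a op) set) \<Rightarrow> bool" where
  "compl_bounded_linear V N N' T \<longleftrightarrow>
     T \<in> completion V N \<rightarrow> completion V N' \<and>
     (\<forall>X\<in>completion V N. \<forall>Y\<in>completion V N. T (compl_add V N X Y) = compl_add V N' (T X) (T Y)) \<and>
     (\<forall>z. \<forall>X\<in>completion V N. T (compl_scale V N z X) = compl_scale V N' z (T X)) \<and>
     (\<exists>B. \<forall>X\<in>completion V N. compl_norm N' (T X) \<le> B * compl_norm N X)"


section \<open>Consistency: commutation relations, coefficients, and existence of the trace\<close>


lemma coord_eqI: "(\<And>x. coord f x = coord g x) \<Longrightarrow> f = g"
  by (simp add: coord_inject[symmetric] fun_eq_iff)

lemma cinner_basis: "cinner f (basis_vec m) = coord f m"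
proof -
  have "cinner f (basis_vec m) = (\<Sum>\<^sub>\<infinity>x\<in>{m}. coord f x)"
    unfolding cinner_def by (rule infsum_cong_neutral) (auto simp: basis_vec.rep_eq)
  then show ?thesis by simp
qed

lemma cinner_commute: "cinner f g = cnj (cinner g f)"
  unfolding cinner_def infsum_cnj[symmetric] by (simp add: mult.commute)

lemma op_adj_eqI:
  fixes A B :: "'a op"
  assumes "\<And>f g. cinner (A f) g = cinner f (B g)"
  shows "op_adj A = B"
  unfolding op_adj_def
proof (rule the_equality)
  fix B' :: "'a op" assume B': "\<forall>f g. cinner (A f) g = cinner f (B' g)"
  have "coord (B' g) m = coord (B g) m" for g m
  proof -
    have "cinner (basis_vec m) (B' g) = cinner (basis_vec m) (B g)"
      using assms B' by simp
    then show ?thesis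
      by (subst (asm) (1 2) cinner_commute) (simp add: cinner_basis)
  qed
  then show "B' = B"
    by (intro blinfun_eqI coord_eqI)
qed (use assms in blast)

text \<open>The adjoint of \<open>U\<^sub>j\<close>.\<close>

definition nc_W :: "'n::{finite,linorder} rmatrix \<Rightarrow> 'n \<Rightarrow> 'n lattice op" where
  "nc_W \<theta> j = Blinfun (weighted_perm (\<lambda>m. cnj (nc_phase \<theta> j m)) (\<lambda>m. m + axis j 1))"

lemma bij_add: "bij (\<lambda>m :: 'n::finite lattice. m + k)"
  by (rule bij_betw_byWitness[where f' = "\<lambda>m. m - k"]) auto
lemma bij_diff: "bij (\<lambda>m :: 'n::finite lattice. m - k)"
  by (rule bij_betw_byWitness[where f' = "\<lambda>m. m + k"]) auto
lemma cmod_phase [simp]: "cmod (nc_phase \<theta> j m) = 1" by (simp add: nc_phase_def)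

lemma coord_nc_W: "coord (nc_W \<theta> j f) m = cnj (nc_phase \<theta> j m) * coord f (m + axis j 1)"
proof -
  have w: "cmod (cnj (nc_phase \<theta> j m)) = 1" for m by simp
  from bounded_linear_weighted_perm[where w = "\<lambda>m. cnj (nc_phase \<theta> j m)", OF w bij_add] coord_weighted_perm[where w = "\<lambda>m. cnj (nc_phase \<theta> j m)", OF w bij_add] show ?thesis
    by (simp add: nc_W_def bounded_linear_Blinfun_apply)
qed

lemma phase_cnj [simp]: "nc_phase \<theta> j m * cnj (nc_phase \<theta> j m) = 1"
  by (simp add: complex_norm_square[symmetric])
lemma phase_cnj' [simp]: "cnj (nc_phase \<theta> j m) * nc_phase \<theta> j m = 1"
  by (metis phase_cnj mult.commute)

lemma adj_U: "op_adj (nc_U \<theta> j) = nc_W \<theta> j"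
proof (rule op_adj_eqI)
  fix f g :: "'a lattice ell2"
  have "cinner (nc_U \<theta> j f) g = (\<Sum>\<^sub>\<infinity>m. nc_phase \<theta> j m * coord f m * cnj (coord g (m + axis j 1)))"
    unfolding cinner_def coord_nc_U
    using infsum_reindex_bij_betw[OF bij_diff[of "axis j 1"], of "\<lambda>m. nc_phase \<theta> j m * coord f m * cnj (coord g (m + axis j 1))"]
    by simp
  then show "cinner (nc_U \<theta> j f) g = cinner f (nc_W \<theta> j g)"
    by (simp add: cinner_def coord_nc_W mult_ac)
qed

lemma UW: "nc_U \<theta> j (nc_W \<theta> j f) = f" and WU: "nc_W \<theta> j (nc_U \<theta> j f) = f"
  by (auto intro!: coord_eqI simp: coord_nc_U coord_nc_W mult.assoc[symmetric])

lemma phase_shift: "nc_phase \<theta> k (m + axis j 1) = nc_phase \<theta> k m * (if j < k then cis (2 * pi * \<theta> $ k $ j) else 1)"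
proof -
  have "(\<Sum>l | l < k. \<theta> $ k $ l * of_int ((m + axis j 1) $ l)) =
     (\<Sum>l | l < k. \<theta> $ k $ l * of_int (m $ l)) + (\<Sum>l | l < k. if l = j then \<theta> $ k $ l else 0)"
    unfolding sum.distrib[symmetric]
    by (rule sum.cong) (simp_all add: axis_def algebra_simps)
  also have "(\<Sum>l | l < k. if l = j then \<theta> $ k $ l else 0) = (if j < k then \<theta> $ k $ j else 0)"
    by (subst sum.delta) auto
  finally show ?thesis
    by (auto simp: nc_phase_def cis_mult algebra_simps)
qed

lemma skew_nth: assumes "transpose \<theta> = - (\<theta> :: 'n::finite rmatrix)" shows "\<theta> $ j $ k = - \<theta> $ k $ j"
proof -
  have "transpose \<theta> $ k $ j = (- \<theta>) $ k $ j" using assms by simp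
  then show ?thesis by (simp add: transpose_def)
qed

lemma phase_shift': "nc_phase \<theta> k (m - axis j 1) = nc_phase \<theta> k m * (if j < k then cis (- 2 * pi * \<theta> $ k $ j) else 1)"
  using phase_shift[of \<theta> k "m - axis j 1" j] by (auto simp: cis_mult mult.assoc)

lemma nc_U_commutation:
  assumes "transpose \<theta> = - (\<theta> :: 'n::{finite,linorder} rmatrix)"
  shows "nc_U \<theta> k o\<^sub>L nc_U \<theta> j = op_scaleC (cis (2 * pi * \<theta> $ k $ j)) (nc_U \<theta> j o\<^sub>L nc_U \<theta> k)"
proof (intro blinfun_eqI coord_eqI)
  fix f and m :: "'n lattice"
  have z: "\<theta> $ j $ j = 0" for j using skew_nth[OF assms, of j j] by simp
  have s: "\<theta> $ j $ k = - \<theta> $ k $ j" by (rule skew_nth[OF assms])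
  have c: "m - axis k 1 - axis j 1 = m - axis j 1 - axis k 1" by (simp add: diff_diff_eq add.commute)
  show "coord ((nc_U \<theta> k o\<^sub>L nc_U \<theta> j) f) m = coord (op_scaleC (cis (2 * pi * \<theta> $ k $ j)) (nc_U \<theta> j o\<^sub>L nc_U \<theta> k) f) m"
    unfolding op_scaleC_def
    by (cases k j rule: linorder_cases)
     (auto simp: bounded_linear_scaleC bounded_linear_Blinfun_apply scaleC.rep_eq coord_nc_U phase_shift' c s z cis_mult mult_ac;
       auto simp: mult.assoc[symmetric] cis_mult)+
qed

lemma apply_scaleC [simp]: "blinfun_apply (op_scaleC z A) f = scaleC z (A f)"
  by (simp add: op_scaleC_def bounded_linear_scaleC bounded_linear_Blinfun_apply)

lemma norm_U: "norm (nc_U \<theta> j f) = norm f"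
proof -
  have w: "cmod (nc_phase \<theta> j (m - axis j 1)) = 1" for m by simp
  show ?thesis
  using norm_weighted_perm[where w = "\<lambda>m. nc_phase \<theta> j (m - axis j 1)", OF w bij_diff] bounded_linear_weighted_perm[where w = "\<lambda>m. nc_phase \<theta> j (m - axis j 1)", OF w bij_diff]
    by (simp add: nc_U_def bounded_linear_Blinfun_apply)
qed
lemma norm_W: "norm (nc_W \<theta> j f) = norm f"
  by (metis norm_U UW)

lemma powi_induct:
  fixes P :: "'n::{finite,linorder} lattice op \<Rightarrow> bool"
  assumes "P id_blinfun" "\<And>B. P B \<Longrightarrow> P (nc_U \<theta> j o\<^sub>L B)" "\<And>B. P B \<Longrightarrow> P (nc_W \<theta> j o\<^sub>L B)"
  shows "P (op_powi (nc_U \<theta> j) k)"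
proof -
  have "P (op_pow (nc_U \<theta> j) n)" "P (op_pow (nc_W \<theta> j) n)" for n
    by (induction n) (auto simp: op_pow_def assms)
  then show ?thesis by (simp add: op_powi_def adj_U)
qed

lemma norm_powi: "norm (op_powi (nc_U \<theta> j) k f) = norm f"
proof -
  have "\<forall>f. norm (op_powi (nc_U \<theta> j) k f) = norm f"
    by (rule powi_induct[where P = "\<lambda>A. \<forall>f. norm (blinfun_apply A f) = norm f"]) (auto simp: norm_U norm_W)
  then show ?thesis by blast
qed

lemma norm_monom: "norm (nc_monom \<theta> m f) = norm f"
proof -
  have "norm (foldr (\<lambda>j B. op_powi (nc_U \<theta> j) (m $ j) o\<^sub>L B) xs id_blinfun f) = norm f" for xs
    by (induction xs arbitrary: f) (auto simp: norm_powi)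
  then show ?thesis by (simp add: nc_monom_def)
qed

lemma phase_zero: "(\<And>l. l < j \<Longrightarrow> m $ l = 0) \<Longrightarrow> nc_phase \<theta> j m = 1"
  by (simp add: nc_phase_def)

lemma scaleC_1[simp]: "scaleC 1 f = f" by (rule coord_eqI) (simp add: scaleC.rep_eq)

lemma W_basis: "nc_W \<theta> j (basis_vec m) = scaleC (cnj (nc_phase \<theta> j (m - axis j 1))) (basis_vec (m - axis j 1))"
  by (auto intro!: coord_eqI simp: coord_nc_W scaleC.rep_eq basis_vec.rep_eq algebra_simps)

lemma powi_basis:
  assumes "\<And>l. l < j \<Longrightarrow> m $ l = 0"
  shows "op_powi (nc_U \<theta> j) k (basis_vec m) = basis_vec (m + axis j k)"
proof -
  have 1: "op_pow (nc_U \<theta> j) n (basis_vec m) = basis_vec (m + axis j (int n))" for n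
  proof (induction n)
    case (Suc n)
    have "nc_phase \<theta> j (m + axis j (int n)) = 1"
      by (rule phase_zero) (use assms in \<open>auto simp: axis_def\<close>)
    moreover have e: "m + axis j (int n) + axis j 1 = m + axis j (int (Suc n))"
      by (simp add: vec_eq_iff axis_def)
    ultimately show ?case using Suc by (simp add: op_pow_def nc_U_basis_vec e)
  qed (simp add: op_pow_def axis_eq_0_iff[THEN iffD2])
  have 2: "op_pow (nc_W \<theta> j) n (basis_vec m) = basis_vec (m + axis j (- int n))" for n
  proof (induction n)
    case (Suc n)
    have "nc_phase \<theta> j (m + axis j (- int n) - axis j 1) = 1"
      by (rule phase_zero) (use assms in \<open>auto simp: axis_def\<close>)
    moreover have e: "m + axis j (- int n) - axis j 1 = m + axis j (- int (Suc n))"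
      by (simp add: vec_eq_iff axis_def)
    ultimately show ?case using Suc by (simp add: op_pow_def W_basis e)
  qed (simp add: op_pow_def axis_eq_0_iff[THEN iffD2])
  show ?thesis
    using 1[of "nat k"] 2[of "nat (-k)"] by (auto simp: op_powi_def adj_U)
qed

lemma monom_basis_0: "nc_monom \<theta> m (basis_vec 0) = basis_vec m"
proof -
  have "foldr (\<lambda>j B. op_powi (nc_U \<theta> j) (m $ j) o\<^sub>L B) xs id_blinfun (basis_vec 0) =
     basis_vec (\<chi> j. if j \<in> set xs then m $ j else 0)" if "sorted xs" "distinct xs" for xs
    using that
  proof (induction xs)
    case Nil
    then show ?case by (simp add: vec_eq_iff zero_vec_def)
  next
    case (Cons j xs)
    have *: "(\<chi> i. if i \<in> set xs then m $ i else 0) + axis j (m $ j) = (\<chi> i. if i \<in> set (j # xs) then m $ i else 0)"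
      using Cons.prems by (auto simp: vec_eq_iff axis_def)
    have "op_powi (nc_U \<theta> j) (m $ j) (basis_vec (\<chi> i. if i \<in> set xs then m $ i else 0)) = basis_vec ((\<chi> i. if i \<in> set xs then m $ i else 0) + axis j (m $ j))"
      by (rule powi_basis) (use Cons.prems in auto)
    then show ?case using Cons * by simp
  qed
  from this[of "sorted_list_of_set UNIV"] show ?thesis
    by (simp add: nc_monom_def)
qed

text \<open>Unitaries \<open>V\<^sub>k\<close> in the commutant of the torus, with \<open>V\<^sub>k e\<^sub>0 = e\<^sub>k\<close>.\<close>

definition nc_R :: "'n::{finite,linorder} rmatrix \<Rightarrow> 'n lattice \<Rightarrow> 'n lattice \<Rightarrow> complex" where
  "nc_R \<theta> k m = cis (2 * pi * (\<Sum>j\<in>UNIV. of_int (m $ j) * (\<Sum>l | l < j. \<theta> $ j $ l * of_int (k $ l))))"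

definition nc_V :: "'n::{finite,linorder} rmatrix \<Rightarrow> 'n lattice \<Rightarrow> 'n lattice op" where
  "nc_V \<theta> k = Blinfun (weighted_perm (\<lambda>m. nc_R \<theta> k (m - k)) (\<lambda>m. m - k))"

lemma coord_V: "coord (nc_V \<theta> k f) m = nc_R \<theta> k (m - k) * coord f (m - k)"
proof -
  have w: "cmod (nc_R \<theta> k (m - k)) = 1" for m by (simp add: nc_R_def)
  from bounded_linear_weighted_perm[where w = "\<lambda>m. nc_R \<theta> k (m - k)", OF w bij_diff] coord_weighted_perm[where w = "\<lambda>m. nc_R \<theta> k (m - k)", OF w bij_diff] show ?thesis
    by (simp add: nc_V_def bounded_linear_Blinfun_apply)
qed

lemma V_0: "nc_V \<theta> k (basis_vec 0) = basis_vec k"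
  by (rule coord_eqI) (auto simp: coord_V basis_vec.rep_eq nc_R_def)

lemma R_shift: "nc_R \<theta> k (m - axis j 1) = nc_R \<theta> k m * cnj (nc_phase \<theta> j k)"
proof -
  have eq1: "(\<Sum>i\<in>UNIV. of_int ((m - axis j 1) $ i) * (\<Sum>l | l < i. \<theta> $ i $ l * of_int (k $ l))) =
     (\<Sum>i\<in>UNIV. of_int (m $ i) * (\<Sum>l | l < i. \<theta> $ i $ l * of_int (k $ l)))
     - (\<Sum>i\<in>UNIV. if i = j then (\<Sum>l | l < i. \<theta> $ i $ l * of_int (k $ l)) else 0)"
    unfolding sum_subtractf[symmetric]
    by (rule sum.cong) (simp_all add: axis_def algebra_simps)
  then show ?thesis
    unfolding nc_R_def eq1 by (simp add: nc_phase_def cis_cnj cis_mult right_diff_distrib)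
qed

lemma phase_diff: "nc_phase \<theta> j (m - k) = nc_phase \<theta> j m * cnj (nc_phase \<theta> j k)"
  by (simp add: nc_phase_def cis_cnj cis_mult algebra_simps sum_subtractf)

lemma V_U: "nc_V \<theta> k (nc_U \<theta> j f) = nc_U \<theta> j (nc_V \<theta> k f)"
proof (rule coord_eqI)
  fix m
  have c: "m - axis j 1 - k = m - k - axis j 1" by (simp add: diff_diff_eq add.commute)
  have "nc_phase \<theta> j (m - axis j 1) = nc_phase \<theta> j (m - k - axis j 1) * nc_phase \<theta> j k"
    unfolding c[symmetric] phase_diff[of \<theta> j "m - axis j 1" k] by (simp add: mult.assoc)
  moreover have "nc_R \<theta> k (m - axis j 1 - k) = nc_R \<theta> k (m - k) * cnj (nc_phase \<theta> j k)"
    unfolding c R_shift ..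
  ultimately have "nc_phase \<theta> j (m - axis j 1) * (nc_R \<theta> k (m - axis j 1 - k) * coord f (m - axis j 1 - k))
      = (nc_phase \<theta> j k * cnj (nc_phase \<theta> j k))
        * (nc_R \<theta> k (m - k) * (nc_phase \<theta> j (m - k - axis j 1) * coord f (m - axis j 1 - k)))"
    by (simp only: mult_ac)
  then show "coord (nc_V \<theta> k (nc_U \<theta> j f)) m = coord (nc_U \<theta> j (nc_V \<theta> k f)) m"
    unfolding coord_V coord_nc_U by (simp only: c phase_cnj mult_1_left)
qed

lemma V_W: "nc_V \<theta> k (nc_W \<theta> j f) = nc_W \<theta> j (nc_V \<theta> k f)"
  by (metis V_U UW WU)

lemma V_bdd: "nc_V \<theta> k \<in> bounded_ops"
  by (auto simp: bounded_ops_def intro!: coord_eqI simp: coord_V scaleC.rep_eq)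

lemma V_comm: assumes "x \<in> nc_torus \<theta>" shows "blinfun_apply x (nc_V \<theta> k f) = nc_V \<theta> k (x f)"
proof -
  have "nc_V \<theta> k \<in> commutant (range (nc_U \<theta>) \<union> op_adj ` range (nc_U \<theta>))"
    by (auto simp: commutant_def V_bdd adj_U V_U V_W intro!: blinfun_eqI)
  then have "x o\<^sub>L nc_V \<theta> k = nc_V \<theta> k o\<^sub>L x"
    using assms by (auto simp: nc_torus_def vN_generated_def commutant_def)
  then show ?thesis by (metis blinfun_apply_blinfun_compose)
qed

definition vector_state :: "'n::{finite,linorder} lattice op \<Rightarrow> complex" where "vector_state x = coord (blinfun_apply x (basis_vec 0)) 0"

lemma bl_coord: "bounded_linear (\<lambda>f. coord f m)"
  by (rule bounded_linear_intro[where K = 1])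
   (auto simp: plus_ell2.rep_eq scaleR_ell2.rep_eq cmod_coord_le_norm scaleR_conv_of_real)

lemma norm_basis: "norm (basis_vec m) = 1"
proof -
  have "(norm (basis_vec m))\<^sup>2 = (\<Sum>\<^sub>\<infinity>x\<in>{m}. 1)"
    unfolding norm_sq_ell2 by (rule infsum_cong_neutral) (auto simp: basis_vec.rep_eq)
  then have "(norm (basis_vec m))\<^sup>2 = 1\<^sup>2" by simp
  then show ?thesis by (subst (asm) power2_eq_iff_nonneg) auto
qed

lemma summable_on_int_inverse_squares: "(\<lambda>m::int. 1 / (1 + (of_int m)\<^sup>2) :: real) summable_on UNIV"
proof -
  have "summable (\<lambda>n. 1 / (1 + (real n)\<^sup>2))"
  proof (rule summable_comparison_test'[where N = 1])
    show "summable (\<lambda>n. inverse (real n ^ 2))" by (rule inverse_power_summable) simp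
    show "norm (1 / (1 + (real n)\<^sup>2)) \<le> inverse (real n ^ 2)" if "n \<ge> 1" for n
      using that by (simp add: inverse_eq_divide) (intro divide_left_mono; simp add: add_pos_nonneg)
  qed
  then have n: "(\<lambda>n. 1 / (1 + (real n)\<^sup>2)) summable_on UNIV"
    by (intro norm_summable_imp_summable_on) simp
  have "(\<lambda>m::int. 1 / (1 + (of_int m)\<^sup>2) :: real) summable_on range int"
    by (subst summable_on_reindex) (use n in \<open>auto simp: o_def\<close>)
  moreover have "(\<lambda>m::int. 1 / (1 + (of_int m)\<^sup>2) :: real) summable_on range (\<lambda>n. - int n)"
    by (subst summable_on_reindex) (use n in \<open>auto simp: o_def inj_on_def\<close>)
  ultimately have "(\<lambda>m::int. 1 / (1 + (of_int m)\<^sup>2) :: real) summable_on range int \<union> range (\<lambda>n. - int n)"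
    by (rule summable_on_union)
  moreover have "range int \<union> range (\<lambda>n. - int n) = UNIV"
    by (auto simp: image_iff) (metis int_cases2)
  ultimately show ?thesis by simp
qed

lemma summable_on_lattice: "(\<lambda>m :: 'n::finite lattice. \<Prod>j\<in>UNIV. 1 / (1 + (of_int (m $ j))\<^sup>2) :: real) summable_on UNIV"
proof -
  define g :: "int \<Rightarrow> real" where "g m = 1 / (1 + (of_int m)\<^sup>2)" for m
  have g0: "g m \<ge> 0" for m by (simp add: g_def)
  have gs: "g summable_on UNIV" using summable_on_int_inverse_squares by (simp add: g_def[abs_def])
  have "(\<Sum>m\<in>F. \<Prod>j\<in>UNIV. g (m $ j)) \<le> (infsum g UNIV) ^ CARD('n)" if F: "finite F" for F :: "'n lattice set"
  proof -
    define B where "B j = (\<lambda>m. m $ j) ` F" for j :: 'n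
    have finB: "finite (B j)" for j using F by (simp add: B_def)
    have inj: "inj_on vec_nth F" by (auto simp: inj_on_def vec_nth_inject)
    have "(\<Sum>m\<in>F. \<Prod>j\<in>UNIV. g (m $ j)) = (\<Sum>h\<in>vec_nth ` F. \<Prod>j\<in>UNIV. g (h j))"
      by (simp add: sum.reindex[OF inj])
    also have "\<dots> \<le> (\<Sum>h\<in>Pi\<^sub>E UNIV B. \<Prod>j\<in>UNIV. g (h j))"
      by (rule sum_mono2) (auto intro!: finite_PiE finB prod_nonneg g0 simp: B_def)
    also have "\<dots> = (\<Prod>j\<in>UNIV. \<Sum>i\<in>B j. g i)"
      by (rule prod_sum_PiE[symmetric]) (auto simp: finB)
    also have "\<dots> \<le> (\<Prod>j\<in>(UNIV::'n set). infsum g UNIV)"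
      by (rule prod_mono) (auto intro!: sum_nonneg g0 finite_sum_le_infsum gs finB)
    finally show ?thesis by simp
  qed
  then show ?thesis
    by (intro nonneg_bdd_above_summable_on) (auto simp: bdd_above_def g_def[symmetric] intro!: prod_nonneg g0)
qed

lemma rapid_summable:
  fixes c :: "'n::finite lattice \<Rightarrow> complex"
  assumes "rapidly_decreasing c"
  shows "(\<lambda>m. cmod (c m)) summable_on UNIV"
proof -
  obtain K where K: "\<And>m. (1 + sqrt (int_norm_sq m)) ^ (2 * CARD('n)) * cmod (c m) \<le> K"
    using assms unfolding rapidly_decreasing_def by blast
  have "cmod (c m) \<le> K * (\<Prod>j\<in>UNIV. 1 / (1 + (of_int (m $ j))\<^sup>2))" for m
  proof -
    have "(\<Prod>j\<in>UNIV. 1 + (real_of_int (m $ j))\<^sup>2) \<le> (\<Prod>j\<in>(UNIV::'n set). 1 + int_norm_sq m)"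
      by (rule prod_mono) (auto simp: int_norm_sq_def intro!: member_le_sum)
    also have "\<dots> \<le> ((1 + sqrt (int_norm_sq m))\<^sup>2) ^ CARD('n)"
    proof -
      have "int_norm_sq m \<ge> 0" by (simp add: int_norm_sq_def sum_nonneg)
      then show ?thesis by (auto intro!: power_mono simp: power2_sum)
    qed
    finally have le: "(\<Prod>j\<in>UNIV. 1 + (real_of_int (m $ j))\<^sup>2) \<le> (1 + sqrt (int_norm_sq m)) ^ (2 * CARD('n))"
      by (simp add: power_mult)
    have pos: "(\<Prod>j\<in>UNIV. 1 + (real_of_int (m $ j))\<^sup>2) > 0"
      by (intro prod_pos) (auto intro: add_pos_nonneg)
    have "(\<Prod>j\<in>UNIV. 1 + (real_of_int (m $ j))\<^sup>2) * cmod (c m) \<le> K"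
      using mult_right_mono[OF le, of "cmod (c m)"] K[of m] by simp
    then show ?thesis
      using pos by (simp add: prod_dividef field_simps)
  qed
  then show ?thesis
    by (intro summable_on_comparison_test[OF summable_on_cmult_right[OF summable_on_lattice, of K]]) auto
qed

lemma series_summable:
  assumes "rapidly_decreasing c"
  shows "(\<lambda>m. op_scaleC (c m) (nc_monom \<theta> m)) summable_on UNIV"
proof (rule abs_summable_summable)
  show "(\<lambda>m. norm (op_scaleC (c m) (nc_monom \<theta> m))) summable_on UNIV"
    by (rule summable_on_comparison_test[OF rapid_summable[OF assms]])
      (auto intro!: norm_blinfun_bound simp: norm_scaleC norm_monom)
qed

lemma series_coord:
  assumes "rapidly_decreasing c"
  shows "coord (nc_series \<theta> c (basis_vec 0)) m = c m"
proof -
  have bl: "bounded_linear (\<lambda>A :: 'a lattice op. coord (blinfun_apply A (basis_vec 0)) m)"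
    using bounded_linear_compose[OF bl_coord blinfun.bounded_linear_left] .
  have "((\<lambda>k. coord (op_scaleC (c k) (nc_monom \<theta> k) (basis_vec 0)) m) has_sum coord (nc_series \<theta> c (basis_vec 0)) m) UNIV"
    using has_sum_bounded_linear[OF bl has_sum_infsum[OF series_summable[OF assms]]]
    by (simp add: nc_series_def)
  then have "((\<lambda>k. c k * (if m = k then 1 else 0)) has_sum coord (nc_series \<theta> c (basis_vec 0)) m) UNIV"
    by (simp add: monom_basis_0 scaleC.rep_eq basis_vec.rep_eq)
  then have "((\<lambda>k. c k) has_sum coord (nc_series \<theta> c (basis_vec 0)) m) {m}"
    by (rule has_sum_cong_neutral[THEN iffD1, rotated -1]) auto
  then show ?thesis by (simp add: has_sum_finite_iff)
qed

lemma coeff_series: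
  assumes "rapidly_decreasing c"
  shows "nc_coeff \<theta> (nc_series \<theta> c) = c"
  unfolding nc_coeff_def
proof (rule the_equality)
  fix d assume d: "rapidly_decreasing d \<and> nc_series \<theta> c = nc_series \<theta> d"
  then have "d m = c m" for m
    using series_coord[of d \<theta> m] series_coord[OF assms, of \<theta> m] by simp
  then show "d = c" by blast
qed (use assms in simp)

lemma basis_has_sum: "((\<lambda>m. scaleC (coord f m) (basis_vec m)) has_sum f) UNIV"
proof -
  have lin: "coord (\<Sum>m\<in>F. h m) x = (\<Sum>m\<in>F. coord (h m) x)" if "finite F" for F h and x :: 'a
    using bounded_linear.linear[OF bl_coord] by (rule linear_sum)
  have eq: "(norm ((\<Sum>m\<in>F. scaleC (coord f m) (basis_vec m)) - f))\<^sup>2 = (norm f)\<^sup>2 - (\<Sum>m\<in>F. (cmod (coord f m))\<^sup>2)"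
    if F: "finite F" for F
  proof -
    have c: "coord ((\<Sum>m\<in>F. scaleC (coord f m) (basis_vec m)) - f) x = (if x \<in> F then 0 else - coord f x)" for x
    proof -
      have "(\<Sum>m\<in>F. coord f m * (if x = m then 1 else 0)) = (\<Sum>m\<in>F. if x = m then coord f m else 0)"
        by (rule sum.cong) auto
      then show ?thesis
        using F by (simp add: minus_ell2.rep_eq lin scaleC.rep_eq basis_vec.rep_eq)
    qed
    have "(norm ((\<Sum>m\<in>F. scaleC (coord f m) (basis_vec m)) - f))\<^sup>2 = (\<Sum>\<^sub>\<infinity>x\<in>UNIV - F. (cmod (coord f x))\<^sup>2)"
      unfolding norm_sq_ell2 by (rule infsum_cong_neutral) (auto simp: c)
    also have "\<dots> = (\<Sum>\<^sub>\<infinity>x. (cmod (coord f x))\<^sup>2) - (\<Sum>\<^sub>\<infinity>x\<in>F. (cmod (coord f x))\<^sup>2)"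
      by (rule infsum_Diff) (auto simp: coord_summable F)
    finally show ?thesis using F by (simp add: norm_sq_ell2)
  qed
  have "((\<lambda>F. \<Sum>m\<in>F. (cmod (coord f m))\<^sup>2) \<longlongrightarrow> (norm f)\<^sup>2) (finite_subsets_at_top UNIV)"
    unfolding norm_sq_ell2 using has_sum_infsum[OF coord_summable[of f]] by (simp add: has_sum_def)
  from tendsto_diff[OF tendsto_const[of "(norm f)\<^sup>2"] this]
  have "((\<lambda>F. (norm f)\<^sup>2 - (\<Sum>m\<in>F. (cmod (coord f m))\<^sup>2)) \<longlongrightarrow> 0) (finite_subsets_at_top UNIV)" by simp
  then have "((\<lambda>F. (norm ((\<Sum>m\<in>F. scaleC (coord f m) (basis_vec m)) - f))\<^sup>2) \<longlongrightarrow> 0) (finite_subsets_at_top UNIV)"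
    by (rule Lim_transform_eventually) (auto intro!: eventually_finite_subsets_at_top_weakI simp: eq)
  from tendsto_real_sqrt[OF this]
  have "((\<lambda>F. norm ((\<Sum>m\<in>F. scaleC (coord f m) (basis_vec m)) - f)) \<longlongrightarrow> 0) (finite_subsets_at_top UNIV)"
    by simp
  then show ?thesis
    unfolding has_sum_def by (simp add: tendsto_norm_zero_iff LIM_zero_iff)
qed

lemma torus_bdd: "x \<in> nc_torus \<theta> \<Longrightarrow> x \<in> bounded_ops"
  by (simp add: nc_torus_def vN_generated_def commutant_def)

lemma vector_state_comp:
  assumes x: "x \<in> nc_torus \<theta>"
  shows "vector_state (x o\<^sub>L y) = (\<Sum>\<^sub>\<infinity>m. nc_R \<theta> m (-m) * coord (blinfun_apply x (basis_vec 0)) (-m) * coord (blinfun_apply y (basis_vec 0)) m)"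
proof -
  let ?f = "blinfun_apply y (basis_vec 0)"
  have bl: "bounded_linear (\<lambda>f. coord (blinfun_apply x f) 0)"
    using bounded_linear_compose[OF bl_coord blinfun.bounded_linear_right] .
  have "((\<lambda>m. coord (blinfun_apply x (scaleC (coord ?f m) (basis_vec m))) 0) has_sum coord (blinfun_apply x ?f) 0) UNIV"
    by (rule has_sum_bounded_linear[OF bl basis_has_sum])
  moreover have "coord (blinfun_apply x (scaleC (coord ?f m) (basis_vec m))) 0 = nc_R \<theta> m (-m) * coord (blinfun_apply x (basis_vec 0)) (-m) * coord ?f m" for m
    using torus_bdd[OF x] V_comm[OF x, of m "basis_vec 0"]
    by (simp add: bounded_ops_def scaleC.rep_eq V_0 coord_V mult_ac)
  ultimately show ?thesis
    by (simp add: vector_state_def infsumI)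
qed

lemma vector_state_tracial:
  assumes "x \<in> nc_torus \<theta>" "y \<in> nc_torus \<theta>"
  shows "vector_state (x o\<^sub>L y) = vector_state (y o\<^sub>L x)"
proof -
  have bij: "bij (\<lambda>m :: 'a lattice. - m)"
    by (rule bij_betw_byWitness[where f' = uminus]) auto
  have R: "nc_R \<theta> (- m) m = nc_R \<theta> m (- m)" for m
    by (simp add: nc_R_def sum_negf)
  have "(\<Sum>\<^sub>\<infinity>m. nc_R \<theta> m (-m) * coord (blinfun_apply y (basis_vec 0)) (-m) * coord (blinfun_apply x (basis_vec 0)) m)
     = (\<Sum>\<^sub>\<infinity>m. nc_R \<theta> (-m) m * coord (blinfun_apply y (basis_vec 0)) m * coord (blinfun_apply x (basis_vec 0)) (-m))"
    using infsum_reindex_bij_betw[OF bij, of "\<lambda>m. nc_R \<theta> m (-m) * coord (blinfun_apply y (basis_vec 0)) (-m) * coord (blinfun_apply x (basis_vec 0)) m"]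
    by simp
  then show ?thesis
    unfolding vector_state_comp[OF assms(1)] vector_state_comp[OF assms(2)] by (simp add: R mult_ac)
qed

lemma cinner_scale: "cinner (scaleC z f) g = z * cinner f g"
  unfolding cinner_def
  by (subst infsum_cmult_right[symmetric]) (auto intro!: cinner_summable simp: scaleC.rep_eq mult.assoc)

lemma pos_null:
  assumes x: "op_pos x" and e: "cinner (blinfun_apply x e) e = 0"
  shows "blinfun_apply x e = 0"
proof -
  define J where "J = (scaleC \<i> :: 'a ell2 \<Rightarrow> 'a ell2)"
  have JJ: "J (J a) = - a" for a by (rule coord_eqI) (simp add: J_def scaleC.rep_eq uminus_ell2.rep_eq)
  have Jadd: "J (a + b) = J a + J b" for a b unfolding J_def by (rule linear_add[OF bounded_linear.linear[OF bounded_linear_scaleC]])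
  have xJ: "blinfun_apply x (J a) = J (blinfun_apply x a)" for a
    using x by (simp add: op_pos_def bounded_ops_def J_def)
  have Jl: "inner (J a) b = - Im (cinner a b)" for a b by (simp add: inner_ell2_def J_def cinner_scale)
  have Jr: "inner a (J b) = Im (cinner a b)" for a b
    using Jl[of b a] cinner_commute[of a b] by (simp add: inner_commute)
  have JaJb: "inner (J a) (J b) = inner a b" for a b
    using Jr[of "J a" b] by (simp add: J_def cinner_scale inner_ell2_def)
  have p1: "inner (blinfun_apply x f) (J f) = 0" and p2: "inner (blinfun_apply x f) f \<ge> 0" for f
    using x unfolding Jr by (auto simp: op_pos_def) (simp add: inner_ell2_def)
  have pol: "inner (blinfun_apply x e) (J g) + inner (blinfun_apply x g) (J e) = 0" for g
    using p1[of "e + g"] p1[of e] p1[of g] by (simp add: blinfun.add_right Jadd inner_add_left inner_add_right)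
  have sym: "inner (blinfun_apply x e) g = inner (blinfun_apply x g) e" for g
    using pol[of "J g"] by (simp add: JJ xJ JaJb)
  let ?h = "blinfun_apply x e"
  have e0: "inner ?h e = 0" using e by (simp add: inner_ell2_def)
  have q: "0 \<le> - 2 * t * (norm ?h)\<^sup>2 + t\<^sup>2 * inner (blinfun_apply x ?h) ?h" for t
    using p2[of "e - t *\<^sub>R ?h"] sym[of ?h, symmetric] e0
    unfolding power2_norm_eq_inner
    by (simp add: blinfun.diff_right blinfun.scaleR_right inner_diff_left inner_diff_right algebra_simps power2_eq_square)
  define K where "K = inner (blinfun_apply x ?h) ?h"
  have K: "K \<ge> 0" using p2 by (simp add: K_def)
  have "(norm ?h)\<^sup>2 \<le> 0"
  proof (rule ccontr)
    assume "\<not> ?thesis"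
    then have n: "(norm ?h)\<^sup>2 > 0" by simp
    define t where "t = (norm ?h)\<^sup>2 / (K + 1)"
    have t: "t > 0" using n K by (simp add: t_def)
    have "2 * t * (norm ?h)\<^sup>2 \<le> t * (t * K)" using q[of t] by (simp add: K_def power2_eq_square mult_ac)
    then have "2 * (norm ?h)\<^sup>2 \<le> t * K" using t by (simp add: mult.assoc mult.left_commute)
    also have "t * K \<le> (norm ?h)\<^sup>2" using K by (simp add: t_def field_simps)
    finally show False using n by simp
  qed
  then show ?thesis by simp
qed

lemma torus_zero:
  assumes x: "x \<in> nc_torus \<theta>" and "blinfun_apply x (basis_vec 0) = 0"
  shows "x = 0"
proof (rule blinfun_eqI)
  fix f
  have "blinfun_apply x (basis_vec m) = 0" for m
    using V_comm[OF x, of m "basis_vec 0"] assms(2) by (simp add: V_0)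
  then have z: "blinfun_apply x (scaleC c (basis_vec m)) = 0" for c m
    using torus_bdd[OF x] by (simp add: bounded_ops_def) (metis coord_eqI mult_zero_right scaleC.rep_eq zero_ell2.rep_eq)
  have "((\<lambda>m. blinfun_apply x (scaleC (coord f m) (basis_vec m))) has_sum blinfun_apply x f) UNIV"
    by (rule has_sum_bounded_linear[OF blinfun.bounded_linear_right basis_has_sum])
  then have "((\<lambda>m :: 'a lattice. 0) has_sum blinfun_apply x f) UNIV" by (simp only: z)
  from infsumI[OF this] show "blinfun_apply x f = blinfun_apply 0 f" by simp
qed

lemma canonical_trace_exists: "is_canonical_trace \<theta> vector_state"
proof -
  have "vector_state x = cinner (blinfun_apply x (basis_vec 0)) (basis_vec 0)" for x :: "'a lattice op"
    by (simp add: vector_state_def cinner_basis)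
  note c = this
  have "normal_functional (nc_torus \<theta>) vector_state"
    unfolding normal_functional_def c by blast
  moreover have "vector_state (nc_series \<theta> c) = c 0" if "rapidly_decreasing c" for c
    using series_coord[OF that] by (simp add: vector_state_def)
  moreover have "x = 0" if "x \<in> nc_torus \<theta>" "op_pos x" "vector_state x = 0" for x
    using torus_zero[OF that(1)] pos_null[OF that(2)] that(3) by (simp add: c)
  moreover have "Im (vector_state x) = 0 \<and> Re (vector_state x) \<ge> 0" if "op_pos x" for x :: "'a lattice op"
    using that by (auto simp: op_pos_def c)
  ultimately show ?thesis
    unfolding is_canonical_trace_def faithful_normal_tracial_state_def
    using vector_state_tracial[of _ \<theta>]
    by (auto simp: vector_state_def blinfun.add_left plus_ell2.rep_eq scaleC.rep_eq basis_vec.rep_eq)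
qed

corollary nc_trace_canonical: "is_canonical_trace \<theta> (nc_trace \<theta>)"
  unfolding nc_trace_def
  by (rule someI[where P = "is_canonical_trace \<theta>", OF canonical_trace_exists])

end

theory Submission
  imports Defs "HOL-Real_Asymp.Real_Asymp"
begin

text \<open>
  The seminorms are compared multiplier by multiplier. The gauge automorphisms
  \<open>U\<^sup>m \<mapsto> e\<^bsup>i h m\<^sub>j\<^esup> U\<^sup>m\<close> are unitarily implemented and preserve the trace, hence are isometric for
  the \<open>L\<^sup>p\<close> norm. So a combination \<open>\<Sum>\<^sub>k b\<^sub>k e\<^bsup>i h\<^sub>k m\<^sub>j\<^esup>\<close> of characters is a multiplier of norm at most
  \<open>\<Sum>\<^sub>k |b\<^sub>k|\<close>, for every \<open>p\<close> and \<open>\<theta>\<close>. Instead of integrating against the heat kernel we use a random walk: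
  with \<open>h = (2\<lambda>/n)\<^bsup>1/2\<^esup>\<close>, the multiplier \<open>exp (- \<lambda> m\<^sub>j\<^sup>2)\<close> is the limit of \<open>cos (h m\<^sub>j)\<^sup>n\<close>, of norm at most \<open>1\<close>,
  and \<open>m\<^sub>j exp (- \<lambda> m\<^sub>j\<^sup>2)\<close> is the limit of \<open>h\<^sup>-\<^sup>1 sin (h m\<^sub>j) cos (h m\<^sub>j)\<^bsup>n - 1\<^esup>\<close>, whose coefficients
  \<open>C(n, k) (2k - n) / (2\<^sup>n n h)\<close> have absolute sum at most \<open>(2\<lambda>)\<^bsup>-1/2\<^esup>\<close> by the variance of the
  binomial distribution. Splitting \<open>exp (- 4\<pi>\<^sup>2 m\<^sub>j\<^sup>2 t)\<close> into equal factors, one for each derivative, yields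
  \<open>t\<^bsup>-r/2\<^esup>\<close>.

  The triangle inequality for the \<open>L\<^sup>p\<close> norm follows from the convexity of \<open>a \<mapsto> \<tau> (|a|\<^sup>p)\<close>, which is a
  supremum of affine functionals by a tracial Young inequality
  \<open>Re \<tau> (c a) \<le> \<tau> (|a|\<^sup>p) / p + \<tau> (|c|\<^sup>q) / q\<close>, nearly attained at \<open>c = |a|\<^bsup>p - 2\<^esup> a\<^sup>*\<close>.
\<close>

section \<open>Bounded operators and their adjoints\<close>

text \<open>The random walk keeps everything finite: a combination of gauge automorphisms is bounded
  by the triangle inequality alone, whereas averaging over the heat kernel would need
  operator-valued integrals. The passage to the limit is harmless because the L^p norm is dominated
  by the operator norm, hence by the l^1 norm of the coefficients, so dominated convergence of
  symbols is enough.

  The obstacle is the L^p norm itself. The trace is a chosen one, of which nothing is known beyond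
  the axioms of a normal tracial state and its values on smooth series; the work therefore takes
  place in the norm closure of the monomials, where these values determine it. That closure is
  stable under continuous functional calculus but need not contain the partial isometry of a polar
  decomposition, which is why Young's inequality goes through regularised fourth roots. The calculus
  itself is built from polynomials, and its positivity comes from Bernstein expansions instead of a
  spectral theorem.\<close>

lemmas compose_simps =
  bounded_bilinear.add_left[OF bounded_bilinear_blinfun_compose]
  bounded_bilinear.add_right[OF bounded_bilinear_blinfun_compose]
  bounded_bilinear.diff_left[OF bounded_bilinear_blinfun_compose]
  bounded_bilinear.diff_right[OF bounded_bilinear_blinfun_compose]
  bounded_bilinear.scaleR_left[OF bounded_bilinear_blinfun_compose]
  bounded_bilinear.scaleR_right[OF bounded_bilinear_blinfun_compose]

lemma compose_assoc: "(A o\<^sub>L B) o\<^sub>L C = A o\<^sub>L (B o\<^sub>L C)"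
  by (rule blinfun_eqI) simp

lemma compose_id [simp]: "id_blinfun o\<^sub>L A = A" "A o\<^sub>L id_blinfun = A"
  by (rule blinfun_eqI; simp)+

lemma scaleC_scaleC [simp]: "scaleC z (scaleC w f) = scaleC (z * w) f"
  by (rule coord_eqI) (simp add: scaleC.rep_eq mult_ac)

lemma scaleC_add: "scaleC z (f + g) = scaleC z f + scaleC z g"
  by (rule coord_eqI) (simp add: scaleC.rep_eq plus_ell2.rep_eq algebra_simps)

lemma scaleC_add_left: "scaleC (z + w) f = scaleC z f + scaleC w f"
  by (rule coord_eqI) (simp add: scaleC.rep_eq plus_ell2.rep_eq algebra_simps)

lemma scaleC_scaleR: "scaleC z (r *\<^sub>R f) = r *\<^sub>R scaleC z f"
  by (rule coord_eqI) (simp add: scaleC.rep_eq scaleR_ell2.rep_eq)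

lemma scaleC_of_real: "scaleC (of_real r) f = r *\<^sub>R f"
  by (rule coord_eqI) (simp add: scaleC.rep_eq scaleR_ell2.rep_eq)

text \<open>Reduces the complex inner product to two real ones, so that Cauchy-Schwarz and
  additivity transfer from the \<open>real_inner\<close> instance.\<close>

lemma cinner_Complex: "cinner f g = Complex (inner f g) (inner (scaleC (- \<i>) f) g)"
  by (rule complex_eqI) (simp_all add: inner_ell2_def cinner_scale)

lemma bounded_linear_cinner_left: "bounded_linear (\<lambda>f. cinner f g)"
proof (rule bounded_linear_intro)
  show "norm (cinner f g) \<le> norm f * (2 * norm g)" for f
  proof -
    have "norm (cinner f g) \<le> \<bar>inner f g\<bar> + \<bar>inner (scaleC (- \<i>) f) g\<bar>"
      unfolding cinner_Complex using cmod_le[of "Complex (inner f g) (inner (scaleC (- \<i>) f) g)"] by simp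
    also have "\<dots> \<le> norm f * norm g + norm (scaleC (- \<i>) f) * norm g"
      by (intro add_mono Cauchy_Schwarz_ineq2)
    finally show ?thesis by (simp add: norm_scaleC)
  qed
qed (simp_all add: cinner_Complex scaleC_add scaleC_scaleR inner_add_left complex_eq_iff)

lemma cinner_add_left: "cinner (f + h) g = cinner f g + cinner h g"
  by (rule linear_add[OF bounded_linear.linear[OF bounded_linear_cinner_left]])

lemma cinner_add_right: "cinner g (f + h) = cinner g f + cinner g h"
  using cinner_add_left[of f h g] by (metis cinner_commute complex_cnj_add)

lemma cinner_scale_right: "cinner f (scaleC z g) = cnj z * cinner f g"
  by (metis cinner_commute cinner_scale complex_cnj_mult)

lemma bounded_ops_scaleC: "A \<in> bounded_ops \<Longrightarrow> blinfun_apply A (scaleC z f) = scaleC z (A f)"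
  by (simp add: bounded_ops_def)

lemma norm_sum_basis:
  assumes "finite F"
  shows "(norm (\<Sum>x\<in>F. scaleC (b x) (basis_vec x)))\<^sup>2 = (\<Sum>x\<in>F. (cmod (b x))\<^sup>2)"
proof -
  have lin: "coord (\<Sum>m\<in>F. h m) x = (\<Sum>m\<in>F. coord (h m) x)" for h and x :: 'a
    using bounded_linear.linear[OF bl_coord] by (rule linear_sum)
  have c: "coord (\<Sum>x\<in>F. scaleC (b x) (basis_vec x)) y = (if y \<in> F then b y else 0)" for y
  proof -
    have "(\<Sum>m\<in>F. b m * (if y = m then 1 else 0)) = (\<Sum>m\<in>F. if y = m then b m else 0)"
      by (rule sum.cong) auto
    then show ?thesis
      using assms by (simp add: lin scaleC.rep_eq basis_vec.rep_eq)
  qed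
  have "(norm (\<Sum>x\<in>F. scaleC (b x) (basis_vec x)))\<^sup>2 = (\<Sum>\<^sub>\<infinity>x\<in>F. (cmod (b x))\<^sup>2)"
    unfolding norm_sq_ell2 by (rule infsum_cong_neutral) (auto simp: c)
  then show ?thesis using assms by simp
qed

text \<open>\<open>op_adj\<close> is a definite description, so existence has to be shown. The
  coordinates of the adjoint vector are forced: \<open>b g x\<close> is the conjugate of
  \<open>cinner (A (basis_vec x)) g\<close>. They are square-summable because testing against the
  truncation \<open>h\<close> of \<open>b g\<close> gives S = <A h, g> \<le> |A| |g| sqrt S for
  every finite partial sum S.\<close>

lemma adjoint_exists:
  fixes A :: "'a op"
  assumes A: "A \<in> bounded_ops"
  shows "\<exists>B :: 'a op. B \<in> bounded_ops \<and> (\<forall>f g. cinner (A f) g = cinner f (B g))"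
proof -
  define b where "b g x = cnj (cinner (A (basis_vec x)) g)" for g and x :: 'a
  have fin: "(\<Sum>x\<in>F. (cmod (b g x))\<^sup>2) \<le> (norm A * norm g)\<^sup>2" if F: "finite F" for F g
  proof -
    define h where "h = (\<Sum>x\<in>F. scaleC (b g x) (basis_vec x))"
    define S where "S = (\<Sum>x\<in>F. (cmod (b g x))\<^sup>2)"
    have S0: "S \<ge> 0" by (simp add: S_def sum_nonneg)
    have nh: "(norm h)\<^sup>2 = S" unfolding h_def S_def by (rule norm_sum_basis[OF F])
    have "cinner (A h) g = (\<Sum>x\<in>F. b g x * cinner (A (basis_vec x)) g)"
      by (simp add: h_def blinfun.sum_right bounded_ops_scaleC[OF A] cinner_scale
        linear_sum[OF bounded_linear.linear[OF bounded_linear_cinner_left]])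
    also have "\<dots> = of_real S"
      by (simp add: S_def b_def complex_norm_square mult.commute del: of_real_power)
    finally have "S = inner (A h) g" by (simp add: inner_ell2_def)
    also have "\<dots> \<le> norm (A h) * norm g" by (rule norm_cauchy_schwarz)
    also have "\<dots> \<le> (norm A * norm h) * norm g" by (intro mult_right_mono norm_blinfun) simp
    finally have "S \<le> norm h * (norm A * norm g)" by (simp add: mult_ac)
    then have "norm h * norm h \<le> norm h * (norm A * norm g)" by (simp add: nh[symmetric] power2_eq_square)
    then have "norm h \<le> norm A * norm g"
      by (cases "norm h = 0") (auto simp: mult_le_cancel_left)
    then show ?thesis unfolding S_def[symmetric] nh[symmetric] by (intro power_mono) auto
  qed
  have sm: "(\<lambda>x. (cmod (b g x))\<^sup>2) summable_on UNIV" for g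
    by (intro nonneg_bdd_above_summable_on) (auto simp: bdd_above_def intro!: exI[of _ "(norm A * norm g)\<^sup>2"] fin)
  define B where "B g = Abs_ell2 (b g)" for g
  have cB: "coord (B g) x = b g x" for g x
    using sm[of g] by (simp add: B_def Abs_ell2_inverse)
  have "bounded_linear B"
  proof (rule bounded_linear_intro)
    show "B (f + g) = B f + B g" for f g
      by (rule coord_eqI) (simp add: cB plus_ell2.rep_eq b_def cinner_add_right)
    show "B (r *\<^sub>R f) = r *\<^sub>R B f" for f r
      by (rule coord_eqI)
        (simp add: cB scaleR_ell2.rep_eq b_def cinner_scale_right[where z = "of_real r", unfolded scaleC_of_real])
    show "norm (B f) \<le> norm f * norm A" for f
    proof -
      have "(norm (B f))\<^sup>2 \<le> (norm A * norm f)\<^sup>2"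
        unfolding norm_sq_ell2 cB by (rule infsum_le_finite_sums[OF sm fin])
      then show ?thesis by (simp add: power2_le_iff_abs_le mult.commute)
    qed
  qed
  then have app: "blinfun_apply (Blinfun B) = B" by (rule bounded_linear_Blinfun_apply)
  have eq: "cinner (A f) g = cinner f (B g)" for f g
  proof -
    have bl: "bounded_linear (\<lambda>f. cinner (A f) g)"
      using bounded_linear_compose[OF bounded_linear_cinner_left blinfun.bounded_linear_right] .
    have "((\<lambda>m. cinner (A (scaleC (coord f m) (basis_vec m))) g) has_sum cinner (A f) g) UNIV"
      by (rule has_sum_bounded_linear[OF bl basis_has_sum])
    then show ?thesis
      by (simp add: bounded_ops_scaleC[OF A] cinner_scale infsumI[symmetric] cinner_def[of f] cB b_def)
  qed
  have "Blinfun B \<in> bounded_ops"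
    by (auto simp: bounded_ops_def app intro!: coord_eqI simp: cB scaleC.rep_eq b_def cinner_scale_right)
  with eq show ?thesis by (intro exI[of _ "Blinfun B"]) (simp add: app)
qed

lemma op_adj_bounded: "A \<in> bounded_ops \<Longrightarrow> op_adj A \<in> bounded_ops"
  and cinner_op_adj: "A \<in> bounded_ops \<Longrightarrow> cinner (blinfun_apply A f) g = cinner f (op_adj A g)"
  using adjoint_exists[of A] op_adj_eqI[of A] by metis+

lemma inner_op_adj: "A \<in> bounded_ops \<Longrightarrow> inner (blinfun_apply A f) g = inner f (op_adj A g)"
  by (simp add: inner_ell2_def cinner_op_adj)

lemma inner_op_adj': "A \<in> bounded_ops \<Longrightarrow> inner (op_adj A f) g = inner f (blinfun_apply A g)"
  by (metis inner_commute inner_op_adj)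

lemma cinner_op_adj': "A \<in> bounded_ops \<Longrightarrow> cinner (op_adj A f) g = cinner f (blinfun_apply A g)"
  by (metis cinner_commute cinner_op_adj)

lemma op_adj_adj [simp]: "A \<in> bounded_ops \<Longrightarrow> op_adj (op_adj A) = A"
  by (rule op_adj_eqI) (simp add: cinner_op_adj')

lemma bounded_ops_id [simp]: "id_blinfun \<in> bounded_ops"
  by (simp add: bounded_ops_def)

lemma bounded_ops_zero [simp]: "0 \<in> bounded_ops"
  by (auto simp: bounded_ops_def intro!: coord_eqI simp: scaleC.rep_eq zero_ell2.rep_eq)

lemma bounded_ops_add: "A \<in> bounded_ops \<Longrightarrow> B \<in> bounded_ops \<Longrightarrow> A + B \<in> bounded_ops"
  by (simp add: bounded_ops_def blinfun.bilinear_simps scaleC_add)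

lemma bounded_ops_diff: "A \<in> bounded_ops \<Longrightarrow> B \<in> bounded_ops \<Longrightarrow> A - B \<in> bounded_ops"
  by (simp add: bounded_ops_def blinfun.bilinear_simps scaleC_diff)

lemma bounded_ops_scaleR: "A \<in> bounded_ops \<Longrightarrow> r *\<^sub>R A \<in> bounded_ops"
  by (simp add: bounded_ops_def blinfun.bilinear_simps scaleC_scaleR)

lemma bounded_ops_op_scaleC: "A \<in> bounded_ops \<Longrightarrow> op_scaleC z A \<in> bounded_ops"
  by (simp add: bounded_ops_def mult.commute)

lemma bounded_ops_compose: "A \<in> bounded_ops \<Longrightarrow> B \<in> bounded_ops \<Longrightarrow> A o\<^sub>L B \<in> bounded_ops"
  by (simp add: bounded_ops_def)

text \<open>Limits are taken in the type of real-linear operators; closedness keeps them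
  complex-linear.\<close>

lemma closed_bounded_ops: "closed (bounded_ops :: 'a op set)"
proof -
  have "closed {A :: 'a op. blinfun_apply A (scaleC z f) = scaleC z (blinfun_apply A f)}" for z f
    by (intro closed_Collect_eq continuous_intros bounded_linear.continuous_on[OF bounded_linear_scaleC])
  moreover have eq: "bounded_ops = (\<Inter>z. \<Inter>f. {A :: 'a op. blinfun_apply A (scaleC z f) = scaleC z (blinfun_apply A f)})"
    by (auto simp: bounded_ops_def)
  ultimately show ?thesis unfolding eq by (intro closed_INT ballI)
qed

lemma op_adj_compose:
  "A \<in> bounded_ops \<Longrightarrow> B \<in> bounded_ops \<Longrightarrow> op_adj (A o\<^sub>L B) = op_adj B o\<^sub>L op_adj A"
  by (rule op_adj_eqI) (simp add: cinner_op_adj)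

lemma op_adj_add: "A \<in> bounded_ops \<Longrightarrow> B \<in> bounded_ops \<Longrightarrow> op_adj (A + B) = op_adj A + op_adj B"
  by (rule op_adj_eqI) (simp add: cinner_op_adj blinfun.bilinear_simps cinner_add_left cinner_add_right)

lemma op_adj_op_scaleC: "A \<in> bounded_ops \<Longrightarrow> op_adj (op_scaleC z A) = op_scaleC (cnj z) (op_adj A)"
  by (rule op_adj_eqI) (simp add: cinner_op_adj cinner_scale cinner_scale_right)

lemma op_scaleC_of_real: "op_scaleC (of_real r) A = r *\<^sub>R A"
  by (rule blinfun_eqI) (simp add: scaleC_of_real blinfun.scaleR_left)

lemma op_adj_scaleR: "A \<in> bounded_ops \<Longrightarrow> op_adj (r *\<^sub>R A) = r *\<^sub>R op_adj A"
  using op_adj_op_scaleC[of A "of_real r"] by (simp add: op_scaleC_of_real)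

lemma op_adj_diff: "A \<in> bounded_ops \<Longrightarrow> B \<in> bounded_ops \<Longrightarrow> op_adj (A - B) = op_adj A - op_adj B"
  using op_adj_add[of A "(-1) *\<^sub>R B"] op_adj_scaleR[of B "-1"] bounded_ops_scaleR[of B "-1"] by simp

lemma op_adj_id [simp]: "op_adj id_blinfun = id_blinfun"
  by (rule op_adj_eqI) simp

lemma op_adj_zero [simp]: "op_adj 0 = 0"
  using op_adj_scaleR[of 0 0] by simp

lemma norm_op_adj_le:
  assumes "A \<in> bounded_ops"
  shows "norm (op_adj A) \<le> norm A"
proof (rule norm_blinfun_bound)
  fix f
  have "(norm (op_adj A f))\<^sup>2 = inner (A (op_adj A f)) f"
    by (simp add: power2_norm_eq_inner inner_op_adj'[OF assms] inner_op_adj[OF assms])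
  also have "\<dots> \<le> norm (A (op_adj A f)) * norm f" by (rule norm_cauchy_schwarz)
  also have "\<dots> \<le> (norm A * norm (op_adj A f)) * norm f" by (intro mult_right_mono norm_blinfun) simp
  finally have "norm (op_adj A f) * norm (op_adj A f) \<le> norm (op_adj A f) * (norm A * norm f)"
    by (simp add: power2_eq_square mult_ac)
  then show "norm (op_adj A f) \<le> norm A * norm f"
    by (cases "norm (op_adj A f) = 0") (auto simp: mult_le_cancel_left)
qed simp

lemma norm_op_adj [simp]: "A \<in> bounded_ops \<Longrightarrow> norm (op_adj A) = norm A"
  by (metis norm_op_adj_le op_adj_adj op_adj_bounded order_antisym)

text \<open>The C*-identity. The lower bound comes from |A f|^2 = <op_adj A (A f), f> and
  Cauchy-Schwarz.\<close>

lemma norm_op_adj_compose: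
  assumes "A \<in> bounded_ops"
  shows "norm (op_adj A o\<^sub>L A) = (norm A)\<^sup>2"
proof (rule order_antisym)
  show "norm (op_adj A o\<^sub>L A) \<le> (norm A)\<^sup>2"
    using norm_blinfun_compose[of "op_adj A" A] assms by (simp add: power2_eq_square)
  have "norm A \<le> sqrt (norm (op_adj A o\<^sub>L A))"
  proof (rule norm_blinfun_bound)
    fix f
    have "(norm (A f))\<^sup>2 = inner ((op_adj A o\<^sub>L A) f) f"
      by (simp add: power2_norm_eq_inner inner_op_adj'[OF assms])
    also have "\<dots> \<le> norm ((op_adj A o\<^sub>L A) f) * norm f" by (rule norm_cauchy_schwarz)
    also have "\<dots> \<le> (norm (op_adj A o\<^sub>L A) * norm f) * norm f" by (intro mult_right_mono norm_blinfun) simp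
    finally have "sqrt ((norm (A f))\<^sup>2) \<le> sqrt (norm (op_adj A o\<^sub>L A) * (norm f)\<^sup>2)"
      by (intro real_sqrt_le_mono) (simp add: power2_eq_square mult_ac)
    then show "norm (A f) \<le> sqrt (norm (op_adj A o\<^sub>L A)) * norm f"
      by (simp add: real_sqrt_mult)
  qed simp
  then show "(norm A)\<^sup>2 \<le> norm (op_adj A o\<^sub>L A)"
    by (metis norm_ge_zero power_mono real_sqrt_pow2)
qed

lemma tendsto_op_adj:
  assumes "X \<longlonglongrightarrow> A" "\<And>i. X i \<in> bounded_ops"
  shows "(\<lambda>i. op_adj (X i)) \<longlonglongrightarrow> op_adj A"
proof -
  have A: "A \<in> bounded_ops"
    using closed_sequentially[OF closed_bounded_ops] assms by blast
  have "(\<lambda>i. norm (X i - A)) \<longlonglongrightarrow> 0"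
    using assms(1) by (simp add: tendsto_norm_zero_iff LIM_zero_iff)
  moreover have "norm (X i - A) = norm (op_adj (X i) - op_adj A)" for i
    using assms(2)[of i] A by (metis bounded_ops_diff norm_op_adj op_adj_diff)
  ultimately show ?thesis
    by (simp add: tendsto_norm_zero_iff LIM_zero_iff)
qed

section \<open>Positive operators\<close>

definition psd :: "'a op \<Rightarrow> bool" where
  "psd A \<longleftrightarrow> A \<in> bounded_ops \<and> op_adj A = A \<and> (\<forall>f. 0 \<le> inner (A f) f)"

text \<open>Self-adjointness makes the complex quadratic form real, so \<open>psd\<close> can be
  phrased with the real inner product. Nonnegativity of the real part alone would not make the form
  real.\<close>

lemma psd_op_pos:
  assumes "psd A" shows "op_pos A"
proof -
  have "cinner (A f) f = cnj (cinner (A f) f)" for f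
    by (metis assms cinner_commute cinner_op_adj psd_def)
  then have "Im (cinner (A f) f) = 0" for f
    by (metis Reals_cnj_iff complex_is_Real_iff)
  with assms show ?thesis by (auto simp: op_pos_def psd_def inner_ell2_def)
qed

lemma psd_bounded: "psd A \<Longrightarrow> A \<in> bounded_ops" by (simp add: psd_def)

lemma psd_self_adjoint: "psd A \<Longrightarrow> op_adj A = A" by (simp add: psd_def)

lemma psd_add: "psd A \<Longrightarrow> psd B \<Longrightarrow> psd (A + B)"
  by (simp add: psd_def bounded_ops_add op_adj_add blinfun.bilinear_simps inner_add_left)

lemma psd_scaleR: "psd A \<Longrightarrow> 0 \<le> r \<Longrightarrow> psd (r *\<^sub>R A)"
  by (simp add: psd_def bounded_ops_scaleR op_adj_scaleR blinfun.bilinear_simps)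

lemma psd_zero [simp]: "psd 0" by (simp add: psd_def)

lemma psd_sum: "(\<And>i. i \<in> I \<Longrightarrow> psd (X i)) \<Longrightarrow> psd (\<Sum>i\<in>I. X i)"
  by (induction I rule: infinite_finite_induct) (auto intro: psd_add)

lemma psd_id [simp]: "psd id_blinfun" by (simp add: psd_def)

lemma psd_conj:
  assumes "psd X" "B \<in> bounded_ops"
  shows "psd (op_adj B o\<^sub>L X o\<^sub>L B)"
  using assms by (simp add: psd_def bounded_ops_compose op_adj_bounded op_adj_compose compose_assoc inner_op_adj')

lemma psd_adj_compose: "A \<in> bounded_ops \<Longrightarrow> psd (op_adj A o\<^sub>L A)"
  using psd_conj[of id_blinfun A] by simp

lemma psd_LIMSEQ:
  assumes "X \<longlonglongrightarrow> A" "\<And>i. psd (X i)"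
  shows "psd A"
proof -
  have A: "A \<in> bounded_ops"
    using closed_sequentially[OF closed_bounded_ops] assms psd_bounded by blast
  have "op_adj A = A"
    using tendsto_op_adj[OF assms(1)] assms psd_bounded psd_self_adjoint
    by (metis (no_types, lifting) LIMSEQ_unique ext)
  moreover have "0 \<le> inner (A f) f" for f
    by (rule LIMSEQ_le_const[where X = "\<lambda>i. inner (X i f) f"])
      (use assms in \<open>auto intro!: tendsto_intros simp: psd_def\<close>)
  ultimately show ?thesis using A by (simp add: psd_def)
qed

section \<open>Polynomial calculus of positive operators\<close>

lemma op_poly_altdef:
  assumes "degree q \<le> n"
  shows "op_poly q A = (\<Sum>i\<le>n. coeff q i *\<^sub>R op_pow A i)"
  unfolding op_poly_def
  by (rule sum.mono_neutral_left) (use assms in \<open>auto simp: coeff_eq_0\<close>)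

lemma op_poly_0 [simp]: "op_poly 0 A = 0"
  by (simp add: op_poly_def)

lemma op_poly_add: "op_poly (p + q) A = op_poly p A + op_poly q A"
proof -
  let ?n = "max (degree p) (degree q)"
  have "degree (p + q) \<le> ?n" by (rule degree_add_le_max)
  then show ?thesis
    by (simp add: op_poly_altdef[of _ ?n] scaleR_add_left sum.distrib)
qed

lemma op_poly_smult: "op_poly (smult c q) A = c *\<^sub>R op_poly q A"
  by (simp add: op_poly_altdef[of _ "degree q"] degree_smult_le scaleR_sum_right)

lemma op_poly_pCons: "op_poly (pCons c q) A = c *\<^sub>R id_blinfun + (A o\<^sub>L op_poly q A)"
proof -
  have "op_poly (pCons c q) A = (\<Sum>i\<le>Suc (degree q). coeff (pCons c q) i *\<^sub>R op_pow A i)"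
    by (rule op_poly_altdef) (rule degree_pCons_le)
  also have "\<dots> = c *\<^sub>R id_blinfun + (\<Sum>i\<le>degree q. coeff q i *\<^sub>R (A o\<^sub>L op_pow A i))"
    by (simp add: sum.atMost_Suc_shift op_pow_def del: sum.atMost_Suc)
  also have "(\<Sum>i\<le>degree q. coeff q i *\<^sub>R (A o\<^sub>L op_pow A i)) = A o\<^sub>L op_poly q A"
    by (simp add: op_poly_def bounded_bilinear.sum_right[OF bounded_bilinear_blinfun_compose] compose_simps)
  finally show ?thesis .
qed

lemma op_poly_1 [simp]: "op_poly 1 A = id_blinfun"
  by (simp add: one_pCons op_poly_pCons)

lemma op_poly_diff: "op_poly (p - q) A = op_poly p A - op_poly q A"
  using op_poly_add[of p "smult (-1) q" A] op_poly_smult[of "-1" q A] by simp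

lemma op_poly_mult: "op_poly (p * q) A = op_poly p A o\<^sub>L op_poly q A"
  by (induction p)
    (simp_all add: op_poly_pCons op_poly_add op_poly_smult compose_simps compose_assoc)

lemma op_poly_sum: "op_poly (\<Sum>i\<in>I. p i) A = (\<Sum>i\<in>I. op_poly (p i) A)"
  by (induction I rule: infinite_finite_induct) (simp_all add: op_poly_add)

lemma op_poly_pcompose_scale: "op_poly (pcompose q [:0, r:]) A = op_poly q (r *\<^sub>R A)"
  by (induction q) (simp_all add: pcompose_pCons op_poly_add op_poly_mult op_poly_smult op_poly_pCons compose_simps)

text \<open>Serves with \<open>A = A'\<close> for commutation, and with \<open>B = a\<close> between
  \<open>op_adj a o\<^sub>L a\<close> and \<open>a o\<^sub>L op_adj a\<close>.\<close>

lemma op_poly_intertwine: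
  assumes "B o\<^sub>L A = A' o\<^sub>L B"
  shows "B o\<^sub>L op_poly q A = op_poly q A' o\<^sub>L B"
proof (induction q)
  case (pCons c q)
  have "B o\<^sub>L (A o\<^sub>L op_poly q A) = A' o\<^sub>L (op_poly q A' o\<^sub>L B)"
    by (metis assms pCons.IH compose_assoc)
  then show ?case by (simp add: op_poly_pCons compose_simps compose_assoc)
qed simp

lemma op_poly_bounded: "A \<in> bounded_ops \<Longrightarrow> op_poly q A \<in> bounded_ops"
  by (induction q) (auto simp: op_poly_pCons intro!: bounded_ops_add bounded_ops_scaleR bounded_ops_compose)

lemma op_adj_op_poly:
  assumes "psd A"
  shows "op_adj (op_poly q A) = op_poly q A"
proof (induction q)
  case (pCons c q)
  have A: "A \<in> bounded_ops" using assms by (rule psd_bounded)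
  have "op_poly q A o\<^sub>L A = A o\<^sub>L op_poly q A"
    by (rule op_poly_intertwine[symmetric]) simp
  with pCons A show ?case
    by (simp add: op_poly_pCons op_adj_add op_adj_scaleR op_adj_compose op_poly_bounded
        bounded_ops_scaleR bounded_ops_compose psd_self_adjoint[OF assms])
qed simp

subsection \<open>Positivity via Bernstein polynomials\<close>

text \<open>From C(n,i) C(i,k) = C(n,k) C(n-k,i-k) and the fact that the Bernstein polynomials of
  degree n - k sum to 1. Dividing by \<open>n choose k\<close> yields the coefficients of x^k in the
  Bernstein basis of degree n.\<close>

lemma Bernstein_moment:
  assumes "k \<le> n"
  shows "(\<Sum>i\<le>n. real (i choose k) * Bernstein n i x) = real (n choose k) * x ^ k"
proof -
  have "(\<Sum>i\<le>n. real (i choose k) * Bernstein n i x) = (\<Sum>i\<in>{k..n}. real (i choose k) * Bernstein n i x)"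
    by (rule sum.mono_neutral_right) (auto simp: binomial_eq_0)
  also have "\<dots> = (\<Sum>j\<le>n - k. real ((j + k) choose k) * Bernstein n (j + k) x)"
    by (rule sum.reindex_bij_witness[of _ "\<lambda>j. j + k" "\<lambda>i. i - k"]) (use assms in auto)
  also have "\<dots> = (\<Sum>j\<le>n - k. real (n choose k) * x ^ k * Bernstein (n - k) j x)"
  proof (rule sum.cong)
    fix j assume "j \<in> {..n - k}"
    then have j: "k \<le> j + k" "j + k \<le> n" using assms by auto
    have "real (n choose (j + k)) * real ((j + k) choose k) = real (n choose k) * real ((n - k) choose j)"
      unfolding of_nat_mult[symmetric] choose_mult[OF j] by simp
    moreover have "n - (j + k) = n - k - j" by simp
    ultimately show "real ((j + k) choose k) * Bernstein n (j + k) x = real (n choose k) * x ^ k * Bernstein (n - k) j x"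
      by (simp add: Bernstein_def power_add mult_ac)
  qed simp
  also have "\<dots> = real (n choose k) * x ^ k"
    unfolding sum_distrib_left[symmetric] by simp
  finally show ?thesis .
qed

text \<open>The quotient is the product of (i - j) / (n - j) over j < k. Each factor has modulus at
  most 1 and differs from i / n by at most 2 d / n, because n - j \<ge> n / 2; and a difference of
  products of such numbers is at most the sum of the differences of the factors.\<close>

lemma binomial_ratio_approx:
  assumes "k \<le> d" "2 * d \<le> n" "i \<le> n" "0 < n"
  shows "\<bar>real (i choose k) / real (n choose k) - (i / n) ^ k\<bar> \<le> 2 * (real d)\<^sup>2 / n"
proof -
  have quot: "real (i choose k) / real (n choose k) = (\<Prod>j<k. (real i - j) / (real n - j))"
    using assms
    by (simp add: binomial_gbinomial gbinomial_prod_rev prod_dividef lessThan_atLeast0)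
  have close: "\<bar>(real i - j) / (real n - j) - i / n\<bar> \<le> 2 * d / n" and le1: "\<bar>(real i - j) / (real n - j)\<bar> \<le> 1" if "j < k" for j
  proof -
    have n: "real n - j \<ge> n / 2" "real n - j > 0" "real n > 0" using that assms by auto
    have "(real i - j) / (real n - j) - i / n = - (j * (real n - i) / (n * (real n - j)))"
      using n by (simp add: divide_simps) (simp add: algebra_simps)
    also have "\<bar>\<dots>\<bar> = (j / (real n - j)) * ((real n - i) / n)"
      using n assms by (simp add: abs_mult)
    also have "\<dots> \<le> (j / (real n - j)) * 1"
      using n assms by (intro mult_left_mono) auto
    also have "j / (real n - j) \<le> d / (n / 2)"
      using n that assms by (intro frac_le) auto
    finally show "\<bar>(real i - j) / (real n - j) - i / n\<bar> \<le> 2 * d / n" by (simp add: mult.commute)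
    show "\<bar>(real i - j) / (real n - j)\<bar> \<le> 1"
      using n that assms by (simp add: abs_le_iff divide_simps)
  qed
  have "\<bar>(\<Prod>j<k. (real i - j) / (real n - j)) - (\<Prod>j<k. i / n)\<bar> \<le> (\<Sum>j<k. \<bar>(real i - j) / (real n - j) - i / n\<bar>)"
    using norm_prod_diff[of "{..<k}" "\<lambda>j. (real i - j) / (real n - j)" "\<lambda>j. i / n"] le1 assms by simp
  also have "\<dots> \<le> (\<Sum>j<k. 2 * d / n)" by (intro sum_mono close) simp
  also have "\<dots> = real k * (2 * d / n)" by simp
  also have "\<dots> \<le> real d * (2 * d / n)" using assms by (intro mult_right_mono) auto
  finally show ?thesis by (simp add: quot power2_eq_square mult_ac)
qed

definition bernstein_poly :: "nat \<Rightarrow> nat \<Rightarrow> real poly" where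
  "bernstein_poly n i = smult (of_nat (n choose i)) ([:0, 1:] ^ i * [:1, -1:] ^ (n - i))"

lemma poly_bernstein_poly [simp]: "poly (bernstein_poly n i) x = Bernstein n i x"
  by (simp add: bernstein_poly_def Bernstein_def)

text \<open>With X for A and Y for 1 - A, parity of the exponents writes X^i Y^j as r m r, where m
  is one of 1, X, Y, X Y. The first three cases are conjugations of positive operators; X Y is not
  visibly positive and needs an identity.\<close>

lemma psd_power_product:
  assumes A: "psd A" and A': "psd (id_blinfun - A)"
  shows "psd (op_poly ([:0, 1:] ^ i * [:1, -1:] ^ j) A)"
proof -
  let ?X = "[:0, 1:] :: real poly" and ?Y = "[:1, -1:] :: real poly"
  have X: "op_poly ?X A = A" and Y: "op_poly ?Y A = id_blinfun - A"
    by (simp_all add: op_poly_pCons blinfun_eqI[where x = "A o\<^sub>L - id_blinfun" and y = "- A"] blinfun.bilinear_simps)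
  have self: "op_adj (op_poly r A) = op_poly r A" for r by (rule op_adj_op_poly[OF A])
  have bd: "op_poly r A \<in> bounded_ops" for r by (rule op_poly_bounded[OF psd_bounded[OF A]])
  have sq: "psd (op_poly (r * r) A)" for r
    using psd_adj_compose[OF bd[of r]] by (simp add: self op_poly_mult)
  have sqX: "psd (op_poly (r * ?X * r) A)" for r
    using psd_conj[OF A bd[of r]] by (simp only: self op_poly_mult X)
  have sqY: "psd (op_poly (r * ?Y * r) A)" for r
    using psd_conj[OF A' bd[of r]] by (simp only: self op_poly_mult Y)
  have sqXY: "psd (op_poly (r * (?X * ?Y) * r) A)" for r
  proof -
    \<comment> \<open>Multiplying by X + Y = 1 turns X Y into Y X Y + X Y X, a sum of two
      conjugations.\<close>
    have "?X + ?Y = 1" by (simp add: one_pCons)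
    then have "r * (?X * ?Y) * r = r * (?X * ?Y) * r * (?X + ?Y)" by simp
    also have "\<dots> = (r * ?Y) * ?X * (r * ?Y) + (r * ?X) * ?Y * (r * ?X)"
      by (simp only: distrib_left mult_ac)
    finally have "op_poly (r * (?X * ?Y) * r) A
        = op_poly ((r * ?Y) * ?X * (r * ?Y)) A + op_poly ((r * ?X) * ?Y * (r * ?X)) A"
      by (simp only: op_poly_add)
    then show ?thesis by (simp only: psd_add[OF sqX sqY])
  qed
  obtain a e where i: "i = 2 * a + e" "e = 0 \<or> e = 1"
    by (metis add.right_neutral evenE oddE)
  obtain b f where j: "j = 2 * b + f" "f = 0 \<or> f = 1"
    by (metis add.right_neutral evenE oddE)
  define r where "r = ?X ^ a * ?Y ^ b"
  have "?X ^ i * ?Y ^ j = r * (?X ^ e * ?Y ^ f) * r"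
    unfolding i(1) j(1) r_def power_add mult_2 by (simp only: mult_ac)
  then show ?thesis
    using i(2) j(2) sq[of r] sqX[of r] sqY[of r] sqXY[of r] by auto
qed

text \<open>Stands in for the spectral theorem. In the Bernstein basis of degree n the coefficients
  \<open>b n i\<close> of q differ from q(i / n) \<ge> 0 by O(1 / n), uniformly in i. The Bernstein
  polynomials of A are positive and sum to the identity, so adding an O(1 / n) multiple of the
  identity makes q(A) positive; then n tends to infinity.\<close>

lemma psd_op_poly_unit:
  assumes A: "psd A" and A': "psd (id_blinfun - A)" and q: "\<And>x. x \<in> {0..1} \<Longrightarrow> 0 \<le> poly q x"
  shows "psd (op_poly q A)"
proof -
  define d where "d = degree q"
  define Q where "Q = (\<Sum>k\<le>d. \<bar>coeff q k\<bar>)"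
  define b where "b n i = (\<Sum>k\<le>d. coeff q k * (real (i choose k) / real (n choose k)))" for n i
  have repr: "q = (\<Sum>i\<le>n. smult (b n i) (bernstein_poly n i))" if n: "d \<le> n" for n
  proof (rule poly_eq_poly_eq_iff[THEN iffD1], rule ext)
    fix x
    have "poly (\<Sum>i\<le>n. smult (b n i) (bernstein_poly n i)) x
        = (\<Sum>k\<le>d. \<Sum>i\<le>n. coeff q k / real (n choose k) * (real (i choose k) * Bernstein n i x))"
      by (subst sum.swap) (simp add: poly_sum b_def sum_distrib_right mult.assoc)
    also have "\<dots> = (\<Sum>k\<le>d. coeff q k / real (n choose k) * (real (n choose k) * x ^ k))"
      unfolding sum_distrib_left[symmetric] using n by (intro sum.cong) (auto simp: Bernstein_moment)
    also have "\<dots> = poly q x"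
      using n by (simp add: poly_altdef d_def)
    finally show "poly q x = poly (\<Sum>i\<le>n. smult (b n i) (bernstein_poly n i)) x" ..
  qed
  have b_ge: "b n i \<ge> - (Q * (2 * (real d)\<^sup>2 / n))" if n: "2 * d \<le> n" "0 < n" and i: "i \<le> n" for n i
  proof -
    have "\<bar>b n i - poly q (i / n)\<bar> = \<bar>\<Sum>k\<le>d. coeff q k * (real (i choose k) / real (n choose k) - (i / n) ^ k)\<bar>"
      by (simp add: b_def poly_altdef d_def sum_subtractf right_diff_distrib)
    also have "\<dots> \<le> (\<Sum>k\<le>d. \<bar>coeff q k\<bar> * (2 * (real d)\<^sup>2 / n))"
      by (rule order_trans[OF sum_abs], unfold abs_mult)
        (intro sum_mono mult_left_mono binomial_ratio_approx, use n i in auto)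
    also have "\<dots> = Q * (2 * (real d)\<^sup>2 / n)" by (simp only: Q_def sum_distrib_right)
    finally show ?thesis
      using q[of "i / n"] i n by (simp add: abs_le_iff)
  qed
  have psd_bern: "psd (op_poly (bernstein_poly n i) A)" for n i
    by (simp add: bernstein_poly_def op_poly_smult psd_scaleR psd_power_product[OF A A'])
  have psd_n: "psd (op_poly q A + (Q * (2 * (real d)\<^sup>2 / n)) *\<^sub>R id_blinfun)" if n: "2 * d \<le> n" "0 < n" for n
  proof -
    define \<epsilon> where "\<epsilon> = Q * (2 * (real d)\<^sup>2 / n)"
    have one: "(\<Sum>i\<le>n. bernstein_poly n i) = 1"
      by (rule poly_eq_poly_eq_iff[THEN iffD1], rule ext) (simp add: poly_sum)
    have "op_poly q A = (\<Sum>i\<le>n. b n i *\<^sub>R op_poly (bernstein_poly n i) A)"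
      using n by (subst repr[of n]) (simp_all add: op_poly_sum op_poly_smult)
    moreover have "id_blinfun = (\<Sum>i\<le>n. op_poly (bernstein_poly n i) A)"
      by (metis one op_poly_1 op_poly_sum)
    ultimately have "op_poly q A + \<epsilon> *\<^sub>R id_blinfun
        = (\<Sum>i\<le>n. b n i *\<^sub>R op_poly (bernstein_poly n i) A) + \<epsilon> *\<^sub>R (\<Sum>i\<le>n. op_poly (bernstein_poly n i) A)"
      by (rule arg_cong2[where f = "\<lambda>x y. x + \<epsilon> *\<^sub>R y"])
    also have "\<dots> = (\<Sum>i\<le>n. (b n i + \<epsilon>) *\<^sub>R op_poly (bernstein_poly n i) A)"
      by (simp add: scaleR_sum_right sum.distrib scaleR_add_left)
    also have "psd \<dots>"
      using b_ge[OF n] by (intro psd_sum psd_scaleR psd_bern) (force simp: \<epsilon>_def)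
    finally show ?thesis by (simp only: \<epsilon>_def)
  qed
  \<comment> \<open>The shift by 2 d + 1 secures 2 d \<le> n and 0 < n at every index.\<close>
  have "(\<lambda>n. op_poly q A + (Q * (2 * (real d)\<^sup>2 / real (n + 2 * d + 1))) *\<^sub>R id_blinfun) \<longlonglongrightarrow> op_poly q A + (Q * 0) *\<^sub>R id_blinfun"
    by (intro tendsto_intros LIMSEQ_ignore_initial_segment[where k = "2 * d + 1" and f = "\<lambda>n. 2 * (real d)\<^sup>2 / real n", simplified add.assoc[symmetric]] lim_const_over_n)
  moreover have "psd (op_poly q A + (Q * (2 * (real d)\<^sup>2 / real (n + 2 * d + 1))) *\<^sub>R id_blinfun)" for n
    by (rule psd_n) auto
  ultimately show ?thesis
    using psd_LIMSEQ by fastforce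
qed

lemma psd_id_minus:
  assumes "A \<in> bounded_ops" "op_adj A = A" "norm A \<le> c"
  shows "psd (c *\<^sub>R id_blinfun - A)"
proof -
  have "inner (A f) f \<le> c * inner f f" for f
  proof -
    have "inner (A f) f \<le> norm (A f) * norm f" by (rule norm_cauchy_schwarz)
    also have "norm (A f) \<le> c * norm f"
      using mult_right_mono[OF assms(3), of "norm f"] norm_blinfun[of A f] by simp
    finally show ?thesis by (simp add: mult_right_mono power2_norm_eq_inner[symmetric] power2_eq_square mult_ac)
  qed
  with assms(1,2) show ?thesis
    by (simp add: psd_def bounded_ops_diff bounded_ops_scaleR op_adj_diff op_adj_scaleR blinfun.bilinear_simps inner_diff_left)
qed

text \<open>Rescaling by R reduces to the unit interval. A bound R in place of the norm lets two
  operators share one interval.\<close>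

lemma psd_op_poly:
  assumes A: "psd A" and R: "norm A \<le> R" and q: "\<And>x. x \<in> {0..R} \<Longrightarrow> 0 \<le> poly q x"
  shows "psd (op_poly q A)"
proof (cases "R = 0")
  case True
  with R have "A = 0" by simp
  then have "op_poly q A = poly q 0 *\<^sub>R id_blinfun"
    by (cases q) (simp add: op_poly_pCons)
  then show ?thesis using q[of 0] True by (simp add: psd_scaleR)
next
  case False
  then have R0: "R > 0" using R norm_ge_zero[of A] by linarith
  define B where "B = inverse R *\<^sub>R A"
  have "psd B" using A R0 by (simp add: B_def psd_scaleR)
  moreover have "norm B \<le> 1" using R R0 by (simp add: B_def divide_simps)
  ultimately have "psd (op_poly (pcompose q [:0, R:]) B)"
    using R0 q by (intro psd_op_poly_unit psd_id_minus[where c = 1, simplified] psd_bounded psd_self_adjoint) (auto simp: poly_pcompose mult_left_le)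
  then show ?thesis using R0 by (simp add: op_poly_pcompose_scale B_def)
qed

text \<open>Positivity of c^2 - q^2 on the interval gives |q(A) f|^2 \<le> c^2 |f|^2. This makes the
  polynomial calculus continuous for uniform convergence.\<close>

lemma norm_op_poly_le:
  assumes A: "psd A" and R: "norm A \<le> R" and q: "\<And>x. x \<in> {0..R} \<Longrightarrow> \<bar>poly q x\<bar> \<le> c"
  shows "norm (op_poly q A) \<le> c"
proof -
  have c: "c \<ge> 0" using q[of 0] R norm_ge_zero[of A] by force
  have "psd (op_poly ([:c\<^sup>2:] - q * q) A)"
  proof (rule psd_op_poly[OF A R])
    fix x assume "x \<in> {0..R}"
    then have "\<bar>poly q x\<bar>\<^sup>2 \<le> c\<^sup>2" by (intro power_mono q) auto
    then show "0 \<le> poly ([:c\<^sup>2:] - q * q) x" by (simp add: power2_eq_square)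
  qed
  then have *: "0 \<le> inner ((c\<^sup>2 *\<^sub>R id_blinfun - (op_poly q A o\<^sub>L op_poly q A)) f) f" for f
    by (simp add: psd_def op_poly_diff op_poly_mult op_poly_pCons)
  show ?thesis
  proof (rule norm_blinfun_bound[OF c])
    fix f
    have "(norm (op_poly q A f))\<^sup>2 = inner ((op_poly q A o\<^sub>L op_poly q A) f) f"
      using inner_op_adj[OF op_poly_bounded[OF psd_bounded[OF A]], of q "op_poly q A f" f]
      by (simp add: power2_norm_eq_inner op_adj_op_poly[OF A])
    also have "\<dots> \<le> c\<^sup>2 * (norm f)\<^sup>2"
      using *[of f] by (simp add: blinfun.bilinear_simps inner_diff_left power2_norm_eq_inner)
    finally have "(norm (op_poly q A f))\<^sup>2 \<le> (c * norm f)\<^sup>2" by (simp add: power_mult_distrib)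
    then show "norm (op_poly q A f) \<le> c * norm f"
      using c by (simp add: power2_le_iff_abs_le)
  qed
qed

section \<open>Continuous functional calculus\<close>

lemma uniform_poly_approx:
  fixes f :: "real \<Rightarrow> real"
  assumes "continuous_on {0..R} f"
  shows "\<exists>q. uniform_limit {0..R} (\<lambda>i. poly (q i)) f sequentially"
proof -
  have "\<exists>q. \<forall>x\<in>{0..R}. \<bar>f x - poly q x\<bar> < 1 / real (Suc i)" for i
  proof -
    obtain g where g: "real_polynomial_function g" "\<And>x. x \<in> {0..R} \<Longrightarrow> \<bar>f x - g x\<bar> < 1 / real (Suc i)"
      using Stone_Weierstrass_real_polynomial_function[OF compact_Icc assms] by (metis of_nat_0_less_iff zero_less_Suc zero_less_divide_1_iff)
    then obtain a n where "g = (\<lambda>x. \<Sum>i\<le>n. a i * x ^ i)"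
      unfolding real_polynomial_function_iff_sum by blast
    then have "g = poly (\<Sum>i\<le>n. monom (a i) i)"
      by (simp add: fun_eq_iff poly_sum poly_monom)
    with g(2) show ?thesis by blast
  qed
  then obtain q where q: "\<And>i x. x \<in> {0..R} \<Longrightarrow> \<bar>f x - poly (q i) x\<bar> < 1 / real (Suc i)"
    by metis
  have "uniform_limit {0..R} (\<lambda>i. poly (q i)) f sequentially"
  proof (rule uniform_limitI)
    fix e :: real assume "0 < e"
    then have "\<forall>\<^sub>F i in sequentially. 1 / real (Suc i) < e"
      using order_tendstoD(2)[OF LIMSEQ_inverse_real_of_nat] by (simp add: inverse_eq_divide)
    then show "\<forall>\<^sub>F i in sequentially. \<forall>x\<in>{0..R}. dist (poly (q i) x) (f x) < e"
    proof eventually_elim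
      case (elim i)
      have "dist (poly (q i) x) (f x) < 1 / real (Suc i)" if "x \<in> {0..R}" for x
        using q[OF that, of i] by (simp add: dist_real_def abs_minus_commute)
      with elim show ?case by (meson less_trans)
    qed
  qed
  then show ?thesis by blast
qed

text \<open>With p = q this is the Cauchy property of an approximating sequence; with two different
  sequences it shows that the limit does not depend on the choice.\<close>

lemma op_poly_dist_limit:
  assumes A: "psd A" and R: "norm A \<le> R"
    and p: "uniform_limit {0..R} (\<lambda>i. poly (p i)) f sequentially"
    and q: "uniform_limit {0..R} (\<lambda>i. poly (q i)) f sequentially"
  shows "0 < e \<Longrightarrow> \<exists>N. \<forall>i\<ge>N. \<forall>j\<ge>N. norm (op_poly (p i) A - op_poly (q j) A) < e"
proof -
  assume "0 < e"
  then have "\<forall>\<^sub>F i in sequentially. \<forall>x\<in>{0..R}. dist (poly (p i) x) (f x) < e / 4"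
    "\<forall>\<^sub>F i in sequentially. \<forall>x\<in>{0..R}. dist (poly (q i) x) (f x) < e / 4"
    using uniform_limitD[OF p, of "e / 4"] uniform_limitD[OF q, of "e / 4"] by simp_all
  then obtain N M where N: "\<And>i x. i \<ge> N \<Longrightarrow> x \<in> {0..R} \<Longrightarrow> dist (poly (p i) x) (f x) < e / 4"
    and M: "\<And>i x. i \<ge> M \<Longrightarrow> x \<in> {0..R} \<Longrightarrow> dist (poly (q i) x) (f x) < e / 4"
    unfolding eventually_sequentially by blast
  have "norm (op_poly (p i) A - op_poly (q j) A) \<le> e / 2" if "i \<ge> max N M" "j \<ge> max N M" for i j
    unfolding op_poly_diff[symmetric]
  proof (rule norm_op_poly_le[OF A R])
    fix x assume "x \<in> {0..R}"
    then show "\<bar>poly (p i - q j) x\<bar> \<le> e / 2"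
      using N[of i x] M[of j x] that dist_triangle2[of "poly (p i) x" "poly (q j) x" "f x"]
      by (simp add: dist_real_def)
  qed
  with \<open>0 < e\<close> have "norm (op_poly (p i) A - op_poly (q j) A) < e" if "i \<ge> max N M" "j \<ge> max N M" for i j
    using that by fastforce
  then show ?thesis by blast
qed

text \<open>Existence and uniqueness behind the definite description in \<open>fun_calc\<close>.
  Since R may exceed the norm of A, one sequence of polynomials can be used for two operators at
  once.\<close>

lemma fun_calc_tendsto:
  assumes A: "psd A" and R: "norm A \<le> R" and q: "uniform_limit {0..R} (\<lambda>i. poly (q i)) f sequentially"
  shows "(\<lambda>i. op_poly (q i) A) \<longlonglongrightarrow> fun_calc f A"
proof -
  have "Cauchy (\<lambda>i. op_poly (q i) A)"
  proof (rule CauchyI)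
    fix e :: real assume "0 < e"
    then show "\<exists>M. \<forall>m\<ge>M. \<forall>n\<ge>M. norm (op_poly (q m) A - op_poly (q n) A) < e"
      by (rule op_poly_dist_limit[OF A R q q])
  qed
  then obtain B where B: "(\<lambda>i. op_poly (q i) A) \<longlonglongrightarrow> B"
    using Cauchy_convergent convergent_def by blast
  have sub: "uniform_limit {0..norm A} (\<lambda>i. poly (q i)) f sequentially"
    using R by (intro uniform_limit_on_subset[OF q]) auto
  have "fun_calc f A = B"
    unfolding fun_calc_def
  proof (rule the_equality)
    fix B' assume "\<exists>q. uniform_limit {0..norm A} (\<lambda>i. poly (q i)) f sequentially \<and> (\<lambda>i. op_poly (q i) A) \<longlonglongrightarrow> B'"
    then obtain q' where q': "uniform_limit {0..norm A} (\<lambda>i. poly (q' i)) f sequentially" "(\<lambda>i. op_poly (q' i) A) \<longlonglongrightarrow> B'"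
      by blast
    have "(\<lambda>i. op_poly (q' i) A - op_poly (q i) A) \<longlonglongrightarrow> 0"
    proof (rule LIMSEQ_I)
      fix e :: real assume "0 < e"
      then show "\<exists>no. \<forall>n\<ge>no. norm (op_poly (q' n) A - op_poly (q n) A - 0) < e"
        using op_poly_dist_limit[OF A order_refl q'(1) sub, of e] by (metis diff_zero)
    qed
    from tendsto_add[OF this B] q'(2) show "B' = B"
      using LIMSEQ_unique by fastforce
  qed (use sub B in blast)
  with B show ?thesis by simp
qed

lemma fun_calc_cong:
  assumes "\<And>x. x \<in> {0..norm A} \<Longrightarrow> f x = g x"
  shows "fun_calc f A = fun_calc g A"
proof -
  have "uniform_limit {0..norm A} h f sequentially \<longleftrightarrow> uniform_limit {0..norm A} h g sequentially" for h
    by (rule uniform_limit_cong') (use assms in auto)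
  then show ?thesis by (simp add: fun_calc_def)
qed

lemma fun_calc_poly: "psd A \<Longrightarrow> fun_calc (poly q) A = op_poly q A"
  using fun_calc_tendsto[of A "norm A" "\<lambda>_. q" "poly q"]
  by (metis LIMSEQ_const_iff order_refl uniform_limit_const)

lemma fun_calc_const: "psd A \<Longrightarrow> fun_calc (\<lambda>x. c) A = c *\<^sub>R id_blinfun"
  using fun_calc_poly[of A "[:c:]"] by (simp add: op_poly_pCons fun_calc_cong[of A "\<lambda>x. c" "poly [:c:]"])

lemma fun_calc_ident: "psd A \<Longrightarrow> fun_calc (\<lambda>x. x) A = A"
  using fun_calc_poly[of A "[:0, 1:]"] by (simp add: op_poly_pCons fun_calc_cong[of A "\<lambda>x. x" "poly [:0, 1:]"])

lemma fun_calc_approx: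
  assumes "psd A" "continuous_on {0..} f"
  obtains q where "uniform_limit {0..norm A} (\<lambda>i. poly (q i)) f sequentially"
    "(\<lambda>i. op_poly (q i) A) \<longlonglongrightarrow> fun_calc f A"
  using uniform_poly_approx[of "norm A" f] fun_calc_tendsto[OF assms(1) order_refl] continuous_on_subset[OF assms(2), of "{0..norm A}"]
  by fastforce

lemma fun_calc_add:
  assumes A: "psd A" and f: "continuous_on {0..} f" and g: "continuous_on {0..} g"
  shows "fun_calc (\<lambda>x. f x + g x) A = fun_calc f A + fun_calc g A"
proof -
  obtain p where p: "uniform_limit {0..norm A} (\<lambda>i. poly (p i)) f sequentially" "(\<lambda>i. op_poly (p i) A) \<longlonglongrightarrow> fun_calc f A"
    using fun_calc_approx[OF A f] .
  obtain q where q: "uniform_limit {0..norm A} (\<lambda>i. poly (q i)) g sequentially" "(\<lambda>i. op_poly (q i) A) \<longlonglongrightarrow> fun_calc g A"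
    using fun_calc_approx[OF A g] .
  have "uniform_limit {0..norm A} (\<lambda>i. poly (p i + q i)) (\<lambda>x. f x + g x) sequentially"
    using uniform_limit_add[OF p(1) q(1)] by (simp add: poly_add[abs_def])
  from fun_calc_tendsto[OF A order_refl this] tendsto_add[OF p(2) q(2)] show ?thesis
    by (simp add: op_poly_add LIMSEQ_unique)
qed

lemma fun_calc_mult:
  assumes A: "psd A" and f: "continuous_on {0..} f" and g: "continuous_on {0..} g"
  shows "fun_calc (\<lambda>x. f x * g x) A = fun_calc f A o\<^sub>L fun_calc g A"
proof -
  obtain p where p: "uniform_limit {0..norm A} (\<lambda>i. poly (p i)) f sequentially" "(\<lambda>i. op_poly (p i) A) \<longlonglongrightarrow> fun_calc f A"
    using fun_calc_approx[OF A f] .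
  obtain q where q: "uniform_limit {0..norm A} (\<lambda>i. poly (q i)) g sequentially" "(\<lambda>i. op_poly (q i) A) \<longlonglongrightarrow> fun_calc g A"
    using fun_calc_approx[OF A g] .
  have bd: "bounded (h ` {0..norm A})" if "continuous_on {0..} h" for h :: "real \<Rightarrow> real"
    by (intro compact_imp_bounded compact_continuous_image continuous_on_subset[OF that]) auto
  have "uniform_limit {0..norm A} (\<lambda>i. poly (p i * q i)) (\<lambda>x. f x * g x) sequentially"
    using uniform_lim_mult[OF p(1) q(1) bd[OF f] bd[OF g]] by (simp add: poly_mult[abs_def])
  from fun_calc_tendsto[OF A order_refl this] bounded_bilinear.tendsto[OF bounded_bilinear_blinfun_compose p(2) q(2)]
  show ?thesis
    by (simp add: op_poly_mult LIMSEQ_unique)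
qed

lemma fun_calc_cmult:
  assumes "psd A" "continuous_on {0..} f"
  shows "fun_calc (\<lambda>x. c * f x) A = c *\<^sub>R fun_calc f A"
  using fun_calc_mult[OF assms(1) continuous_on_const[of _ c] assms(2)] assms(1)
  by (simp add: fun_calc_const compose_simps)

lemma fun_calc_diff:
  assumes "psd A" "continuous_on {0..} f" "continuous_on {0..} g"
  shows "fun_calc (\<lambda>x. f x - g x) A = fun_calc f A - fun_calc g A"
  using fun_calc_add[of A f "\<lambda>x. (-1) * g x"] fun_calc_cmult[of A g "-1"] assms
  by (simp add: continuous_on_minus)

lemma fun_calc_sum:
  assumes "psd A" "\<And>i. i \<in> I \<Longrightarrow> continuous_on {0..} (f i)"
  shows "fun_calc (\<lambda>x. \<Sum>i\<in>I. f i x) A = (\<Sum>i\<in>I. fun_calc (f i) A)"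
  using assms(2)
  by (induction I rule: infinite_finite_induct)
    (simp_all add: fun_calc_const[OF assms(1)] fun_calc_add[OF assms(1)] continuous_on_sum)

lemma fun_calc_bounded:
  assumes "psd A" "continuous_on {0..} f"
  shows "fun_calc f A \<in> bounded_ops"
  using fun_calc_approx[OF assms] closed_sequentially[OF closed_bounded_ops] op_poly_bounded[OF psd_bounded[OF assms(1)]]
  by metis

lemma op_adj_fun_calc:
  assumes "psd A" "continuous_on {0..} f"
  shows "op_adj (fun_calc f A) = fun_calc f A"
proof -
  obtain q where q: "(\<lambda>i. op_poly (q i) A) \<longlonglongrightarrow> fun_calc f A"
    using fun_calc_approx[OF assms] by metis
  have "(\<lambda>i. op_adj (op_poly (q i) A)) \<longlonglongrightarrow> op_adj (fun_calc f A)"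
    by (intro tendsto_op_adj q op_poly_bounded psd_bounded assms)
  with q show ?thesis
    by (simp add: op_adj_op_poly[OF assms(1)] LIMSEQ_unique)
qed

lemma psd_fun_calc:
  assumes A: "psd A" and f: "continuous_on {0..} f" and nn: "\<And>x. x \<in> {0..norm A} \<Longrightarrow> 0 \<le> f x"
  shows "psd (fun_calc f A)"
proof -
  \<comment> \<open>\<open>sqrt\<close> is continuous on the whole real line, so this is continuous
    even where f is negative; only on the interval up to \<open>norm A\<close> must its square be
    f.\<close>
  let ?g = "\<lambda>x. sqrt (f x)"
  have g: "continuous_on {0..} ?g" using f by (intro continuous_intros)
  have "fun_calc f A = fun_calc (\<lambda>x. ?g x * ?g x) A"
    by (rule fun_calc_cong) (use nn in auto)
  also have "\<dots> = op_adj (fun_calc ?g A) o\<^sub>L fun_calc ?g A"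
    by (simp only: fun_calc_mult[OF A g g] op_adj_fun_calc[OF A g])
  finally show ?thesis
    using psd_adj_compose[OF fun_calc_bounded[OF A g]] by simp
qed

lemma fun_calc_intertwine:
  assumes A: "psd A" and A': "psd A'" and B: "B o\<^sub>L A = A' o\<^sub>L B" and f: "continuous_on {0..} f"
  shows "B o\<^sub>L fun_calc f A = fun_calc f A' o\<^sub>L B"
proof -
  define R where "R = max (norm A) (norm A')"
  obtain q where q: "uniform_limit {0..R} (\<lambda>i. poly (q i)) f sequentially"
    using uniform_poly_approx[of R f] continuous_on_subset[OF f, of "{0..R}"] by auto
  have "(\<lambda>i. op_poly (q i) A) \<longlonglongrightarrow> fun_calc f A" "(\<lambda>i. op_poly (q i) A') \<longlonglongrightarrow> fun_calc f A'"
    by (rule fun_calc_tendsto[OF A _ q] fun_calc_tendsto[OF A' _ q]; simp add: R_def)+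
  note lim = this
  have "(\<lambda>i. B o\<^sub>L op_poly (q i) A) \<longlonglongrightarrow> (B o\<^sub>L fun_calc f A)"
    by (rule bounded_bilinear.tendsto[OF bounded_bilinear_blinfun_compose tendsto_const lim(1)])
  moreover have "(\<lambda>i. op_poly (q i) A' o\<^sub>L B) \<longlonglongrightarrow> (fun_calc f A' o\<^sub>L B)"
    by (rule bounded_bilinear.tendsto[OF bounded_bilinear_blinfun_compose lim(2) tendsto_const])
  ultimately show ?thesis
    by (simp add: op_poly_intertwine[OF B] LIMSEQ_unique)
qed

lemma norm_fun_calc_le:
  assumes A: "psd A" and f: "continuous_on {0..} f" and le: "\<And>x. x \<in> {0..norm A} \<Longrightarrow> \<bar>f x\<bar> \<le> c"
  shows "norm (fun_calc f A) \<le> c"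
proof -
  have c: "c \<ge> 0" using le[of 0] by force
  have "psd (fun_calc (\<lambda>x. c\<^sup>2 - f x * f x) A)"
  proof (rule psd_fun_calc[OF A])
    show "continuous_on {0..} (\<lambda>x. c\<^sup>2 - f x * f x)" using f by (intro continuous_intros)
    fix x assume "x \<in> {0..norm A}"
    then have "\<bar>f x\<bar>\<^sup>2 \<le> c\<^sup>2" by (intro power_mono le) auto
    then show "0 \<le> c\<^sup>2 - f x * f x" by (simp add: power2_eq_square)
  qed
  then have *: "0 \<le> inner ((c\<^sup>2 *\<^sub>R id_blinfun - (fun_calc f A o\<^sub>L fun_calc f A)) h) h" for h
    using f by (simp add: psd_def fun_calc_diff[OF A] fun_calc_const[OF A] fun_calc_mult[OF A] continuous_on_mult)
  show ?thesis
  proof (rule norm_blinfun_bound[OF c])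
    fix h
    have "(norm (fun_calc f A h))\<^sup>2 = inner ((fun_calc f A o\<^sub>L fun_calc f A) h) h"
      using inner_op_adj[OF fun_calc_bounded[OF A f], of "fun_calc f A h" h]
      by (simp add: power2_norm_eq_inner op_adj_fun_calc[OF A f])
    also have "\<dots> \<le> c\<^sup>2 * (norm h)\<^sup>2"
      using *[of h] by (simp add: blinfun.bilinear_simps inner_diff_left power2_norm_eq_inner)
    finally have "(norm (fun_calc f A h))\<^sup>2 \<le> (c * norm h)\<^sup>2" by (simp add: power_mult_distrib)
    then show "norm (fun_calc f A h) \<le> c * norm h"
      using c by (simp add: power2_le_iff_abs_le)
  qed
qed

lemma fun_calc_uniform_limit:
  assumes A: "psd A" and g: "\<And>i. continuous_on {0..} (g i)" and f: "continuous_on {0..} f"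
    and lim: "uniform_limit {0..norm A} g f sequentially"
  shows "(\<lambda>i. fun_calc (g i) A) \<longlonglongrightarrow> fun_calc f A"
proof (rule LIMSEQ_I)
  fix e :: real assume "0 < e"
  then have "\<forall>\<^sub>F i in sequentially. \<forall>x\<in>{0..norm A}. dist (g i x) (f x) < e / 2"
    using uniform_limitD[OF lim, of "e / 2"] by simp
  then obtain N where N: "\<And>i x. i \<ge> N \<Longrightarrow> x \<in> {0..norm A} \<Longrightarrow> dist (g i x) (f x) < e / 2"
    unfolding eventually_sequentially by blast
  have "norm (fun_calc (g i) A - fun_calc f A) < e" if "i \<ge> N" for i
  proof -
    have "norm (fun_calc (g i) A - fun_calc f A) \<le> e / 2"
      unfolding fun_calc_diff[OF A g f, symmetric]
      by (rule norm_fun_calc_le[OF A])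
        (use N[OF that] in \<open>force intro!: continuous_intros g f simp: dist_real_def\<close>)+
    then show ?thesis using \<open>0 < e\<close> by linarith
  qed
  then show "\<exists>no. \<forall>n\<ge>no. norm (fun_calc (g n) A - fun_calc f A) < e" by blast
qed

lemma op_poly_fun_calc:
  assumes A: "psd A" and f: "continuous_on {0..} f"
  shows "op_poly q (fun_calc f A) = fun_calc (\<lambda>x. poly q (f x)) A"
proof (induction q)
  case (pCons c q)
  have "continuous_on {0..} (\<lambda>x. poly q (f x))" using f by (intro continuous_intros)
  with f show ?case
    by (simp add: op_poly_pCons pCons.IH fun_calc_add[OF A] fun_calc_mult[OF A] fun_calc_const[OF A] continuous_intros)
qed (simp add: fun_calc_const[OF A])

lemma fun_calc_compose:
  assumes A: "psd A" and f: "continuous_on {0..} f" and g: "continuous_on {0..} g"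
    and nn: "\<And>x. x \<ge> 0 \<Longrightarrow> 0 \<le> f x"
  shows "fun_calc g (fun_calc f A) = fun_calc (\<lambda>x. g (f x)) A"
proof -
  have "bounded (f ` {0..norm A})"
    by (intro compact_imp_bounded compact_continuous_image continuous_on_subset[OF f]) auto
  then obtain M where M: "\<And>x. x \<in> {0..norm A} \<Longrightarrow> \<bar>f x\<bar> \<le> M"
    unfolding bounded_iff by (metis imageI real_norm_def)
  \<comment> \<open>The interval has to contain both the values of f, where g is evaluated, and the
    norm of f(A), where the calculus of f(A) takes place.\<close>
  define R where "R = max M (norm (fun_calc f A))"
  obtain q where q: "uniform_limit {0..R} (\<lambda>i. poly (q i)) g sequentially"
    using uniform_poly_approx[of R g] continuous_on_subset[OF g, of "{0..R}"] by auto
  have "(\<lambda>i. op_poly (q i) (fun_calc f A)) \<longlonglongrightarrow> fun_calc g (fun_calc f A)"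
    by (rule fun_calc_tendsto[OF psd_fun_calc[OF A f] _ q]) (use nn in \<open>auto simp: R_def\<close>)
  moreover have "(\<lambda>i. fun_calc (\<lambda>x. poly (q i) (f x)) A) \<longlonglongrightarrow> fun_calc (\<lambda>x. g (f x)) A"
  proof (rule fun_calc_uniform_limit[OF A])
    show "continuous_on {0..} (\<lambda>x. poly (q i) (f x))" for i using f by (intro continuous_intros)
    show "continuous_on {0..} (\<lambda>x. g (f x))"
      by (rule continuous_on_compose2[OF g f]) (use nn in auto)
    show "uniform_limit {0..norm A} (\<lambda>i x. poly (q i) (f x)) (\<lambda>x. g (f x)) sequentially"
    proof (rule uniform_limitI)
      fix e :: real assume "0 < e"
      from uniform_limitD[OF q this] show "\<forall>\<^sub>F i in sequentially. \<forall>x\<in>{0..norm A}. dist (poly (q i) (f x)) (g (f x)) < e"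
        by eventually_elim (use M nn in \<open>force simp: R_def\<close>)
    qed
  qed
  ultimately show ?thesis
    by (simp add: op_poly_fun_calc[OF A f] LIMSEQ_unique)
qed

section \<open>Tracial $L^p$ norms\<close>

lemma Bernstein_uniform_limit:
  fixes f :: "real \<Rightarrow> real"
  assumes f: "continuous_on {0..} f" and R: "0 < R"
  shows "uniform_limit {0..R} (\<lambda>n t. \<Sum>j\<le>n. f (R * (j / n)) * Bernstein n j (t / R)) f sequentially"
proof (rule uniform_limitI)
  fix e :: real assume "0 < e"
  have "continuous_on {0..1} (\<lambda>t. f (R * t))"
    by (rule continuous_on_compose2[OF f]) (use R in \<open>auto intro!: continuous_intros\<close>)
  from Bernstein_Weierstrass[OF this \<open>0 < e\<close>] obtain N where
    N: "\<And>n x. N \<le> n \<Longrightarrow> x \<in> {0..1} \<Longrightarrow> \<bar>f (R * x) - (\<Sum>j\<le>n. f (R * (j / n)) * Bernstein n j x)\<bar> < e"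
    by blast
  have "dist (\<Sum>j\<le>n. f (R * (j / n)) * Bernstein n j (t / R)) (f t) < e" if "N \<le> n" "t \<in> {0..R}" for n t
    using N[of n "t / R"] that R by (simp add: dist_real_def abs_minus_commute)
  then show "\<forall>\<^sub>F n in sequentially. \<forall>t\<in>{0..R}. dist (\<Sum>j\<le>n. f (R * (j / n)) * Bernstein n j (t / R)) (f t) < e"
    unfolding eventually_sequentially by blast
qed

lemma continuous_on_Bernstein [continuous_intros]:
  "continuous_on S f \<Longrightarrow> continuous_on S (\<lambda>x. Bernstein n j (f x))"
  unfolding Bernstein_def by (intro continuous_intros)

lemma continuous_on_powr_const: "0 < c \<Longrightarrow> continuous_on {0..} (\<lambda>s::real. s powr c)"
  by (rule continuous_on_powr') auto

lemma sqrt_powr: "0 \<le> s \<Longrightarrow> sqrt s powr p = s powr (p / 2)"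
  by (simp add: powr_half_sqrt[symmetric] powr_powr)

text \<open>\<rho> is meant to be the real part of a trace, so only real linearity is asked;
  \<open>trace_adj\<close> is what remains of a state being compatible with adjoints. Norm
  closedness keeps the functional calculus of elements of M inside M.\<close>

locale tracial_algebra =
  fixes M :: "'a op set" and \<rho> :: "'a op \<Rightarrow> real"
  assumes M_bounded: "x \<in> M \<Longrightarrow> x \<in> bounded_ops"
    and M_id: "id_blinfun \<in> M"
    and M_add: "x \<in> M \<Longrightarrow> y \<in> M \<Longrightarrow> x + y \<in> M"
    and M_scaleR: "x \<in> M \<Longrightarrow> r *\<^sub>R x \<in> M"
    and M_compose: "x \<in> M \<Longrightarrow> y \<in> M \<Longrightarrow> x o\<^sub>L y \<in> M"
    and M_adj: "x \<in> M \<Longrightarrow> op_adj x \<in> M"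
    and M_closed: "closed M"
    and trace_add: "x \<in> M \<Longrightarrow> y \<in> M \<Longrightarrow> \<rho> (x + y) = \<rho> x + \<rho> y"
    and trace_scaleR: "x \<in> M \<Longrightarrow> \<rho> (r *\<^sub>R x) = r * \<rho> x"
    and trace_commute: "x \<in> M \<Longrightarrow> y \<in> M \<Longrightarrow> \<rho> (x o\<^sub>L y) = \<rho> (y o\<^sub>L x)"
    and trace_adj: "x \<in> M \<Longrightarrow> \<rho> (op_adj x) = \<rho> x"
    and trace_nonneg: "x \<in> M \<Longrightarrow> psd x \<Longrightarrow> 0 \<le> \<rho> x"
    and trace_id: "\<rho> id_blinfun = 1"
begin

lemma M_zero: "0 \<in> M"
  using M_scaleR[OF M_id, of 0] by simp

lemma M_diff: "x \<in> M \<Longrightarrow> y \<in> M \<Longrightarrow> x - y \<in> M"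
  using M_add[OF _ M_scaleR[of y "-1"], of x] by simp

lemma trace_diff: "x \<in> M \<Longrightarrow> y \<in> M \<Longrightarrow> \<rho> (x - y) = \<rho> x - \<rho> y"
  using trace_add[of x "(-1) *\<^sub>R y"] trace_scaleR[of y "-1"] M_scaleR[of y "-1"] by simp

lemma M_sum: "(\<And>i. i \<in> I \<Longrightarrow> f i \<in> M) \<Longrightarrow> (\<Sum>i\<in>I. f i) \<in> M"
  by (induction I rule: infinite_finite_induct) (auto intro: M_zero M_add)

lemma trace_zero: "\<rho> 0 = 0"
  using trace_scaleR[OF M_zero, of 0] by simp

lemma trace_sum: "(\<And>i. i \<in> I \<Longrightarrow> f i \<in> M) \<Longrightarrow> \<rho> (\<Sum>i\<in>I. f i) = (\<Sum>i\<in>I. \<rho> (f i))"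
  by (induction I rule: infinite_finite_induct) (auto simp: trace_zero trace_add M_sum)

lemma psd_square: "x \<in> M \<Longrightarrow> psd (op_adj x o\<^sub>L x)" "x \<in> M \<Longrightarrow> psd (x o\<^sub>L op_adj x)"
  using psd_adj_compose[of x] psd_adj_compose[of "op_adj x"] M_bounded op_adj_bounded by fastforce+

lemma M_square: "x \<in> M \<Longrightarrow> op_adj x o\<^sub>L x \<in> M" "x \<in> M \<Longrightarrow> x o\<^sub>L op_adj x \<in> M"
  by (auto intro: M_compose M_adj)

lemma trace_le_norm:
  assumes "x \<in> M" "psd x"
  shows "\<rho> x \<le> norm x"
proof -
  have "0 \<le> \<rho> (norm x *\<^sub>R id_blinfun - x)"
    by (intro trace_nonneg M_diff M_scaleR M_id assms psd_id_minus psd_bounded psd_self_adjoint order_refl)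
  then show ?thesis
    using assms by (simp add: trace_diff trace_scaleR M_scaleR M_id trace_id)
qed

text \<open>The variance of x is nonnegative: \<rho> of |x - \<rho>(x)|^2 equals \<rho> of |x|^2
  minus \<rho>(x)^2. With the C*-identity this yields norm continuity of \<rho>.\<close>

lemma abs_trace_le:
  assumes x: "x \<in> M"
  shows "\<bar>\<rho> x\<bar> \<le> norm x"
proof -
  define y where "y = x - \<rho> x *\<^sub>R id_blinfun"
  have y: "y \<in> M" using x by (simp add: y_def M_diff M_scaleR M_id)
  have "op_adj y o\<^sub>L y = (op_adj x o\<^sub>L x) - \<rho> x *\<^sub>R x - \<rho> x *\<^sub>R op_adj x + (\<rho> x)\<^sup>2 *\<^sub>R id_blinfun"
    using M_bounded[OF x]
    by (simp add: y_def op_adj_diff op_adj_scaleR bounded_ops_scaleR compose_simps power2_eq_square algebra_simps)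
  moreover have "0 \<le> \<rho> (op_adj y o\<^sub>L y)"
    by (intro trace_nonneg psd_square M_square y)
  ultimately have "(\<rho> x)\<^sup>2 \<le> \<rho> (op_adj x o\<^sub>L x)"
    using x by (simp add: trace_add trace_diff trace_scaleR trace_adj trace_id M_add M_diff M_scaleR M_adj M_compose M_id power2_eq_square)
  also have "\<dots> \<le> (norm x)\<^sup>2"
    using trace_le_norm[OF M_square(1)[OF x] psd_square(1)[OF x]] norm_op_adj_compose[OF M_bounded[OF x]] by simp
  finally show ?thesis by (simp add: power2_le_iff_abs_le)
qed

lemma tendsto_trace:
  assumes "X \<longlonglongrightarrow> A" "\<And>i. X i \<in> M"
  shows "(\<lambda>i. \<rho> (X i)) \<longlonglongrightarrow> \<rho> A"
proof -
  have A: "A \<in> M" using closed_sequentially[OF M_closed] assms by blast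
  have "(\<lambda>i. norm (X i - A)) \<longlonglongrightarrow> 0"
    using assms(1) by (simp add: tendsto_norm_zero_iff LIM_zero_iff)
  then have "(\<lambda>i. \<rho> (X i) - \<rho> A) \<longlonglongrightarrow> 0"
    by (rule Lim_null_comparison[rotated])
      (use abs_trace_le[OF M_diff[OF assms(2) A]] in \<open>auto simp: trace_diff[OF assms(2) A]\<close>)
  then show ?thesis by (simp add: LIM_zero_iff)
qed

lemma M_op_poly: "A \<in> M \<Longrightarrow> op_poly q A \<in> M"
  by (induction q) (auto simp: op_poly_pCons intro: M_zero M_add M_scaleR M_id M_compose)

lemma M_fun_calc:
  assumes "psd A" "A \<in> M" "continuous_on {0..} f"
  shows "fun_calc f A \<in> M"
  using fun_calc_approx[OF assms(1,3)] closed_sequentially[OF M_closed] M_op_poly[OF assms(2)] by metis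

lemma trace_fun_calc_mono:
  assumes A: "psd A" "A \<in> M" and f: "continuous_on {0..} f" and g: "continuous_on {0..} g"
    and le: "\<And>x. x \<in> {0..norm A} \<Longrightarrow> f x \<le> g x"
  shows "\<rho> (fun_calc f A) \<le> \<rho> (fun_calc g A)"
proof -
  have c: "continuous_on {0..} (\<lambda>x. g x - f x)" using f g by (intro continuous_intros)
  have "0 \<le> \<rho> (fun_calc (\<lambda>x. g x - f x) A)"
    using le by (intro trace_nonneg M_fun_calc psd_fun_calc A c) auto
  then show ?thesis
    using f g A by (simp add: fun_calc_diff trace_diff M_fun_calc)
qed

text \<open>The two products have equal norms, so one sequence of polynomials approximates f for
  both. For a polynomial c + s p'(s) the constant terms agree, and the rest is transported by
  intertwining with a and cyclicity.\<close>

lemma trace_fun_calc_swap: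
  assumes a: "a \<in> M" and f: "continuous_on {0..} f"
  shows "\<rho> (fun_calc f (op_adj a o\<^sub>L a)) = \<rho> (fun_calc f (a o\<^sub>L op_adj a))"
proof -
  let ?x = "op_adj a o\<^sub>L a" and ?y = "a o\<^sub>L op_adj a"
  have "norm ?x = norm ?y"
    using M_bounded[OF a] norm_op_adj_compose[of a] norm_op_adj_compose[of "op_adj a"]
    by (simp add: op_adj_bounded)
  moreover obtain q where q: "uniform_limit {0..norm ?x} (\<lambda>i. poly (q i)) f sequentially"
    using uniform_poly_approx[of "norm ?x" f] continuous_on_subset[OF f, of "{0..norm ?x}"] by auto
  ultimately have "(\<lambda>i. op_poly (q i) ?x) \<longlonglongrightarrow> fun_calc f ?x" "(\<lambda>i. op_poly (q i) ?y) \<longlonglongrightarrow> fun_calc f ?y"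
    using a by (auto intro!: fun_calc_tendsto[where R = "norm ?x"] psd_square)
  then have "(\<lambda>i. \<rho> (op_poly (q i) ?x)) \<longlonglongrightarrow> \<rho> (fun_calc f ?x)" "(\<lambda>i. \<rho> (op_poly (q i) ?y)) \<longlonglongrightarrow> \<rho> (fun_calc f ?y)"
    using a by (auto intro!: tendsto_trace M_op_poly M_square)
  moreover have "\<rho> (op_poly p ?x) = \<rho> (op_poly p ?y)" for p
  proof (cases p)
    case (pCons c p')
    have P: "op_poly p' ?x \<in> M" "op_poly p' ?y \<in> M" using a by (auto intro: M_op_poly M_square)
    have "\<rho> (?x o\<^sub>L op_poly p' ?x) = \<rho> (op_adj a o\<^sub>L (op_poly p' ?y o\<^sub>L a))"
      using op_poly_intertwine[of a ?x ?y p'] by (simp add: compose_assoc)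
    also have "\<dots> = \<rho> (op_poly p' ?y o\<^sub>L ?y)"
      using trace_commute[of "op_adj a" "op_poly p' ?y o\<^sub>L a"] a P by (simp add: M_adj M_compose compose_assoc)
    also have "\<dots> = \<rho> (?y o\<^sub>L op_poly p' ?y)"
      using a P by (intro trace_commute M_square)
    finally show ?thesis
      using a P by (simp add: pCons op_poly_pCons trace_add M_scaleR M_id M_compose M_square)
  qed
  ultimately show ?thesis by (simp add: LIMSEQ_unique)
qed

text \<open>f(x) = S^2 with S = sqrt(f)(x), and cyclicity turns the trace into that of S g(y) S,
  which is positive although x and y need not commute.\<close>

lemma trace_product_nonneg:
  assumes x: "psd x" "x \<in> M" and y: "psd y" "y \<in> M"
    and f: "continuous_on {0..} f" "\<And>s. s \<in> {0..norm x} \<Longrightarrow> 0 \<le> f s"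
    and g: "continuous_on {0..} g" "\<And>t. t \<in> {0..norm y} \<Longrightarrow> 0 \<le> g t"
  shows "0 \<le> \<rho> (fun_calc f x o\<^sub>L fun_calc g y)"
proof -
  let ?s = "\<lambda>s. sqrt (f s)"
  have s: "continuous_on {0..} ?s" using f(1) by (intro continuous_intros)
  define S where "S = fun_calc ?s x"
  define G where "G = fun_calc g y"
  have S: "S \<in> M" "op_adj S = S" using x s by (auto simp: S_def M_fun_calc op_adj_fun_calc)
  have G: "G \<in> M" "psd G" using y g by (auto simp: G_def intro!: M_fun_calc psd_fun_calc)
  have "fun_calc f x = fun_calc (\<lambda>s. ?s s * ?s s) x"
    by (rule fun_calc_cong) (use f(2) in auto)
  then have "fun_calc f x = S o\<^sub>L S" by (simp only: fun_calc_mult[OF x(1) s s] S_def)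
  then have "\<rho> (fun_calc f x o\<^sub>L G) = \<rho> (S o\<^sub>L G o\<^sub>L S)"
    using trace_commute[of S "S o\<^sub>L G"] S G by (simp add: compose_assoc M_compose)
  also have "\<dots> \<ge> 0"
    using psd_conj[OF G(2) M_bounded[OF S(1)]] S G by (intro trace_nonneg) (auto intro: M_compose)
  finally show ?thesis by (simp add: G_def)
qed

text \<open>
  The map \<open>f \<otimes> g \<mapsto> \<rho> (f(x) g(y))\<close> is a positive functional on functions of two variables.
  Replacing \<open>\<psi>\<close> and \<open>G\<close> by their Bernstein polynomials turns \<open>F(s) + G(t) - \<phi>(s) \<psi>(t)\<close>
  into a sum of products of nonnegative functions of one variable.
\<close>

lemma trace_product_le:
  assumes x: "psd x" "x \<in> M" "norm x \<le> R" and y: "psd y" "y \<in> M" "norm y \<le> R" and R: "0 < R"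
    and cont: "continuous_on {0..} \<phi>" "continuous_on {0..} \<psi>" "continuous_on {0..} F" "continuous_on {0..} G"
    and le: "\<And>s t. s \<in> {0..R} \<Longrightarrow> t \<in> {0..R} \<Longrightarrow> \<phi> s * \<psi> t \<le> F s + G t"
  shows "\<rho> (fun_calc \<phi> x o\<^sub>L fun_calc \<psi> y) \<le> \<rho> (fun_calc F x) + \<rho> (fun_calc G y)"
proof -
  define b where "b n j t = Bernstein n j (t / R)" for n j t
  define B where "B f n t = (\<Sum>j\<le>n. f (R * (real j / real n)) * b n j t)" for f :: "real \<Rightarrow> real" and n t
  have b: "continuous_on {0..} (b n j)" for n j
    unfolding b_def using R by (intro continuous_intros) auto
  have cB: "continuous_on {0..} (B f n)" for f n
    unfolding B_def using b by (intro continuous_intros)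
  have bM: "fun_calc (b n j) y \<in> M" for n j by (intro M_fun_calc y b)
  have FM: "fun_calc F x \<in> M" "fun_calc \<phi> x \<in> M" "fun_calc (B f n) y \<in> M" for f n
    using x y cont cB by (auto intro: M_fun_calc)
  have B_eq: "fun_calc (B f n) y = (\<Sum>j\<le>n. f (R * (real j / real n)) *\<^sub>R fun_calc (b n j) y)" for f n
    unfolding B_def using b y by (subst fun_calc_sum) (auto simp: fun_calc_cmult intro!: continuous_intros)
  have B_lim: "(\<lambda>n. fun_calc (B f n) y) \<longlonglongrightarrow> fun_calc f y" if "continuous_on {0..} f" for f
    unfolding B_def b_def
  proof (rule fun_calc_uniform_limit[OF y(1) _ that])
    show "continuous_on {0..} (\<lambda>t. \<Sum>j\<le>i. f (R * (real j / real i)) * Bernstein i j (t / R))" for i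
      using cB[of f i] by (simp add: B_def b_def)
    show "uniform_limit {0..norm y} (\<lambda>n t. \<Sum>j\<le>n. f (R * (real j / real n)) * Bernstein n j (t / R)) f sequentially"
      using y(3) by (intro uniform_limit_on_subset[OF Bernstein_uniform_limit[OF that R]]) auto
  qed
  have approx: "\<rho> (fun_calc \<phi> x o\<^sub>L fun_calc (B \<psi> n) y) \<le> \<rho> (fun_calc F x) + \<rho> (fun_calc (B G n) y)" for n
  proof -
    define u where "u j = R * (real j / real n)" for j
    \<comment> \<open>For n = 0 division by zero puts the only node at 0.\<close>
    have u: "u j \<in> {0..R}" if "j \<le> n" for j
      using that R by (cases "n = 0") (auto simp: u_def divide_simps)
    \<comment> \<open>The scalar inequality with t frozen at the node \<open>u j\<close>; it
      involves only x, so it can be multiplied by the Bernstein polynomial in y belonging to that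
      node.\<close>
    define h where "h j s = F s + G (u j) - \<psi> (u j) * \<phi> s" for j s
    have hc: "continuous_on {0..} (h j)" for j unfolding h_def using cont by (intro continuous_intros)
    have h_eq: "fun_calc (h j) x = fun_calc F x + G (u j) *\<^sub>R id_blinfun - \<psi> (u j) *\<^sub>R fun_calc \<phi> x" for j
      unfolding h_def using cont x(1)
      by (simp add: fun_calc_diff fun_calc_add fun_calc_cmult fun_calc_const continuous_intros)
    have "0 \<le> \<rho> (fun_calc (h j) x o\<^sub>L fun_calc (b n j) y)" if "j \<le> n" for j
    proof (rule trace_product_nonneg[OF x(1,2) y(1,2) hc _ b])
      fix s assume "s \<in> {0..norm x}"
      with x(3) le[OF _ u[OF that], of s] show "0 \<le> h j s" by (auto simp: h_def mult.commute)
    next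
      fix t assume "t \<in> {0..norm y}"
      with y(3) R show "0 \<le> b n j t" by (auto simp: b_def intro!: Bernstein_nonneg)
    qed
    then have "0 \<le> (\<Sum>j\<le>n. \<rho> (fun_calc (h j) x o\<^sub>L fun_calc (b n j) y))"
      by (intro sum_nonneg) auto
    also have "\<dots> = (\<Sum>j\<le>n. \<rho> (fun_calc F x o\<^sub>L fun_calc (b n j) y)) + (\<Sum>j\<le>n. \<rho> (G (u j) *\<^sub>R fun_calc (b n j) y))
        - (\<Sum>j\<le>n. \<rho> (fun_calc \<phi> x o\<^sub>L (\<psi> (u j) *\<^sub>R fun_calc (b n j) y)))"
      using FM bM
      by (simp add: h_eq compose_simps trace_add trace_diff trace_scaleR M_add M_diff M_scaleR M_compose
        sum.distrib sum_subtractf)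
    also have "(\<Sum>j\<le>n. \<rho> (fun_calc F x o\<^sub>L fun_calc (b n j) y)) = \<rho> (fun_calc F x o\<^sub>L (\<Sum>j\<le>n. fun_calc (b n j) y))"
      using FM bM by (simp add: bounded_bilinear.sum_right[OF bounded_bilinear_blinfun_compose] trace_sum M_compose)
    also have "(\<Sum>j\<le>n. fun_calc (b n j) y) = id_blinfun"
    proof -
      \<comment> \<open>Bernstein polynomials reproduce constants, so summing over the nodes leaves
        F(x) unchanged.\<close>
      have "B (\<lambda>_. 1) n = (\<lambda>_. 1)" by (rule ext) (simp add: B_def b_def)
      then show ?thesis using B_eq[of "\<lambda>_. 1" n] fun_calc_const[OF y(1), of 1] by simp
    qed
    also have "(\<Sum>j\<le>n. \<rho> (G (u j) *\<^sub>R fun_calc (b n j) y)) = \<rho> (fun_calc (B G n) y)"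
      unfolding B_eq using bM by (simp add: trace_sum M_scaleR u_def)
    also have "(\<Sum>j\<le>n. \<rho> (fun_calc \<phi> x o\<^sub>L (\<psi> (u j) *\<^sub>R fun_calc (b n j) y))) = \<rho> (fun_calc \<phi> x o\<^sub>L fun_calc (B \<psi> n) y)"
      unfolding B_eq using bM FM
      by (simp add: bounded_bilinear.sum_right[OF bounded_bilinear_blinfun_compose] trace_sum M_compose M_scaleR u_def)
    finally show ?thesis by simp
  qed
  have "(\<lambda>n. \<rho> (fun_calc \<phi> x o\<^sub>L fun_calc (B \<psi> n) y)) \<longlonglongrightarrow> \<rho> (fun_calc \<phi> x o\<^sub>L fun_calc \<psi> y)"
    using FM cont by (intro tendsto_trace M_compose bounded_bilinear.tendsto[OF bounded_bilinear_blinfun_compose] tendsto_const B_lim)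
  moreover have "(\<lambda>n. \<rho> (fun_calc F x) + \<rho> (fun_calc (B G n) y)) \<longlonglongrightarrow> \<rho> (fun_calc F x) + \<rho> (fun_calc G y)"
    using FM cont by (intro tendsto_intros tendsto_trace B_lim)
  ultimately show ?thesis
    by (rule LIMSEQ_le) (use approx in blast)
qed

section \<open>Traces of powers and the tracial Young inequality\<close>

definition pow_trace :: "real \<Rightarrow> 'a op \<Rightarrow> real" where
  "pow_trace p a = \<rho> (fun_calc (\<lambda>s. s powr (p / 2)) (op_adj a o\<^sub>L a))"

definition Lp :: "real \<Rightarrow> 'a op \<Rightarrow> real" where
  "Lp p a = \<rho> (fun_calc (\<lambda>x. x powr p) (op_abs a)) powr (1 / p)"

text \<open>
  With \<open>x = a\<^sup>* a\<close>, \<open>x' = a a\<^sup>*\<close>, \<open>y = c c\<^sup>*\<close>, \<open>y' = c\<^sup>* c\<close> and \<open>\<phi>(s) = (s + \<epsilon>)\<^bsup>1/4\<^esup>\<close>, the factorization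
  \<open>\<rho> (c a) = \<rho> (P Q)\<close>, \<open>P = \<phi>(x) \<phi>\<^sup>-\<^sup>1(y) c\<close>, \<open>Q = \<phi>(y') \<phi>\<^sup>-\<^sup>1(x') a\<close>, replaces a polar decomposition:
  \<open>P P\<^sup>*\<close> and \<open>Q Q\<^sup>*\<close> have traces of the form treated in \<open>trace_product_le\<close>.
\<close>

lemma trace_Young:
  assumes a: "a \<in> M" and c: "c \<in> M" and p: "1 < p" and q: "1 < q" "1 / p + 1 / q = 1"
  shows "\<rho> (c o\<^sub>L a) \<le> pow_trace p a / p + pow_trace q c / q"
proof -
  define x where "x = op_adj a o\<^sub>L a"
  define x' where "x' = a o\<^sub>L op_adj a"
  define y where "y = c o\<^sub>L op_adj c"
  define y' where "y' = op_adj c o\<^sub>L c"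
  have psd: "psd x" "psd x'" "psd y" "psd y'" and M: "x \<in> M" "x' \<in> M" "y \<in> M" "y' \<in> M"
    using a c by (auto simp: x_def x'_def y_def y'_def intro: psd_square M_square)
  define R where "R = norm x + norm x' + norm y + norm y' + 1"
  have R: "norm x \<le> R" "norm x' \<le> R" "norm y \<le> R" "norm y' \<le> R" "0 < R"
    by (auto simp: R_def add_nonneg_pos add.assoc)
  define F where "F s = s powr (p / 2) / p" for s
  define G where "G s = s powr (q / 2) / q" for s
  have FG: "continuous_on {0..} F" "continuous_on {0..} G"
    unfolding F_def G_def using p q by (auto intro!: continuous_intros continuous_on_powr_const)
  have \<rho>F: "\<rho> (fun_calc F x) = pow_trace p a / p"
    unfolding F_def using fun_calc_cmult[OF psd(1), of "\<lambda>s. s powr (p / 2)" "1 / p"] p M psd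
    by (simp add: continuous_on_powr_const trace_scaleR M_fun_calc pow_trace_def x_def)
  have \<rho>G: "\<rho> (fun_calc G y') = pow_trace q c / q"
    unfolding G_def using fun_calc_cmult[OF psd(4), of "\<lambda>s. s powr (q / 2)" "1 / q"] q M psd
    by (simp add: continuous_on_powr_const trace_scaleR M_fun_calc pow_trace_def y'_def)
  have swapF: "\<rho> (fun_calc F x') = \<rho> (fun_calc F x)" and swapG: "\<rho> (fun_calc G y) = \<rho> (fun_calc G y')"
    using trace_fun_calc_swap[OF a FG(1)] trace_fun_calc_swap[OF c FG(2)] by (simp_all add: x_def x'_def y_def y'_def)
  have eps: "\<rho> (c o\<^sub>L a) \<le> \<rho> (fun_calc F x) + \<rho> (fun_calc G y') + sqrt \<epsilon> * sqrt R" if \<epsilon>: "0 < \<epsilon>" for \<epsilon>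
  proof -
    \<comment> \<open>The shift by \<epsilon> makes \<phi> invertible at 0. The fourth root is taken
      because \<phi> occurs squared in P P^*: its square at x approximates |a|, and y divided by its
      square at y approximates the square root of y.\<close>
    define \<phi> where "\<phi> s = sqrt (sqrt (s + \<epsilon>))" for s
    define \<phi>i where "\<phi>i s = inverse (\<phi> s)" for s
    have pos: "0 < \<phi> s" if "s \<ge> 0" for s using that \<epsilon> by (simp add: \<phi>_def)
    have cont: "continuous_on {0..} \<phi>" "continuous_on {0..} \<phi>i"
      "continuous_on {0..} (\<lambda>s. \<phi> s * \<phi> s)" "continuous_on {0..} (\<lambda>s. \<phi>i s * s * \<phi>i s)"
      unfolding \<phi>i_def \<phi>_def using \<epsilon> by (auto intro!: continuous_intros)
    have inv: "fun_calc \<phi> z o\<^sub>L fun_calc \<phi>i z = id_blinfun" "fun_calc \<phi>i z o\<^sub>L fun_calc \<phi> z = id_blinfun" if "psd z" for z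
    proof -
      have "fun_calc (\<lambda>s. \<phi> s * \<phi>i s) z = fun_calc (\<lambda>s. 1) z"
        by (rule fun_calc_cong) (use pos in \<open>force simp: \<phi>i_def\<close>)
      then show "fun_calc \<phi> z o\<^sub>L fun_calc \<phi>i z = id_blinfun" "fun_calc \<phi>i z o\<^sub>L fun_calc \<phi> z = id_blinfun"
        using fun_calc_mult[OF that cont(1,2)] fun_calc_mult[OF that cont(2,1)]
        by (simp_all add: fun_calc_const[OF that] mult.commute)
    qed
    note calcM = M_fun_calc[OF _ _ cont(1)] M_fun_calc[OF _ _ cont(2)]
    define P where "P = fun_calc \<phi> x o\<^sub>L (fun_calc \<phi>i y o\<^sub>L c)"
    define Q where "Q = fun_calc \<phi> y' o\<^sub>L (fun_calc \<phi>i x' o\<^sub>L a)"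
    have PQM: "P \<in> M" "Q \<in> M" using a c psd M calcM by (auto simp: P_def Q_def intro!: M_compose)
    \<comment> \<open>Intertwining moves \<phi>(y') through c, where it cancels the inverse at y,
      and moves the inverse at x' through a; cyclicity then cancels the latter against
      \<phi>(x).\<close>
    have ca: "\<rho> (P o\<^sub>L Q) = \<rho> (c o\<^sub>L a)"
    proof -
      have 1: "c o\<^sub>L fun_calc \<phi> y' = fun_calc \<phi> y o\<^sub>L c"
        by (rule fun_calc_intertwine[OF psd(4) psd(3) _ cont(1)]) (simp add: y_def y'_def compose_assoc)
      have 2: "a o\<^sub>L fun_calc \<phi>i x = fun_calc \<phi>i x' o\<^sub>L a"
        by (rule fun_calc_intertwine[OF psd(1) psd(2) _ cont(2)]) (simp add: x_def x'_def compose_assoc)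
      have "P o\<^sub>L Q = fun_calc \<phi> x o\<^sub>L (fun_calc \<phi>i y o\<^sub>L ((c o\<^sub>L fun_calc \<phi> y') o\<^sub>L (fun_calc \<phi>i x' o\<^sub>L a)))"
        by (simp add: P_def Q_def compose_assoc)
      also have "\<dots> = fun_calc \<phi> x o\<^sub>L ((fun_calc \<phi>i y o\<^sub>L fun_calc \<phi> y) o\<^sub>L (c o\<^sub>L (a o\<^sub>L fun_calc \<phi>i x)))"
        by (simp only: 1 2 compose_assoc)
      also have "\<dots> = fun_calc \<phi> x o\<^sub>L (c o\<^sub>L a o\<^sub>L fun_calc \<phi>i x)"
        by (simp add: inv psd compose_assoc)
      finally have "\<rho> (P o\<^sub>L Q) = \<rho> ((c o\<^sub>L a o\<^sub>L fun_calc \<phi>i x) o\<^sub>L fun_calc \<phi> x)"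
        using trace_commute[of "fun_calc \<phi> x" "c o\<^sub>L a o\<^sub>L fun_calc \<phi>i x"] a c psd M calcM by (simp add: M_compose)
      then show ?thesis by (simp add: compose_assoc inv psd)
    qed
    have \<phi>2: "\<phi> s * \<phi> s \<le> sqrt s + sqrt \<epsilon>" if "s \<ge> 0" for s
      using that \<epsilon> sqrt_add_le_add_sqrt[of s \<epsilon>] by (simp add: \<phi>_def)
    have \<phi>i2: "\<phi>i t * t * \<phi>i t \<le> sqrt t" if "t \<ge> 0" for t
    proof -
      have "\<phi>i t * t * \<phi>i t = t / sqrt (t + \<epsilon>)"
        using that \<epsilon> by (simp add: \<phi>i_def \<phi>_def field_simps)
      also have "\<dots> \<le> sqrt t"
      proof (cases "t = 0")
        case False
        then have "t / sqrt (t + \<epsilon>) \<le> t / sqrt t"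
          using that \<epsilon> by (intro divide_left_mono) auto
        then show ?thesis by (simp add: real_div_sqrt that)
      qed simp
      finally show ?thesis .
    qed
    \<comment> \<open>One estimate serves both factors: for Q the roles of F and G are
      exchanged.\<close>
    have bound: "\<rho> (Z o\<^sub>L op_adj Z) \<le> \<rho> (fun_calc H v) + \<rho> (fun_calc K w) + sqrt \<epsilon> * sqrt R"
      if Z: "Z = fun_calc \<phi> v o\<^sub>L (fun_calc \<phi>i w o\<^sub>L b)" and b: "b \<in> M" and w: "w = b o\<^sub>L op_adj b" "norm w \<le> R"
        and v: "psd v" "v \<in> M" "norm v \<le> R" and HK: "continuous_on {0..} H" "continuous_on {0..} K"
        and le: "\<And>s t. 0 \<le> s \<Longrightarrow> 0 \<le> t \<Longrightarrow> sqrt s * sqrt t \<le> H s + K t" for Z v w b H K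
    proof -
      have w': "psd w" "w \<in> M" using b by (auto simp: w intro: psd_square M_square)
      \<comment> \<open>The regularisation error is a constant and is absorbed into one of the two
        functions; under \<rho> it contributes itself, since the identity has trace 1.\<close>
      define K' where "K' t = K t + sqrt \<epsilon> * sqrt R" for t
      have K': "continuous_on {0..} K'" unfolding K'_def using HK by (auto intro!: continuous_intros)
      have "b o\<^sub>L (op_adj b o\<^sub>L z) = w o\<^sub>L z" for z :: "'a op" by (simp add: w compose_assoc)
      then have "Z o\<^sub>L op_adj Z = fun_calc \<phi> v o\<^sub>L fun_calc (\<lambda>s. \<phi>i s * s * \<phi>i s) w o\<^sub>L fun_calc \<phi> v"
        using b v w' cont
        by (simp add: Z op_adj_compose bounded_ops_compose M_bounded M_fun_calc op_adj_fun_calc fun_calc_mult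
            fun_calc_ident continuous_intros compose_assoc)
      then have "\<rho> (Z o\<^sub>L op_adj Z) = \<rho> (fun_calc (\<lambda>s. \<phi> s * \<phi> s) v o\<^sub>L fun_calc (\<lambda>s. \<phi>i s * s * \<phi>i s) w)"
        using trace_commute[of "fun_calc \<phi> v" "fun_calc \<phi> v o\<^sub>L fun_calc (\<lambda>s. \<phi>i s * s * \<phi>i s) w"] v w' cont
        by (simp add: fun_calc_mult[OF v(1) cont(1) cont(1)] M_compose M_fun_calc compose_assoc)
      also have "\<dots> \<le> \<rho> (fun_calc H v) + \<rho> (fun_calc K' w)"
      proof (rule trace_product_le[OF v w' w(2) R(5) cont(3,4) HK(1) K'])
        fix s t assume s: "s \<in> {0..R}" and t: "t \<in> {0..R}"
        have "\<phi> s * \<phi> s * (\<phi>i t * t * \<phi>i t) \<le> (sqrt s + sqrt \<epsilon>) * sqrt t"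
          using s t \<epsilon> by (intro mult_mono \<phi>2 \<phi>i2) (auto simp: \<phi>i_def \<phi>_def)
        also have "\<dots> \<le> sqrt s * sqrt t + sqrt \<epsilon> * sqrt R"
          using t \<epsilon> by (simp add: distrib_right mult_left_mono)
        finally show "\<phi> s * \<phi> s * (\<phi>i t * t * \<phi>i t) \<le> H s + K' t"
          using le[of s t] s t by (simp add: K'_def)
      qed
      also have "\<rho> (fun_calc K' w) = \<rho> (fun_calc K w) + sqrt \<epsilon> * sqrt R"
        unfolding K'_def using w' HK
        by (simp add: fun_calc_add fun_calc_const trace_add trace_scaleR M_fun_calc M_scaleR M_id trace_id)
      finally show ?thesis by simp
    qed
    have young: "sqrt s * sqrt t \<le> F s + G t" if "s \<ge> 0" "t \<ge> 0" for s t
      using Youngs_inequality[of p q "sqrt s" "sqrt t"] that p q by (simp add: F_def G_def sqrt_powr)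
    have "\<rho> (P o\<^sub>L op_adj P) \<le> \<rho> (fun_calc F x) + \<rho> (fun_calc G y) + sqrt \<epsilon> * sqrt R"
      by (rule bound[OF P_def c y_def R(3) psd(1) M(1) R(1) FG young])
    moreover have "\<rho> (Q o\<^sub>L op_adj Q) \<le> \<rho> (fun_calc G y') + \<rho> (fun_calc F x') + sqrt \<epsilon> * sqrt R"
      by (rule bound[OF Q_def a x'_def R(2) psd(4) M(4) R(4) FG(2,1)]) (use young in \<open>metis add.commute mult.commute\<close>)
    \<comment> \<open>The Hilbert-Schmidt form of 2 s t \<le> s^2 + t^2, with \<open>D\<close> as
      the difference.\<close>
    moreover have "2 * \<rho> (P o\<^sub>L Q) \<le> \<rho> (P o\<^sub>L op_adj P) + \<rho> (Q o\<^sub>L op_adj Q)"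
    proof -
      define D where "D = op_adj P - Q"
      have D: "D \<in> M" using PQM by (simp add: D_def M_adj M_diff)
      have bdPQ: "P \<in> bounded_ops" "Q \<in> bounded_ops" using PQM M_bounded by auto
      have "op_adj D o\<^sub>L D = (P o\<^sub>L op_adj P) - (P o\<^sub>L Q) - op_adj (P o\<^sub>L Q) + (op_adj Q o\<^sub>L Q)"
        using bdPQ by (simp add: D_def op_adj_diff op_adj_bounded op_adj_compose compose_simps)
      moreover have "0 \<le> \<rho> (op_adj D o\<^sub>L D)" by (intro trace_nonneg psd_square M_square D)
      ultimately show ?thesis
        using PQM by (simp add: trace_add trace_diff trace_adj trace_commute[of Q] M_add M_diff M_adj M_compose)
    qed
    ultimately show ?thesis by (simp add: ca swapF swapG)
  qed
  have "(\<lambda>n. \<rho> (fun_calc F x) + \<rho> (fun_calc G y') + sqrt (inverse (real (Suc n))) * sqrt R)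
      \<longlonglongrightarrow> \<rho> (fun_calc F x) + \<rho> (fun_calc G y') + sqrt 0 * sqrt R"
    by (intro tendsto_intros LIMSEQ_inverse_real_of_nat)
  then have "\<rho> (c o\<^sub>L a) \<le> \<rho> (fun_calc F x) + \<rho> (fun_calc G y') + sqrt 0 * sqrt R"
    by (rule LIMSEQ_le_const) (use eps in auto)
  then show ?thesis by (simp add: \<rho>F \<rho>G)
qed

section \<open>Convexity and the L^p norm\<close>

lemma pow_trace_nonneg:
  assumes "a \<in> M" "0 < p"
  shows "0 \<le> pow_trace p a"
  unfolding pow_trace_def using assms
  by (intro trace_nonneg M_fun_calc psd_fun_calc psd_square M_square continuous_on_powr_const) auto

text \<open>Young's inequality is applied to a and to b with one c that is almost extremal for their
  combination z. Then \<rho>(c z) is nearly \<open>pow_trace p z\<close>, while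
  \<open>pow_trace q c\<close> is at most \<open>pow_trace p z\<close>. Linearity of \<rho>(c z) in
  z combines the two inequalities, and moving the term in z to the left leaves the fraction 1 - 1 /
  q = 1 / p of it.\<close>

lemma pow_trace_convex:
  assumes a: "a \<in> M" and b: "b \<in> M" and p: "1 < p" and \<mu>: "0 \<le> \<mu>" "0 \<le> \<nu>" "\<mu> + \<nu> = 1"
  shows "pow_trace p (\<mu> *\<^sub>R a + \<nu> *\<^sub>R b) \<le> \<mu> * pow_trace p a + \<nu> * pow_trace p b"
proof -
  define z where "z = \<mu> *\<^sub>R a + \<nu> *\<^sub>R b"
  define w where "w = op_adj z o\<^sub>L z"
  define q where "q = p / (p - 1)"
  have q: "1 < q" "1 / p + 1 / q = 1" and pq: "(p - 1) * (q / 2) = p / 2"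
    using p by (auto simp: q_def divide_simps)
  have z: "z \<in> M" using a b by (simp add: z_def M_add M_scaleR)
  have w: "psd w" "w \<in> M" using z by (auto simp: w_def intro: psd_square M_square)
  define E where "E s = s powr (p / 2)" for s :: real
  have E: "continuous_on {0..} E" using p unfolding E_def by (intro continuous_on_powr_const) auto
  define R where "R = norm w"
  have eps: "pow_trace p z - sqrt \<epsilon> * R powr ((p - 1) / 2)
      \<le> (\<mu> * pow_trace p a + \<nu> * pow_trace p b) / p + pow_trace p z / q" if \<epsilon>: "0 < \<epsilon>" for \<epsilon>
  proof -
    \<comment> \<open>Approximates s^(p/2 - 1), which is singular at 0 when p < 2; so c approximates
      |z|^(p - 2) times the adjoint of z.\<close>
    define g where "g s = s powr (p / 2) / (s + \<epsilon>)" for s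
    have g: "continuous_on {0..} g"
      unfolding g_def using p \<epsilon> by (intro continuous_intros continuous_on_powr_const) auto
    define c where "c = fun_calc g w o\<^sub>L op_adj z"
    have gM: "fun_calc g w \<in> M" using w g by (intro M_fun_calc)
    have c: "c \<in> M" using gM z by (simp add: c_def M_compose M_adj)
    have gs: "continuous_on {0..} (\<lambda>s. g s * s)" using g by (intro continuous_intros)
    define h where "h s = g s * s * g s" for s
    have h: "continuous_on {0..} h" unfolding h_def using g by (intro continuous_intros)
    have h0: "0 \<le> h s" if "0 \<le> s" for s using that \<epsilon> by (simp add: h_def g_def)
    have "c o\<^sub>L z = fun_calc g w o\<^sub>L w" by (simp add: c_def w_def compose_assoc)
    then have "\<rho> (c o\<^sub>L z) = \<rho> (fun_calc (\<lambda>s. g s * s) w)"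
      by (simp add: fun_calc_mult[OF w(1) g continuous_on_id] fun_calc_ident[OF w(1)])
    also have "\<dots> \<ge> \<rho> (fun_calc (\<lambda>s. E s - sqrt \<epsilon> * R powr ((p - 1) / 2)) w)"
    proof (rule trace_fun_calc_mono[OF w _ gs])
      show "continuous_on {0..} (\<lambda>s. E s - sqrt \<epsilon> * R powr ((p - 1) / 2))" using E by (intro continuous_intros)
      fix s assume s: "s \<in> {0..norm w}"
      show "E s - sqrt \<epsilon> * R powr ((p - 1) / 2) \<le> g s * s"
      proof (cases "s = 0")
        case True
        then show ?thesis using \<epsilon> by (simp add: E_def g_def)
      next
        case False
        then have s0: "s > 0" using s by auto
        have "E s - g s * s = s powr (p / 2) * (\<epsilon> / (s + \<epsilon>))"
          using s0 \<epsilon> by (simp add: E_def g_def divide_simps) (simp add: algebra_simps)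
        \<comment> \<open>Giving up half a power of s leaves sqrt \<epsilon> times s^((p - 1) / 2),
          which is bounded on the interval because p > 1.\<close>
        also have "\<epsilon> / (s + \<epsilon>) \<le> sqrt (\<epsilon> / s)"
        proof -
          have r: "0 \<le> \<epsilon> / (s + \<epsilon>)" "\<epsilon> / (s + \<epsilon>) \<le> 1" using s0 \<epsilon> by auto
          have "(\<epsilon> / (s + \<epsilon>))\<^sup>2 \<le> \<epsilon> / (s + \<epsilon>)"
            unfolding power2_eq_square using r by (intro mult_left_le)
          also have "\<dots> \<le> \<epsilon> / s" using s0 \<epsilon> by (intro divide_left_mono) auto
          finally show ?thesis using real_le_rsqrt by blast
        qed
        also have "s powr (p / 2) * sqrt (\<epsilon> / s) = sqrt \<epsilon> * s powr ((p - 1) / 2)"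
          using s0 by (simp add: real_sqrt_divide powr_half_sqrt[symmetric] diff_divide_distrib powr_diff)
        also have "\<dots> \<le> sqrt \<epsilon> * R powr ((p - 1) / 2)"
          using s s0 p \<epsilon> by (intro mult_left_mono powr_mono2) (auto simp: R_def)
        finally show ?thesis by (simp add: mult_left_mono)
      qed
    qed
    finally have 1: "\<rho> (fun_calc (\<lambda>s. E s - sqrt \<epsilon> * R powr ((p - 1) / 2)) w) \<le> \<rho> (c o\<^sub>L z)" .
    have "\<rho> (fun_calc (\<lambda>s. E s - sqrt \<epsilon> * R powr ((p - 1) / 2)) w) = pow_trace p z - sqrt \<epsilon> * R powr ((p - 1) / 2)"
      using w E
      by (simp add: fun_calc_diff fun_calc_const trace_diff trace_scaleR M_fun_calc M_scaleR M_id trace_id pow_trace_def w_def E_def)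
    moreover have "pow_trace q c \<le> pow_trace p z"
    proof -
      have "c o\<^sub>L op_adj c = fun_calc h w"
        using z gM g w unfolding h_def
        by (simp add: c_def op_adj_compose M_bounded M_adj op_adj_fun_calc fun_calc_mult fun_calc_ident continuous_intros w_def[symmetric] compose_assoc)
          (simp add: w_def compose_assoc)
      \<comment> \<open>\<open>pow_trace q c\<close> refers to the adjoint of c times c, but it is
        the opposite product that is a function of w; the swap exchanges them.\<close>
      then have "pow_trace q c = \<rho> (fun_calc (\<lambda>s. s powr (q / 2)) (fun_calc h w))"
        using trace_fun_calc_swap[OF c continuous_on_powr_const, of "q / 2"] q by (simp add: pow_trace_def)
      also have "\<dots> = \<rho> (fun_calc (\<lambda>s. h s powr (q / 2)) w)"
        using q by (simp add: fun_calc_compose[OF w(1) h continuous_on_powr_const h0])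
      also have "\<dots> \<le> \<rho> (fun_calc E w)"
      proof (rule trace_fun_calc_mono[OF w _ E])
        show "continuous_on {0..} (\<lambda>s. h s powr (q / 2))"
          by (rule continuous_on_powr') (use h h0 q in \<open>auto intro!: continuous_intros\<close>)
        fix s assume s: "s \<in> {0..norm w}"
        show "h s powr (q / 2) \<le> E s"
        proof (cases "s = 0")
          case False
          then have s0: "s > 0" using s by auto
          have "h s = s powr p * s / (s + \<epsilon>)\<^sup>2"
            using s0 by (simp add: h_def g_def power2_eq_square powr_add[symmetric])
          also have "\<dots> \<le> s powr p * s / s\<^sup>2"
            using s0 \<epsilon> by (intro divide_left_mono power_mono mult_pos_pos) auto
          also have "\<dots> = s powr (p - 1)"
            using s0 by (simp add: powr_diff power2_eq_square)
          finally have "h s powr (q / 2) \<le> (s powr (p - 1)) powr (q / 2)"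
            using h0 s0 q by (intro powr_mono2) auto
          then show ?thesis by (simp only: powr_powr pq E_def)
        qed (simp add: h_def E_def)
      qed
      finally show ?thesis by (simp add: E_def[abs_def] pow_trace_def w_def)
    qed
    moreover have "\<rho> (c o\<^sub>L z) = \<mu> * \<rho> (c o\<^sub>L a) + \<nu> * \<rho> (c o\<^sub>L b)"
      using a b c by (simp add: z_def compose_simps trace_add trace_scaleR M_scaleR M_compose)
    moreover have "\<mu> * \<rho> (c o\<^sub>L a) \<le> \<mu> * (pow_trace p a / p + pow_trace q c / q)"
      "\<nu> * \<rho> (c o\<^sub>L b) \<le> \<nu> * (pow_trace p b / p + pow_trace q c / q)"
      using a b c p q \<mu> by (auto intro!: mult_left_mono trace_Young)
    moreover have "\<mu> * (pow_trace p a / p + pow_trace q c / q) + \<nu> * (pow_trace p b / p + pow_trace q c / q)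
        = (\<mu> * pow_trace p a + \<nu> * pow_trace p b) / p + (\<mu> + \<nu>) * (pow_trace q c / q)"
      by (simp add: algebra_simps add_divide_distrib)
    moreover have "pow_trace q c / q \<le> pow_trace p z / q"
      using q \<open>pow_trace q c \<le> pow_trace p z\<close> by (intro divide_right_mono) auto
    ultimately show ?thesis using 1 \<mu>(3) by simp
  qed
  have "(\<lambda>n. pow_trace p z - sqrt (inverse (real (Suc n))) * R powr ((p - 1) / 2))
      \<longlonglongrightarrow> pow_trace p z - sqrt 0 * R powr ((p - 1) / 2)"
    by (intro tendsto_intros LIMSEQ_inverse_real_of_nat)
  then have "pow_trace p z - sqrt 0 * R powr ((p - 1) / 2) \<le> (\<mu> * pow_trace p a + \<nu> * pow_trace p b) / p + pow_trace p z / q"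
    by (rule LIMSEQ_le_const2) (use eps in auto)
  moreover have "pow_trace p z = pow_trace p z / p + pow_trace p z / q"
    using q(2) by (metis add_divide_distrib distrib_left mult.right_neutral times_divide_eq_right)
  ultimately have "pow_trace p z / p \<le> (\<mu> * pow_trace p a + \<nu> * pow_trace p b) / p" by simp
  then show ?thesis using p by (simp add: z_def divide_le_cancel)
qed

text \<open>Links the power of |a| in the definition of the norm to the power of
  \<open>op_adj a o\<^sub>L a\<close> in \<open>pow_trace\<close>, on which all estimates are
  made.\<close>

lemma fun_calc_op_abs:
  assumes "a \<in> M" "0 < p"
  shows "fun_calc (\<lambda>x. x powr p) (op_abs a) = fun_calc (\<lambda>s. s powr (p / 2)) (op_adj a o\<^sub>L a)"
proof -
  have "fun_calc (\<lambda>x. x powr p) (op_abs a) = fun_calc (\<lambda>s. sqrt s powr p) (op_adj a o\<^sub>L a)"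
    unfolding op_abs_def using assms
    by (intro fun_calc_compose psd_square continuous_on_powr_const) (auto intro!: continuous_intros)
  also have "\<dots> = fun_calc (\<lambda>s. s powr (p / 2)) (op_adj a o\<^sub>L a)"
    by (rule fun_calc_cong) (simp add: sqrt_powr)
  finally show ?thesis .
qed

lemma Lp_eq_pow_trace: "a \<in> M \<Longrightarrow> 0 < p \<Longrightarrow> Lp p a = pow_trace p a powr (1 / p)"
  by (simp add: Lp_def pow_trace_def fun_calc_op_abs)

lemma pow_trace_le_1_iff:
  assumes "a \<in> M" "0 < p"
  shows "pow_trace p a \<le> 1 \<longleftrightarrow> Lp p a \<le> 1"
  using assms(2) pow_trace_nonneg[OF assms] powr_le1[of "1 / p" "pow_trace p a"] gr_one_powr[of "pow_trace p a" "1 / p"]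
  by (auto simp: Lp_eq_pow_trace[OF assms] not_le[symmetric])

text \<open>Membership of \<open>op_scaleC z a\<close> is a hypothesis because the locale closes M
  under real scalars only.\<close>

lemma Lp_op_scaleC:
  assumes a: "a \<in> M" and za: "op_scaleC z a \<in> M" and p: "0 < p"
  shows "Lp p (op_scaleC z a) = cmod z * Lp p a"
proof -
  let ?x = "op_adj a o\<^sub>L a"
  have x: "psd ?x" "?x \<in> M" using a by (auto intro: psd_square M_square)
  have "op_adj (op_scaleC z a) o\<^sub>L op_scaleC z a = (cmod z)\<^sup>2 *\<^sub>R ?x"
    using M_bounded[OF a]
    by (intro blinfun_eqI)
      (simp add: op_adj_op_scaleC bounded_ops_scaleC op_adj_bounded complex_norm_square[symmetric] mult.commute
        blinfun.scaleR_left scaleC_of_real del: of_real_power)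
  also have "\<dots> = fun_calc (\<lambda>s. (cmod z)\<^sup>2 * s) ?x"
    using fun_calc_cmult[OF x(1) continuous_on_id, of "(cmod z)\<^sup>2"] fun_calc_ident[OF x(1)] by simp
  finally have "pow_trace p (op_scaleC z a) = \<rho> (fun_calc (\<lambda>s. s powr (p / 2)) (fun_calc (\<lambda>s. (cmod z)\<^sup>2 * s) ?x))"
    by (simp add: pow_trace_def)
  also have "\<dots> = \<rho> (fun_calc (\<lambda>s. ((cmod z)\<^sup>2 * s) powr (p / 2)) ?x)"
    using p by (subst fun_calc_compose[OF x(1)]) (auto intro!: continuous_intros continuous_on_powr_const)
  also have "fun_calc (\<lambda>s. ((cmod z)\<^sup>2 * s) powr (p / 2)) ?x = fun_calc (\<lambda>s. cmod z powr p * s powr (p / 2)) ?x"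
    by (rule fun_calc_cong) (simp add: powr_mult sqrt_powr[symmetric])
  also have "\<dots> = cmod z powr p *\<^sub>R fun_calc (\<lambda>s. s powr (p / 2)) ?x"
    using p by (intro fun_calc_cmult x continuous_on_powr_const) auto
  also have "\<rho> \<dots> = cmod z powr p * pow_trace p a"
    using p x by (simp add: trace_scaleR M_fun_calc continuous_on_powr_const pow_trace_def)
  finally show ?thesis
    using p pow_trace_nonneg[OF a p] by (simp add: Lp_eq_pow_trace[OF a p] Lp_eq_pow_trace[OF za p] powr_mult powr_powr)
qed

lemma Lp_scaleR:
  assumes "a \<in> M" "0 < p"
  shows "Lp p (r *\<^sub>R a) = \<bar>r\<bar> * Lp p a"
  using Lp_op_scaleC[of a "of_real r" p] M_scaleR[of a r] assms by (simp add: op_scaleC_of_real)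

lemma Lp_nonneg: "0 \<le> Lp p a"
  by (simp add: Lp_def)

text \<open>Convexity of \<open>pow_trace\<close> makes the unit ball of \<open>Lp\<close> convex,
  and homogeneity turns this into the triangle inequality.\<close>

lemma Lp_triangle:
  assumes a: "a \<in> M" and b: "b \<in> M" and p: "1 < p"
  shows "Lp p (a + b) \<le> Lp p a + Lp p b"
proof (rule field_le_epsilon)
  fix e :: real assume e: "0 < e"
  \<comment> \<open>The added e / 2 keeps the normalising factors positive even when a norm
    vanishes.\<close>
  define \<alpha> where "\<alpha> = Lp p a + e / 2"
  define \<beta> where "\<beta> = Lp p b + e / 2"
  have ab: "\<alpha> > 0" "\<beta> > 0" using e Lp_nonneg[of p a] Lp_nonneg[of p b] by (auto simp: \<alpha>_def \<beta>_def)
  define u where "u = inverse \<alpha> *\<^sub>R a"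
  define v where "v = inverse \<beta> *\<^sub>R b"
  have uv: "u \<in> M" "v \<in> M" using a b by (auto simp: u_def v_def M_scaleR)
  have "Lp p u \<le> 1" "Lp p v \<le> 1"
    using a b p ab e by (simp_all add: u_def v_def Lp_scaleR) (simp_all add: \<alpha>_def \<beta>_def divide_simps)
  then have "pow_trace p u \<le> 1" "pow_trace p v \<le> 1"
    using uv p by (simp_all add: pow_trace_le_1_iff)
  define \<mu> where "\<mu> = \<alpha> / (\<alpha> + \<beta>)"
  define \<nu> where "\<nu> = \<beta> / (\<alpha> + \<beta>)"
  have mn: "0 \<le> \<mu>" "0 \<le> \<nu>" "\<mu> + \<nu> = 1" using ab by (auto simp: \<mu>_def \<nu>_def add_divide_distrib[symmetric])
  have "pow_trace p (\<mu> *\<^sub>R u + \<nu> *\<^sub>R v) \<le> \<mu> * pow_trace p u + \<nu> * pow_trace p v"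
    by (rule pow_trace_convex[OF uv p mn])
  also have "\<dots> \<le> \<mu> * 1 + \<nu> * 1"
    using mn \<open>pow_trace p u \<le> 1\<close> \<open>pow_trace p v \<le> 1\<close> by (intro add_mono mult_left_mono) auto
  finally have "Lp p (\<mu> *\<^sub>R u + \<nu> *\<^sub>R v) \<le> 1"
    using mn uv p by (simp add: pow_trace_le_1_iff[symmetric] M_add M_scaleR)
  moreover have "\<mu> *\<^sub>R u + \<nu> *\<^sub>R v = inverse (\<alpha> + \<beta>) *\<^sub>R (a + b)"
    using ab by (simp add: u_def v_def \<mu>_def \<nu>_def divide_simps scaleR_add_right)
  ultimately show "Lp p (a + b) \<le> Lp p a + Lp p b + e"
    using ab a b p by (simp add: Lp_scaleR M_add) (simp add: \<alpha>_def \<beta>_def divide_simps)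
qed

text \<open>Holds because \<rho> is normalised. It turns summability of Fourier coefficients into
  L^p convergence.\<close>

lemma Lp_le_norm:
  assumes a: "a \<in> M" and p: "0 < p"
  shows "Lp p a \<le> norm a"
proof -
  let ?x = "op_adj a o\<^sub>L a"
  have x: "psd ?x" "?x \<in> M" using a by (auto intro: psd_square M_square)
  have nx: "norm ?x = (norm a)\<^sup>2" using M_bounded[OF a] by (rule norm_op_adj_compose)
  have "pow_trace p a \<le> norm a powr p"
    unfolding pow_trace_def
  proof (rule order_trans[OF trace_le_norm])
    show "norm (fun_calc (\<lambda>s. s powr (p / 2)) ?x) \<le> norm a powr p"
    proof (rule norm_fun_calc_le[OF x(1)])
      fix s assume "s \<in> {0..norm ?x}"
      then have "s powr (p / 2) \<le> (norm a)\<^sup>2 powr (p / 2)"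
        using p nx by (intro powr_mono2) auto
      then show "\<bar>s powr (p / 2)\<bar> \<le> norm a powr p" by (simp add: sqrt_powr[symmetric])
    qed (use p in \<open>auto intro: continuous_on_powr_const\<close>)
  qed (use p x in \<open>auto intro!: M_fun_calc psd_fun_calc continuous_on_powr_const\<close>)
  then have "Lp p a \<le> (norm a powr p) powr (1 / p)"
    unfolding Lp_eq_pow_trace[OF a p] using p pow_trace_nonneg[OF a p] by (intro powr_mono2) auto
  then show ?thesis using p by (simp add: powr_powr)
qed

end

section \<open>The $C^*$-algebra of the noncommutative torus\<close>

lemma closed_commutant: "closed (commutant S)"
proof -
  have "closed {T. (T o\<^sub>L A) = (A o\<^sub>L T)}" for A :: "'a op"
    by (intro closed_Collect_eq bounded_linear.continuous_on[OF bounded_bilinear.bounded_linear_left[OF bounded_bilinear_blinfun_compose]]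
        bounded_linear.continuous_on[OF bounded_bilinear.bounded_linear_right[OF bounded_bilinear_blinfun_compose]] continuous_on_id)
  moreover have eq: "commutant S = bounded_ops \<inter> (\<Inter>A\<in>S. {T. (T o\<^sub>L A) = (A o\<^sub>L T)})"
    by (auto simp: commutant_def)
  ultimately show ?thesis
    unfolding eq by (intro closed_Int closed_bounded_ops closed_INT ballI)
qed

lemma commutant_add: "x \<in> commutant S \<Longrightarrow> y \<in> commutant S \<Longrightarrow> x + y \<in> commutant S"
  by (simp add: commutant_def bounded_ops_add compose_simps)

lemma commutant_compose: "x \<in> commutant S \<Longrightarrow> y \<in> commutant S \<Longrightarrow> x o\<^sub>L y \<in> commutant S"
  by (auto simp: commutant_def bounded_ops_compose compose_assoc) (metis compose_assoc)

lemma op_scaleC_compose: "op_scaleC z A o\<^sub>L B = op_scaleC z (A o\<^sub>L B)"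
  by (rule blinfun_eqI) simp

lemma compose_op_scaleC: "A \<in> bounded_ops \<Longrightarrow> A o\<^sub>L op_scaleC z B = op_scaleC z (A o\<^sub>L B)"
  by (rule blinfun_eqI) (simp add: bounded_ops_scaleC)

lemma op_scaleC_op_scaleC [simp]: "op_scaleC z (op_scaleC w A) = op_scaleC (z * w) A"
  by (rule blinfun_eqI) simp

lemma op_scaleC_0 [simp]: "op_scaleC 0 A = 0"
  using op_scaleC_of_real[of 0 A] by simp

lemma uminus_op_scaleC: "- A = op_scaleC (-1) A"
  using op_scaleC_of_real[of "-1" A] by simp

lemma op_scaleC_diff: "op_scaleC z (A - B) = op_scaleC z A - op_scaleC z B"
  by (rule blinfun_eqI) (simp add: blinfun.diff_left scaleC_diff)

lemma bounded_linear_op_scaleC: "bounded_linear (op_scaleC z)"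
  unfolding op_scaleC_def[abs_def]
  by (rule bounded_bilinear.bounded_linear_right[OF bounded_bilinear_blinfun_compose])

lemma commutant_op_scaleC:
  "x \<in> commutant S \<Longrightarrow> S \<subseteq> bounded_ops \<Longrightarrow> op_scaleC z x \<in> commutant S"
  by (auto simp: commutant_def bounded_ops_op_scaleC op_scaleC_compose compose_op_scaleC)

lemma vN_generated_superset:
  "A \<in> S \<union> op_adj ` S \<Longrightarrow> A \<in> bounded_ops \<Longrightarrow> A \<in> vN_generated S"
  unfolding vN_generated_def commutant_def[of "commutant _"] by (auto simp: commutant_def)

lemma closed_nc_torus: "closed (nc_torus \<theta>)"
  by (simp add: nc_torus_def vN_generated_def closed_commutant)

lemma nc_torus_add: "x \<in> nc_torus \<theta> \<Longrightarrow> y \<in> nc_torus \<theta> \<Longrightarrow> x + y \<in> nc_torus \<theta>"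
  by (simp add: nc_torus_def vN_generated_def commutant_add)

lemma nc_torus_compose: "x \<in> nc_torus \<theta> \<Longrightarrow> y \<in> nc_torus \<theta> \<Longrightarrow> x o\<^sub>L y \<in> nc_torus \<theta>"
  by (simp add: nc_torus_def vN_generated_def commutant_compose)

lemma nc_torus_op_scaleC: "x \<in> nc_torus \<theta> \<Longrightarrow> op_scaleC z x \<in> nc_torus \<theta>"
  unfolding nc_torus_def vN_generated_def
  by (rule commutant_op_scaleC) (auto simp: commutant_def)

lemma nc_torus_scaleR: "x \<in> nc_torus \<theta> \<Longrightarrow> r *\<^sub>R x \<in> nc_torus \<theta>"
  using nc_torus_op_scaleC[of x \<theta> "of_real r"] by (simp add: op_scaleC_of_real)

lemma nc_torus_diff: "x \<in> nc_torus \<theta> \<Longrightarrow> y \<in> nc_torus \<theta> \<Longrightarrow> x - y \<in> nc_torus \<theta>"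
  using nc_torus_add[of x \<theta> "(-1) *\<^sub>R y"] nc_torus_scaleR[of y \<theta> "-1"] by simp

lemma nc_torus_id: "id_blinfun \<in> nc_torus \<theta>"
  by (auto simp: nc_torus_def vN_generated_def commutant_def)

lemma nc_U_bounded: "nc_U \<theta> j \<in> bounded_ops"
  by (auto simp: bounded_ops_def intro!: coord_eqI simp: coord_nc_U scaleC.rep_eq)

lemma nc_W_bounded: "nc_W \<theta> j \<in> bounded_ops"
  by (auto simp: bounded_ops_def intro!: coord_eqI simp: coord_nc_W scaleC.rep_eq)

lemma nc_U_torus: "nc_U \<theta> j \<in> nc_torus \<theta>"
  unfolding nc_torus_def by (rule vN_generated_superset) (auto simp: nc_U_bounded)

lemma nc_W_torus: "nc_W \<theta> j \<in> nc_torus \<theta>"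
  unfolding nc_torus_def using adj_U[of \<theta> j] nc_W_bounded[of \<theta> j]
  by (intro vN_generated_superset) (metis UnI2 imageI rangeI, assumption)

lemma nc_powi_torus: "op_powi (nc_U \<theta> j) k \<in> nc_torus \<theta>"
  by (rule powi_induct) (auto intro: nc_torus_id nc_torus_compose nc_U_torus nc_W_torus)

lemma nc_monom_torus: "nc_monom \<theta> m \<in> nc_torus \<theta>"
proof -
  have "foldr (\<lambda>j B. op_powi (nc_U \<theta> j) (m $ j) o\<^sub>L B) xs id_blinfun \<in> nc_torus \<theta>" for xs
    by (induction xs) (auto intro: nc_torus_id nc_torus_compose nc_powi_torus)
  then show ?thesis by (simp add: nc_monom_def)
qed

section \<open>Lattice degrees and monomials up to phase\<close>

definition shifts_basis :: "'n::finite lattice op \<Rightarrow> 'n lattice \<Rightarrow> bool" where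
  "shifts_basis A m \<longleftrightarrow> A \<in> bounded_ops \<and> (\<forall>k. \<exists>z. A (basis_vec k) = scaleC z (basis_vec (k + m)))"

lemma shifts_basis_compose:
  assumes "shifts_basis A m" "shifts_basis B k"
  shows "shifts_basis (A o\<^sub>L B) (m + k)"
  unfolding shifts_basis_def
proof (intro conjI allI)
  show "A o\<^sub>L B \<in> bounded_ops" using assms by (simp add: shifts_basis_def bounded_ops_compose)
  fix l
  obtain z where z: "B (basis_vec l) = scaleC z (basis_vec (l + k))"
    using assms(2) unfolding shifts_basis_def by blast
  obtain w where w: "A (basis_vec (l + k)) = scaleC w (basis_vec (l + k + m))"
    using assms(1) unfolding shifts_basis_def by blast
  show "\<exists>z. (A o\<^sub>L B) (basis_vec l) = scaleC z (basis_vec (l + (m + k)))"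
    using assms z w by (auto simp: shifts_basis_def bounded_ops_scaleC add_ac)
qed

lemma shifts_basis_id: "shifts_basis id_blinfun 0"
  by (auto simp: shifts_basis_def intro: exI[of _ 1])

lemma shifts_basis_U: "shifts_basis (nc_U \<theta> j) (axis j 1)"
  using nc_U_basis_vec by (auto simp: shifts_basis_def nc_U_bounded)

lemma shifts_basis_W: "shifts_basis (nc_W \<theta> j) (- axis j 1)"
  using W_basis by (auto simp: shifts_basis_def nc_W_bounded)

lemma shifts_basis_powi: "shifts_basis (op_powi (nc_U \<theta> j) k) (axis j k)"
proof -
  have 1: "shifts_basis (op_pow (nc_U \<theta> j) n) (axis j (int n))" for n
  proof (induction n)
    case (Suc n)
    have "axis j (int (Suc n)) = axis j 1 + axis j (int n)" by (simp add: vec_eq_iff axis_def)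
    then show ?case using shifts_basis_compose[OF shifts_basis_U Suc] by (simp add: op_pow_def)
  qed (simp add: op_pow_def shifts_basis_id axis_eq_0_iff[THEN iffD2])
  have 2: "shifts_basis (op_pow (nc_W \<theta> j) n) (axis j (- int n))" for n
  proof (induction n)
    case (Suc n)
    have "axis j (- int (Suc n)) = - axis j 1 + axis j (- int n)" by (simp add: vec_eq_iff axis_def)
    then show ?case using shifts_basis_compose[OF shifts_basis_W Suc] by (simp add: op_pow_def)
  qed (simp add: op_pow_def shifts_basis_id axis_eq_0_iff[THEN iffD2])
  show ?thesis using 1[of "nat k"] 2[of "nat (- k)"] by (auto simp: op_powi_def adj_U)
qed

lemma shifts_basis_monom: "shifts_basis (nc_monom \<theta> m) m"
proof -
  have "shifts_basis (foldr (\<lambda>j B. op_powi (nc_U \<theta> j) (m $ j) o\<^sub>L B) xs id_blinfun)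
     (\<chi> j. if j \<in> set xs then m $ j else 0)" if "distinct xs" for xs
    using that
  proof (induction xs)
    case Nil
    have "(\<chi> j. 0) = (0 :: 'a lattice)" by (simp add: vec_eq_iff)
    then show ?case by (simp add: shifts_basis_id)
  next
    case (Cons j xs)
    have "axis j (m $ j) + (\<chi> i. if i \<in> set xs then m $ i else 0) = (\<chi> i. if i \<in> set (j # xs) then m $ i else 0)"
      using Cons.prems by (auto simp: vec_eq_iff axis_def)
    then show ?case using shifts_basis_compose[OF shifts_basis_powi Cons.IH, of \<theta> j "m $ j"] Cons.prems by simp
  qed
  from this[of "sorted_list_of_set UNIV"] show ?thesis by (simp add: nc_monom_def)
qed

text \<open>By \<open>torus_zero\<close> the vector \<open>basis_vec 0\<close> separates the torus
  algebra, so an element is known from its value there.\<close>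

lemma torus_monom_eqI:
  assumes "x \<in> nc_torus \<theta>" "blinfun_apply x (basis_vec 0) = scaleC z (basis_vec m)"
  shows "x = op_scaleC z (nc_monom \<theta> m)"
proof -
  have "x - op_scaleC z (nc_monom \<theta> m) = 0"
    by (rule torus_zero) (use assms in \<open>auto simp: blinfun.diff_left monom_basis_0 intro!: nc_torus_diff nc_torus_op_scaleC nc_monom_torus\<close>)
  then show ?thesis by simp
qed

definition scaled_monoms :: "'n::{finite,linorder} rmatrix \<Rightarrow> 'n lattice op set" where
  "scaled_monoms \<theta> = {op_scaleC z (nc_monom \<theta> m) | z m. True}"

text \<open>Gives closure under products without computing any commutation phase:
  \<open>shifts_basis\<close> leaves the phase free to depend on the basis vector and records only
  the degree, which is additive.\<close>

lemma scaled_monoms_iff: "x \<in> scaled_monoms \<theta> \<longleftrightarrow> x \<in> nc_torus \<theta> \<and> (\<exists>m. shifts_basis x m)"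
proof
  assume "x \<in> scaled_monoms \<theta>"
  then obtain z m where x: "x = op_scaleC z (nc_monom \<theta> m)" by (auto simp: scaled_monoms_def)
  have "shifts_basis x m" unfolding shifts_basis_def
  proof (intro conjI allI)
    show "x \<in> bounded_ops" using shifts_basis_monom by (simp add: x bounded_ops_op_scaleC torus_bdd[OF nc_monom_torus])
    fix k
    obtain w where "nc_monom \<theta> m (basis_vec k) = scaleC w (basis_vec (k + m))"
      using shifts_basis_monom by (auto simp: shifts_basis_def) blast
    then show "\<exists>z. blinfun_apply x (basis_vec k) = scaleC z (basis_vec (k + m))" by (auto simp: x)
  qed
  then show "x \<in> nc_torus \<theta> \<and> (\<exists>m. shifts_basis x m)"
    by (auto simp: x nc_torus_op_scaleC nc_monom_torus)
next
  assume x: "x \<in> nc_torus \<theta> \<and> (\<exists>m. shifts_basis x m)"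
  then obtain m z where "blinfun_apply x (basis_vec 0) = scaleC z (basis_vec (0 + m))"
    unfolding shifts_basis_def by blast
  then show "x \<in> scaled_monoms \<theta>"
    using x torus_monom_eqI[of x \<theta> z m] by (auto simp: scaled_monoms_def)
qed

lemma scaled_monoms_id: "id_blinfun \<in> scaled_monoms \<theta>"
  using shifts_basis_id by (auto simp: scaled_monoms_iff nc_torus_id)

lemma scaled_monoms_compose: "x \<in> scaled_monoms \<theta> \<Longrightarrow> y \<in> scaled_monoms \<theta> \<Longrightarrow> x o\<^sub>L y \<in> scaled_monoms \<theta>"
  by (auto simp: scaled_monoms_iff nc_torus_compose intro: shifts_basis_compose)

lemma scaled_monoms_op_scaleC: "x \<in> scaled_monoms \<theta> \<Longrightarrow> op_scaleC z x \<in> scaled_monoms \<theta>"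
  by (auto simp: scaled_monoms_def) blast

lemma scaled_monoms_monom: "nc_monom \<theta> m \<in> scaled_monoms \<theta>"
  using shifts_basis_monom by (auto simp: scaled_monoms_iff nc_monom_torus)

lemma adj_W: "op_adj (nc_W \<theta> j) = nc_U \<theta> j"
  by (metis adj_U nc_U_bounded op_adj_adj)

text \<open>The adjoint reverses products, so it suffices to treat the generators, which
  \<open>op_adj\<close> interchanges with their inverses.\<close>

lemma scaled_monoms_adj:
  assumes "x \<in> scaled_monoms \<theta>"
  shows "op_adj x \<in> scaled_monoms \<theta>"
proof -
  define P where "P = (\<lambda>x. x \<in> bounded_ops \<and> op_adj x \<in> scaled_monoms \<theta>)"
  have U: "P (nc_U \<theta> j)" and W: "P (nc_W \<theta> j)" for j
    using shifts_basis_U[of \<theta> j] shifts_basis_W[of \<theta> j]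
    by (auto simp: P_def nc_U_bounded nc_W_bounded adj_U adj_W scaled_monoms_iff nc_U_torus nc_W_torus)
  have comp: "P (x o\<^sub>L y)" if "P x" "P y" for x y
    using that by (simp add: P_def bounded_ops_compose op_adj_compose scaled_monoms_compose)
  have id: "P id_blinfun" by (simp add: P_def scaled_monoms_id)
  have powi: "P (op_powi (nc_U \<theta> j) k)" for j k
    by (rule powi_induct) (auto intro: id comp U W)
  have "P (foldr (\<lambda>j B. op_powi (nc_U \<theta> j) (m $ j) o\<^sub>L B) xs id_blinfun)" for xs m
    by (induction xs) (auto intro: id comp powi)
  then have "P (nc_monom \<theta> m)" for m by (simp add: nc_monom_def)
  moreover obtain z m where "x = op_scaleC z (nc_monom \<theta> m)"
    using assms by (auto simp: scaled_monoms_def)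
  ultimately show ?thesis
    by (simp add: P_def op_adj_op_scaleC scaled_monoms_op_scaleC)
qed

text \<open>The span is real, but the generating set already contains all complex multiples. On this
  norm closure the values on monomials determine the trace by norm continuity alone.\<close>

definition nc_cstar :: "'n::{finite,linorder} rmatrix \<Rightarrow> 'n lattice op set" where
  "nc_cstar \<theta> = closure (span (scaled_monoms \<theta>))"

lemma subspace_closure:
  fixes S :: "'a::real_normed_vector set"
  assumes "subspace S"
  shows "subspace (closure S)"
proof (rule subspaceI)
  show "0 \<in> closure S" using assms closure_subset subspace_0 by blast
next
  fix x y assume "x \<in> closure S" "y \<in> closure S"
  then obtain f g where "\<forall>n. f n \<in> S" "f \<longlonglongrightarrow> x" "\<forall>n. g n \<in> S" "g \<longlonglongrightarrow> y"
    unfolding closure_sequential by blast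
  then show "x + y \<in> closure S"
    unfolding closure_sequential using assms
    by (intro exI[of _ "\<lambda>n. f n + g n"]) (auto intro: tendsto_add subspace_add)
next
  fix c x assume "x \<in> closure S"
  then obtain f where "\<forall>n. f n \<in> S" "f \<longlonglongrightarrow> x"
    unfolding closure_sequential by blast
  then show "c *\<^sub>R x \<in> closure S"
    unfolding closure_sequential using assms
    by (intro exI[of _ "\<lambda>n. c *\<^sub>R f n"]) (auto intro: tendsto_scaleR subspace_scale)
qed

lemma subspace_nc_cstar: "subspace (nc_cstar \<theta>)"
  unfolding nc_cstar_def by (intro subspace_closure subspace_span)

lemma closed_nc_cstar: "closed (nc_cstar \<theta>)"
  by (simp add: nc_cstar_def)

lemma nc_cstar_superset: "scaled_monoms \<theta> \<subseteq> nc_cstar \<theta>"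
  unfolding nc_cstar_def by (meson closure_subset span_superset subset_trans)

text \<open>Acts as an induction principle: a property that defines a closed real subspace need only
  be checked on scaled monomials.\<close>

lemma nc_cstar_subset:
  assumes "scaled_monoms \<theta> \<subseteq> C" "subspace C" "closed C"
  shows "nc_cstar \<theta> \<subseteq> C"
  unfolding nc_cstar_def using assms by (intro closure_minimal span_minimal)

lemma nc_cstar_bounded_linear:
  assumes f: "bounded_linear f" and S: "\<And>x. x \<in> scaled_monoms \<theta> \<Longrightarrow> f x \<in> nc_cstar \<theta>" and x: "x \<in> nc_cstar \<theta>"
  shows "f x \<in> nc_cstar \<theta>"
proof -
  have "nc_cstar \<theta> \<subseteq> {x. f x \<in> nc_cstar \<theta>}"
  proof (rule nc_cstar_subset)
    show "scaled_monoms \<theta> \<subseteq> {x. f x \<in> nc_cstar \<theta>}" using S by blast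
    show "subspace {x. f x \<in> nc_cstar \<theta>}"
      using f subspace_nc_cstar[of \<theta>] by (intro linear_subspace_linear_preimage bounded_linear.linear)
    have "closed (f -` nc_cstar \<theta>)"
      using f by (intro closed_vimage closed_nc_cstar linear_continuous_on)
    then show "closed {x. f x \<in> nc_cstar \<theta>}" by (simp add: vimage_def)
  qed
  then show ?thesis using x by blast
qed

lemma nc_cstar_torus: "nc_cstar \<theta> \<subseteq> nc_torus \<theta>"
proof (rule nc_cstar_subset)
  show "subspace (nc_torus \<theta>)"
    using nc_torus_scaleR[OF nc_torus_id, of 0 \<theta>]
    by (intro subspaceI) (auto intro: nc_torus_add nc_torus_scaleR)
qed (auto simp: scaled_monoms_iff closed_nc_torus)

lemma nc_cstar_id: "id_blinfun \<in> nc_cstar \<theta>"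
  using nc_cstar_superset scaled_monoms_id by blast

lemma nc_cstar_compose:
  assumes "x \<in> nc_cstar \<theta>" "y \<in> nc_cstar \<theta>"
  shows "x o\<^sub>L y \<in> nc_cstar \<theta>"
proof -
  have "x o\<^sub>L z \<in> nc_cstar \<theta>" if "z \<in> scaled_monoms \<theta>" for z
    by (rule nc_cstar_bounded_linear[OF bounded_bilinear.bounded_linear_left[OF bounded_bilinear_blinfun_compose] _ assms(1)])
      (use that scaled_monoms_compose nc_cstar_superset in blast)
  then show ?thesis
    by (rule nc_cstar_bounded_linear[OF bounded_bilinear.bounded_linear_right[OF bounded_bilinear_blinfun_compose] _ assms(2)])
qed

lemma nc_cstar_op_scaleC: "x \<in> nc_cstar \<theta> \<Longrightarrow> op_scaleC z x \<in> nc_cstar \<theta>"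
  by (rule nc_cstar_bounded_linear[OF bounded_linear_op_scaleC])
    (use scaled_monoms_op_scaleC nc_cstar_superset in blast)+

lemma nc_cstar_adj:
  assumes "x \<in> nc_cstar \<theta>"
  shows "op_adj x \<in> nc_cstar \<theta>"
proof -
  define C where "C = {x \<in> bounded_ops. op_adj x \<in> nc_cstar \<theta>}"
  have "nc_cstar \<theta> \<subseteq> C"
  proof (rule nc_cstar_subset)
    show "scaled_monoms \<theta> \<subseteq> C"
      using scaled_monoms_adj nc_cstar_superset by (auto simp: C_def scaled_monoms_iff[of _ \<theta>] dest: torus_bdd)
    show "subspace C"
      using subspace_nc_cstar[of \<theta>]
      by (intro subspaceI)
        (auto simp: C_def bounded_ops_add bounded_ops_scaleR op_adj_add op_adj_scaleR subspace_0 subspace_add subspace_scale)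
    show "closed C"
      unfolding closed_sequential_limits
    proof (intro allI impI)
      fix X l assume X: "(\<forall>n. X n \<in> C) \<and> X \<longlonglongrightarrow> l"
      then have l: "l \<in> bounded_ops"
        using closed_sequentially[OF closed_bounded_ops, of X l] by (auto simp: C_def)
      have "(\<lambda>i. op_adj (X i)) \<longlonglongrightarrow> op_adj l"
        using X by (intro tendsto_op_adj) (auto simp: C_def)
      then have "op_adj l \<in> nc_cstar \<theta>"
        using X closed_sequentially[OF closed_nc_cstar, of "\<lambda>i. op_adj (X i)"] by (auto simp: C_def)
      with l show "l \<in> C" by (simp add: C_def)
    qed
  qed
  then show ?thesis using assms by (auto simp: C_def)
qed

text \<open>The point is compatibility with adjoints. A self-adjoint y has real trace because
  \<open>norm y\<close> times the identity minus y is positive; applied to i times the difference of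
  x and its adjoint, this equates the real parts of the two traces.\<close>

lemma tracial_algebra_torus: "tracial_algebra (nc_cstar \<theta>) (\<lambda>x. Re (nc_trace \<theta> x))"
proof -
  let ?\<tau> = "nc_trace \<theta>"
  have st: "faithful_normal_tracial_state (nc_torus \<theta>) ?\<tau>"
    using nc_trace_canonical[of \<theta>] by (simp add: is_canonical_trace_def)
  have add: "?\<tau> (x + y) = ?\<tau> x + ?\<tau> y" if "x \<in> nc_torus \<theta>" "y \<in> nc_torus \<theta>" for x y
    using st that by (simp add: faithful_normal_tracial_state_def)
  have scale: "?\<tau> (op_scaleC z x) = z * ?\<tau> x" if "x \<in> nc_torus \<theta>" for x z
    using st that by (simp add: faithful_normal_tracial_state_def)
  have scaleR: "?\<tau> (r *\<^sub>R x) = of_real r * ?\<tau> x" if "x \<in> nc_torus \<theta>" for x r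
    using scale[OF that, of "of_real r"] by (simp add: op_scaleC_of_real)
  have pos: "Im (?\<tau> x) = 0 \<and> 0 \<le> Re (?\<tau> x)" if "x \<in> nc_torus \<theta>" "psd x" for x
    using st that psd_op_pos[of x] unfolding faithful_normal_tracial_state_def by blast
  have id: "?\<tau> id_blinfun = 1" and comm: "?\<tau> (x o\<^sub>L y) = ?\<tau> (y o\<^sub>L x)" if "x \<in> nc_torus \<theta>" "y \<in> nc_torus \<theta>" for x y
    using st that by (simp_all add: faithful_normal_tracial_state_def)
  have diff: "?\<tau> (x - y) = ?\<tau> x - ?\<tau> y" if "x \<in> nc_torus \<theta>" "y \<in> nc_torus \<theta>" for x y
    using add[of x "(-1) *\<^sub>R y"] scaleR[of y "-1"] nc_torus_scaleR[of y \<theta> "-1"] that by simp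
  have real: "Im (?\<tau> y) = 0" if y: "y \<in> nc_torus \<theta>" "op_adj y = y" for y
  proof -
    have "psd (norm y *\<^sub>R id_blinfun - y)"
      by (rule psd_id_minus) (use y torus_bdd in auto)
    then have "Im (?\<tau> (norm y *\<^sub>R id_blinfun - y)) = 0"
      using pos y by (simp add: nc_torus_diff nc_torus_scaleR nc_torus_id)
    then show ?thesis
      using y id[OF nc_torus_id nc_torus_id] by (simp add: diff scaleR nc_torus_scaleR nc_torus_id)
  qed
  have adj: "Re (?\<tau> (op_adj x)) = Re (?\<tau> x)" if x: "x \<in> nc_cstar \<theta>" for x
  proof -
    have xx: "x \<in> nc_torus \<theta>" "op_adj x \<in> nc_torus \<theta>" using x nc_cstar_adj nc_cstar_torus by auto
    have bd: "x \<in> bounded_ops" using xx torus_bdd by blast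
    define y where "y = op_scaleC \<i> (x - op_adj x)"
    have "y \<in> nc_torus \<theta>" using xx by (simp add: y_def nc_torus_op_scaleC nc_torus_diff)
    moreover have "op_adj y = op_scaleC (- \<i>) (op_adj x - x)"
      using bd by (simp add: y_def op_adj_op_scaleC op_adj_diff bounded_ops_diff op_adj_bounded)
    moreover have "\<dots> = y"
      by (intro blinfun_eqI coord_eqI)
        (simp add: y_def scaleC.rep_eq blinfun.diff_left minus_ell2.rep_eq algebra_simps)
    ultimately have "Im (?\<tau> y) = 0" using real by simp
    then show ?thesis using xx by (simp add: y_def scale diff nc_torus_diff)
  qed
  note sub = nc_cstar_torus[THEN subsetD]
  show ?thesis
    by unfold_locales
      (auto simp: add scaleR adj pos id[OF nc_torus_id nc_torus_id] comm sub torus_bdd[OF sub] nc_cstar_id nc_cstar_compose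
        nc_cstar_adj closed_nc_cstar intro: subspace_add[OF subspace_nc_cstar] subspace_scale[OF subspace_nc_cstar])
qed

interpretation torus: tracial_algebra "nc_cstar \<theta>" "\<lambda>x. Re (nc_trace \<theta> x)" for \<theta> :: "'n::{finite,linorder} rmatrix"
  by (rule tracial_algebra_torus)

lemma Lp_norm_eq: "Lp_norm \<theta> p a = torus.Lp \<theta> p a"
  by (simp add: Lp_norm_def torus.Lp_def)

section \<open>Fourier series\<close>

lemma nc_series_has_sum:
  "rapidly_decreasing c \<Longrightarrow> ((\<lambda>m. op_scaleC (c m) (nc_monom \<theta> m)) has_sum nc_series \<theta> c) UNIV"
  unfolding nc_series_def by (intro has_sum_infsum series_summable)

lemma nc_series_cstar:
  assumes "rapidly_decreasing c"
  shows "nc_series \<theta> c \<in> nc_cstar \<theta>"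
proof (rule Lim_in_closed_set[OF closed_nc_cstar])
  show "\<forall>\<^sub>F F in finite_subsets_at_top UNIV. (\<Sum>m\<in>F. op_scaleC (c m) (nc_monom \<theta> m)) \<in> nc_cstar \<theta>"
    using scaled_monoms_op_scaleC[OF scaled_monoms_monom] nc_cstar_superset
    by (intro always_eventually allI subspace_sum[OF subspace_nc_cstar]) blast
  show "((\<lambda>F. \<Sum>m\<in>F. op_scaleC (c m) (nc_monom \<theta> m)) \<longlongrightarrow> nc_series \<theta> c) (finite_subsets_at_top UNIV)"
    using nc_series_has_sum[OF assms] by (simp add: has_sum_def)
qed simp

lemma norm_nc_series_le:
  assumes "rapidly_decreasing c"
  shows "norm (nc_series \<theta> c) \<le> (\<Sum>\<^sub>\<infinity>m. cmod (c m))"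
  unfolding nc_series_def
proof (rule order_trans[OF norm_infsum_bound])
  have le: "norm (op_scaleC (c m) (nc_monom \<theta> m)) \<le> cmod (c m)" for m
    by (rule norm_blinfun_bound) (auto simp: norm_scaleC norm_monom)
  show sm: "(\<lambda>m. op_scaleC (c m) (nc_monom \<theta> m)) abs_summable_on UNIV"
    by (rule summable_on_comparison_test[OF rapid_summable[OF assms]]) (use le in auto)
  show "(\<Sum>\<^sub>\<infinity>m. norm (op_scaleC (c m) (nc_monom \<theta> m))) \<le> (\<Sum>\<^sub>\<infinity>m. cmod (c m))"
    by (rule infsum_mono[OF sm rapid_summable[OF assms]]) (use le in auto)
qed

lemma rapidly_decreasing_single: "rapidly_decreasing (\<lambda>k. if k = m then z else 0)"
  unfolding rapidly_decreasing_def
proof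
  fix N :: nat
  show "\<exists>K. \<forall>k. (1 + sqrt (int_norm_sq k)) ^ N * cmod (if k = m then z else 0) \<le> K"
    by (rule exI[of _ "(1 + sqrt (int_norm_sq m)) ^ N * cmod z"])
      (auto simp: int_norm_sq_def sum_nonneg)
qed

lemma nc_series_single: "nc_series \<theta> (\<lambda>k. if k = m then z else 0) = op_scaleC z (nc_monom \<theta> m)"
proof -
  have "nc_series \<theta> (\<lambda>k. if k = m then z else 0) = (\<Sum>\<^sub>\<infinity>k\<in>{m}. op_scaleC z (nc_monom \<theta> k))"
    unfolding nc_series_def by (rule infsum_cong_neutral) auto
  then show ?thesis by simp
qed

text \<open>The chosen trace is specified on smooth series; finitely supported ones give its values
  on monomials.\<close>

lemma nc_trace_monom: "nc_trace \<theta> (op_scaleC z (nc_monom \<theta> m)) = (if m = 0 then z else 0)"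
  using nc_trace_canonical[of \<theta>] rapidly_decreasing_single[of m z]
  by (auto simp: is_canonical_trace_def nc_series_single[symmetric])

section \<open>The gauge action\<close>

definition nc_gauge :: "'n::finite \<Rightarrow> real \<Rightarrow> 'n lattice op" where
  "nc_gauge j h = Blinfun (weighted_perm (\<lambda>m. cis (h * of_int (m $ j))) (\<lambda>m. m))"

lemma coord_gauge: "coord (nc_gauge j h f) m = cis (h * of_int (m $ j)) * coord f m"
proof -
  have w: "cmod (cis (h * of_int (m $ j))) = 1" for m :: "'a lattice" by simp
  have b: "bij (\<lambda>m :: 'a lattice. m)" using bij_id by (simp add: id_def)
  show ?thesis
    using bounded_linear_weighted_perm[where w = "\<lambda>m. cis (h * of_int (m $ j))", OF w b]
      coord_weighted_perm[where w = "\<lambda>m. cis (h * of_int (m $ j))", OF w b]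
    by (simp add: nc_gauge_def bounded_linear_Blinfun_apply)
qed

lemma nc_gauge_bounded: "nc_gauge j h \<in> bounded_ops"
  by (auto simp: bounded_ops_def intro!: coord_eqI simp: coord_gauge scaleC.rep_eq)

lemma nc_gauge_inverse [simp]:
  "nc_gauge j h o\<^sub>L nc_gauge j (- h) = id_blinfun" "nc_gauge j (- h) o\<^sub>L nc_gauge j h = id_blinfun"
  by (intro blinfun_eqI coord_eqI; simp add: coord_gauge mult.assoc[symmetric] cis_mult)+

lemma op_adj_gauge: "op_adj (nc_gauge j h) = nc_gauge j (- h)"
  by (rule op_adj_eqI) (simp add: cinner_def coord_gauge cis_cnj mult_ac)

lemma nc_gauge_basis: "nc_gauge j h (basis_vec m) = scaleC (cis (h * of_int (m $ j))) (basis_vec m)"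
  by (rule coord_eqI) (simp add: coord_gauge scaleC.rep_eq basis_vec.rep_eq)

definition gauge_conj :: "'n::finite \<Rightarrow> real \<Rightarrow> 'n lattice op \<Rightarrow> 'n lattice op" where
  "gauge_conj j h x = (nc_gauge j h o\<^sub>L x) o\<^sub>L nc_gauge j (- h)"

lemma bounded_linear_gauge_conj: "bounded_linear (gauge_conj j h)"
  unfolding gauge_conj_def[abs_def]
  by (rule bounded_linear_compose[OF bounded_bilinear.bounded_linear_left[OF bounded_bilinear_blinfun_compose]
        bounded_bilinear.bounded_linear_right[OF bounded_bilinear_blinfun_compose]])

lemma bounded_ops_eqI:
  assumes "A \<in> bounded_ops" "B \<in> bounded_ops" "\<And>m. blinfun_apply A (basis_vec m) = B (basis_vec m)"
  shows "A = B"
proof (rule blinfun_eqI)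
  fix f
  have "((\<lambda>m. A (scaleC (coord f m) (basis_vec m))) has_sum A f) UNIV"
    "((\<lambda>m. B (scaleC (coord f m) (basis_vec m))) has_sum B f) UNIV"
    by (rule has_sum_bounded_linear[OF blinfun.bounded_linear_right basis_has_sum])+
  then show "A f = B f"
    using assms by (simp add: bounded_ops_scaleC) (metis infsumI)
qed

text \<open>A monomial of degree m takes \<open>basis_vec k\<close> to a multiple of
  \<open>basis_vec (k + m)\<close>. The phases of the two gauge unitaries, at k and at k + m,
  combine to that of \<open>m $ j\<close>, whatever the phase of the monomial.\<close>

lemma gauge_conj_monom:
  "gauge_conj j h (op_scaleC z (nc_monom \<theta> m)) = op_scaleC (cis (h * of_int (m $ j)) * z) (nc_monom \<theta> m)"
proof (rule bounded_ops_eqI)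
  have mb: "nc_monom \<theta> m \<in> bounded_ops" by (rule torus_bdd[OF nc_monom_torus])
  show "gauge_conj j h (op_scaleC z (nc_monom \<theta> m)) \<in> bounded_ops"
    "op_scaleC (cis (h * of_int (m $ j)) * z) (nc_monom \<theta> m) \<in> bounded_ops"
    using mb by (auto simp: gauge_conj_def intro!: bounded_ops_compose nc_gauge_bounded bounded_ops_op_scaleC)
  fix k
  obtain w where w: "nc_monom \<theta> m (basis_vec k) = scaleC w (basis_vec (k + m))"
    using shifts_basis_monom[of \<theta> m] unfolding shifts_basis_def by blast
  have "cis (- (h * of_int (k $ j))) * cis (h * (of_int (k $ j) + of_int (m $ j))) = cis (h * of_int (m $ j))"
    by (simp add: cis_mult algebra_simps)
  then show "gauge_conj j h (op_scaleC z (nc_monom \<theta> m)) (basis_vec k)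
      = op_scaleC (cis (h * of_int (m $ j)) * z) (nc_monom \<theta> m) (basis_vec k)"
    using mb by (simp add: gauge_conj_def nc_gauge_basis bounded_ops_scaleC[OF mb] bounded_ops_scaleC[OF nc_gauge_bounded] w mult_ac)
qed

lemma gauge_conj_cstar: "x \<in> nc_cstar \<theta> \<Longrightarrow> gauge_conj j h x \<in> nc_cstar \<theta>"
proof (rule nc_cstar_bounded_linear[OF bounded_linear_gauge_conj])
  fix x assume "x \<in> scaled_monoms \<theta>"
  then show "gauge_conj j h x \<in> nc_cstar \<theta>"
    using nc_cstar_superset by (force simp: scaled_monoms_def gauge_conj_monom)
qed

text \<open>On monomials both sides vanish unless m = 0, where the gauge phase is 1;
  \<open>nc_cstar_subset\<close> carries the identity to the whole algebra.\<close>

lemma trace_gauge_conj: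
  assumes "x \<in> nc_cstar \<theta>"
  shows "Re (nc_trace \<theta> (gauge_conj j h x)) = Re (nc_trace \<theta> x)"
proof -
  let ?\<rho> = "\<lambda>x. Re (nc_trace \<theta> x)"
  define C where "C = {x \<in> nc_cstar \<theta>. ?\<rho> (gauge_conj j h x) = ?\<rho> x}"
  have lin: "linear (gauge_conj j h)" using bounded_linear_gauge_conj by (rule bounded_linear.linear)
  have "nc_cstar \<theta> \<subseteq> C"
  proof (rule nc_cstar_subset)
    show "scaled_monoms \<theta> \<subseteq> C"
    proof
      fix x assume x: "x \<in> scaled_monoms \<theta>"
      then obtain z m where "x = op_scaleC z (nc_monom \<theta> m)" by (auto simp: scaled_monoms_def)
      then show "x \<in> C" using x nc_cstar_superset by (auto simp: C_def gauge_conj_monom nc_trace_monom)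
    qed
    show "subspace C"
      by (rule subspaceI)
        (auto simp: C_def linear_0[OF lin] linear_add[OF lin] linear_cmul[OF lin] gauge_conj_cstar
          torus.M_zero torus.M_add torus.M_scaleR torus.trace_add torus.trace_scaleR)
    show "closed C"
      unfolding closed_sequential_limits
    proof (intro allI impI)
      fix X l assume X: "(\<forall>n. X n \<in> C) \<and> X \<longlonglongrightarrow> l"
      then have l: "l \<in> nc_cstar \<theta>"
        using closed_sequentially[OF closed_nc_cstar, of X \<theta> l] by (auto simp: C_def)
      have "(\<lambda>i. ?\<rho> (gauge_conj j h (X i))) \<longlonglongrightarrow> ?\<rho> (gauge_conj j h l)"
        using X by (intro torus.tendsto_trace bounded_linear.tendsto[OF bounded_linear_gauge_conj]) (auto simp: C_def gauge_conj_cstar)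
      moreover have "(\<lambda>i. ?\<rho> (X i)) \<longlonglongrightarrow> ?\<rho> l"
        using X by (intro torus.tendsto_trace) (auto simp: C_def)
      ultimately show "l \<in> C"
        using X l by (auto simp: C_def intro: LIMSEQ_unique)
    qed
  qed
  then show ?thesis using assms by (auto simp: C_def)
qed

text \<open>Conjugation by a unitary commutes with the functional calculus by intertwining, so
  invariance of the trace gives invariance of \<open>pow_trace\<close>.\<close>

lemma Lp_gauge_conj:
  assumes x: "x \<in> nc_cstar \<theta>" and p: "0 < p"
  shows "torus.Lp \<theta> p (gauge_conj j h x) = torus.Lp \<theta> p x"
proof -
  let ?D = "nc_gauge j h" and ?D' = "nc_gauge j (- h)"
  define y where "y = op_adj x o\<^sub>L x"
  have y: "psd y" "y \<in> nc_cstar \<theta>" using x by (auto simp: y_def torus.psd_square torus.M_square)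
  have xb: "x \<in> bounded_ops" using x by (rule torus.M_bounded)
  have DD: "?D' o\<^sub>L (?D o\<^sub>L z) = z" for z :: "'a lattice op"
    unfolding compose_assoc[symmetric] by simp
  have gy: "op_adj (gauge_conj j h x) o\<^sub>L gauge_conj j h x = gauge_conj j h y"
    using xb by (simp add: gauge_conj_def op_adj_compose bounded_ops_compose nc_gauge_bounded op_adj_gauge compose_assoc y_def DD)
  have pg: "psd (gauge_conj j h y)"
    using psd_conj[OF y(1) nc_gauge_bounded, of j "- h"] by (simp add: gauge_conj_def op_adj_gauge)
  have "?D o\<^sub>L fun_calc f y = fun_calc f (gauge_conj j h y) o\<^sub>L ?D" if "continuous_on {0..} f" for f
    by (rule fun_calc_intertwine[OF y(1) pg _ that]) (simp add: gauge_conj_def compose_assoc)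
  then have f: "gauge_conj j h (fun_calc f y) = fun_calc f (gauge_conj j h y)" if "continuous_on {0..} f" for f
    using that by (simp add: gauge_conj_def compose_assoc)
  have "torus.pow_trace \<theta> p (gauge_conj j h x) = torus.pow_trace \<theta> p x"
    unfolding torus.pow_trace_def gy y_def[symmetric]
    using p y by (simp add: f[symmetric] continuous_on_powr_const trace_gauge_conj torus.M_fun_calc)
  then show ?thesis using x p by (simp add: torus.Lp_eq_pow_trace gauge_conj_cstar)
qed

section \<open>Fourier multipliers\<close>

definition slowly_growing :: "('n::finite lattice \<Rightarrow> complex) \<Rightarrow> bool" where
  "slowly_growing \<phi> \<longleftrightarrow> (\<exists>K N. \<forall>m. cmod (\<phi> m) \<le> K * (1 + sqrt (int_norm_sq m)) ^ N)"

lemma int_norm_sq_nonneg [simp]: "0 \<le> int_norm_sq m"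
  by (simp add: int_norm_sq_def sum_nonneg)

lemma slowly_growing_mult:
  assumes "slowly_growing \<phi>" "slowly_growing \<psi>"
  shows "slowly_growing (\<lambda>m. \<phi> m * \<psi> m)"
proof -
  obtain K N where \<phi>: "\<And>m. cmod (\<phi> m) \<le> K * (1 + sqrt (int_norm_sq m)) ^ N"
    using assms(1) unfolding slowly_growing_def by blast
  obtain L M where \<psi>: "\<And>m. cmod (\<psi> m) \<le> L * (1 + sqrt (int_norm_sq m)) ^ M"
    using assms(2) unfolding slowly_growing_def by blast
  have "cmod (\<phi> m * \<psi> m) \<le> (K * L) * (1 + sqrt (int_norm_sq m)) ^ (N + M)" for m
    using mult_mono'[OF \<phi>[of m] \<psi>[of m]] by (simp add: norm_mult power_add mult_ac)
  then show ?thesis unfolding slowly_growing_def by blast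
qed

lemma slowly_growing_bounded:
  assumes "\<And>m. cmod (\<phi> m) \<le> K"
  shows "slowly_growing \<phi>"
  unfolding slowly_growing_def by (rule exI[of _ K], rule exI[of _ 0]) (use assms in simp)

lemma slowly_growing_coord: "slowly_growing (\<lambda>m. of_int (m $ j))"
proof -
  have "\<bar>real_of_int (m $ j)\<bar> \<le> 1 * (1 + sqrt (int_norm_sq m)) ^ 1" for m :: "'a lattice"
  proof -
    have "(real_of_int (m $ j))\<^sup>2 \<le> int_norm_sq m"
      unfolding int_norm_sq_def by (rule member_le_sum) auto
    then have "\<bar>real_of_int (m $ j)\<bar> \<le> sqrt (int_norm_sq m)"
      by (simp add: real_le_rsqrt)
    then show ?thesis by simp
  qed
  then show ?thesis unfolding slowly_growing_def by (metis norm_of_int of_int_abs)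
qed

lemma slowly_growing_prod:
  "(\<And>i. i \<in> I \<Longrightarrow> slowly_growing (\<phi> i)) \<Longrightarrow> slowly_growing (\<lambda>m. \<Prod>i\<in>I. \<phi> i m)"
  by (induction I rule: infinite_finite_induct)
    (auto intro: slowly_growing_mult slowly_growing_bounded[where K = 1])

lemma slowly_growing_power:
  assumes "slowly_growing \<phi>"
  shows "slowly_growing (\<lambda>m. \<phi> m ^ k)"
  using slowly_growing_prod[of "{..<k}" "\<lambda>_. \<phi>"] assms by simp

lemma slowly_growing_add:
  assumes "slowly_growing \<phi>" "slowly_growing \<psi>"
  shows "slowly_growing (\<lambda>m. \<phi> m + \<psi> m)"
proof -
  obtain K N where \<phi>: "\<And>m. cmod (\<phi> m) \<le> K * (1 + sqrt (int_norm_sq m)) ^ N"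
    using assms(1) unfolding slowly_growing_def by blast
  obtain L M where \<psi>: "\<And>m. cmod (\<psi> m) \<le> L * (1 + sqrt (int_norm_sq m)) ^ M"
    using assms(2) unfolding slowly_growing_def by blast
  have "cmod (\<phi> m + \<psi> m) \<le> (\<bar>K\<bar> + \<bar>L\<bar>) * (1 + sqrt (int_norm_sq m)) ^ (N + M)" for m
  proof -
    let ?x = "1 + sqrt (int_norm_sq m)"
    have "K * ?x ^ N \<le> \<bar>K\<bar> * ?x ^ (N + M)" "L * ?x ^ M \<le> \<bar>L\<bar> * ?x ^ (N + M)"
      by (auto intro!: mult_mono power_increasing)
    then show ?thesis
      using norm_triangle_ineq[of "\<phi> m" "\<psi> m"] \<phi>[of m] \<psi>[of m] by (simp add: distrib_right)
  qed
  then show ?thesis unfolding slowly_growing_def by blast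
qed

lemma rapidly_decreasing_mult:
  assumes "slowly_growing \<phi>" "rapidly_decreasing c"
  shows "rapidly_decreasing (\<lambda>m. \<phi> m * c m)"
  unfolding rapidly_decreasing_def
proof
  fix M :: nat
  obtain K N where \<phi>: "\<And>m. cmod (\<phi> m) \<le> K * (1 + sqrt (int_norm_sq m)) ^ N"
    using assms(1) unfolding slowly_growing_def by blast
  obtain L where L: "\<And>m. (1 + sqrt (int_norm_sq m)) ^ (M + N) * cmod (c m) \<le> L"
    using assms(2) unfolding rapidly_decreasing_def by blast
  have "(1 + sqrt (int_norm_sq m)) ^ M * cmod (\<phi> m * c m) \<le> \<bar>K\<bar> * L" for m
  proof -
    let ?x = "1 + sqrt (int_norm_sq m)"
    have "cmod (\<phi> m) \<le> \<bar>K\<bar> * ?x ^ N"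
      by (rule order_trans[OF \<phi>]) (auto intro!: mult_right_mono)
    then have "?x ^ M * cmod (\<phi> m * c m) \<le> ?x ^ M * ((\<bar>K\<bar> * ?x ^ N) * cmod (c m))"
      unfolding norm_mult by (intro mult_left_mono mult_right_mono) auto
    also have "\<dots> = \<bar>K\<bar> * (?x ^ (M + N) * cmod (c m))" by (simp add: power_add mult_ac)
    also have "\<dots> \<le> \<bar>K\<bar> * L" by (intro mult_left_mono L) auto
    finally show ?thesis .
  qed
  then show "\<exists>K. \<forall>m. (1 + sqrt (int_norm_sq m)) ^ M * cmod (\<phi> m * c m) \<le> K" by blast
qed

lemma rapidly_decreasing_scale: "rapidly_decreasing c \<Longrightarrow> rapidly_decreasing (\<lambda>m. z * c m)"
  by (rule rapidly_decreasing_mult[OF slowly_growing_bounded[of _ "cmod z"]]) auto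

lemma rapidly_decreasing_add:
  assumes "rapidly_decreasing c" "rapidly_decreasing d"
  shows "rapidly_decreasing (\<lambda>m. c m + d m)"
  unfolding rapidly_decreasing_def
proof
  fix N :: nat
  obtain K where K: "\<And>m. (1 + sqrt (int_norm_sq m)) ^ N * cmod (c m) \<le> K"
    using assms(1) unfolding rapidly_decreasing_def by blast
  obtain L where L: "\<And>m. (1 + sqrt (int_norm_sq m)) ^ N * cmod (d m) \<le> L"
    using assms(2) unfolding rapidly_decreasing_def by blast
  have "(1 + sqrt (int_norm_sq m)) ^ N * cmod (c m + d m) \<le> K + L" for m
  proof -
    have "(1 + sqrt (int_norm_sq m)) ^ N * cmod (c m + d m)
        \<le> (1 + sqrt (int_norm_sq m)) ^ N * (cmod (c m) + cmod (d m))"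
      by (intro mult_left_mono norm_triangle_ineq) auto
    then show ?thesis using K[of m] L[of m] by (simp add: distrib_left)
  qed
  then show "\<exists>K. \<forall>m. (1 + sqrt (int_norm_sq m)) ^ N * cmod (c m + d m) \<le> K" by blast
qed

lemma nc_series_add:
  assumes "rapidly_decreasing c" "rapidly_decreasing d"
  shows "nc_series \<theta> (\<lambda>m. c m + d m) = nc_series \<theta> c + nc_series \<theta> d"
proof -
  have "op_scaleC (c m + d m) (nc_monom \<theta> m) = op_scaleC (c m) (nc_monom \<theta> m) + op_scaleC (d m) (nc_monom \<theta> m)" for m
    by (rule blinfun_eqI) (simp add: scaleC_add_left blinfun.add_left)
  then show ?thesis
    unfolding nc_series_def using assms by (simp add: infsum_add series_summable)
qed

lemma nc_series_scale:
  assumes "rapidly_decreasing c"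
  shows "nc_series \<theta> (\<lambda>m. z * c m) = op_scaleC z (nc_series \<theta> c)"
  using has_sum_bounded_linear[OF bounded_linear_op_scaleC nc_series_has_sum[OF assms], of z \<theta>]
  by (simp add: nc_series_def infsumI)

lemma gauge_conj_series:
  assumes "rapidly_decreasing c"
  shows "gauge_conj j h (nc_series \<theta> c) = nc_series \<theta> (\<lambda>m. cis (h * of_int (m $ j)) * c m)"
  using has_sum_bounded_linear[OF bounded_linear_gauge_conj nc_series_has_sum[OF assms], of j h \<theta>]
  by (simp add: gauge_conj_monom nc_series_def infsumI)

text \<open>Phrased with symbols acting on coefficients, so that composition is the pointwise
  product of symbols. Slow growth keeps the sequences rapidly decreasing, and B \<ge> 0 allows
  bounds to be multiplied.\<close>

definition multiplier_bound ::
    "'n::{finite,linorder} rmatrix \<Rightarrow> real \<Rightarrow> ('n lattice \<Rightarrow> complex) \<Rightarrow> real \<Rightarrow> bool" where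
  "multiplier_bound \<theta> p \<phi> B \<longleftrightarrow> slowly_growing \<phi> \<and> 0 \<le> B \<and>
     (\<forall>c. rapidly_decreasing c \<longrightarrow>
        Lp_norm \<theta> p (nc_series \<theta> (\<lambda>m. \<phi> m * c m)) \<le> B * Lp_norm \<theta> p (nc_series \<theta> c))"

lemma Lp_norm_nonneg: "0 \<le> Lp_norm \<theta> p a"
  by (simp add: Lp_norm_def)

lemma multiplier_bound_mult:
  assumes "multiplier_bound \<theta> p \<phi> A" "multiplier_bound \<theta> p \<psi> B"
  shows "multiplier_bound \<theta> p (\<lambda>m. \<phi> m * \<psi> m) (A * B)"
  unfolding multiplier_bound_def
proof (intro conjI allI impI)
  show "slowly_growing (\<lambda>m. \<phi> m * \<psi> m)" "0 \<le> A * B"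
    using assms by (auto simp: multiplier_bound_def slowly_growing_mult)
  fix c :: "'a lattice \<Rightarrow> complex" assume c: "rapidly_decreasing c"
  have "Lp_norm \<theta> p (nc_series \<theta> (\<lambda>m. \<phi> m * (\<psi> m * c m))) \<le> A * Lp_norm \<theta> p (nc_series \<theta> (\<lambda>m. \<psi> m * c m))"
    using assms c by (simp add: multiplier_bound_def rapidly_decreasing_mult)
  also have "\<dots> \<le> A * (B * Lp_norm \<theta> p (nc_series \<theta> c))"
    using assms c by (intro mult_left_mono) (auto simp: multiplier_bound_def)
  finally show "Lp_norm \<theta> p (nc_series \<theta> (\<lambda>m. \<phi> m * \<psi> m * c m)) \<le> A * B * Lp_norm \<theta> p (nc_series \<theta> c)"
    by (simp add: mult_ac)
qed

lemma multiplier_bound_scale: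
  assumes "1 < p"
  shows "multiplier_bound \<theta> p (\<lambda>_. z) (cmod z)"
  unfolding multiplier_bound_def
proof (intro conjI allI impI)
  fix c :: "'a lattice \<Rightarrow> complex" assume c: "rapidly_decreasing c"
  show "Lp_norm \<theta> p (nc_series \<theta> (\<lambda>m. z * c m)) \<le> cmod z * Lp_norm \<theta> p (nc_series \<theta> c)"
    using assms c by (simp add: nc_series_scale Lp_norm_eq torus.Lp_op_scaleC nc_cstar_op_scaleC nc_series_cstar)
qed (auto intro: slowly_growing_bounded)

lemma multiplier_bound_gauge:
  assumes "1 < p"
  shows "multiplier_bound \<theta> p (\<lambda>m. cis (h * of_int (m $ j))) 1"
  unfolding multiplier_bound_def
  using assms
  by (auto simp: gauge_conj_series[symmetric] Lp_norm_eq Lp_gauge_conj nc_series_cstar intro: slowly_growing_bounded[where K = 1])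

lemma multiplier_bound_add:
  assumes p: "1 < p" and "multiplier_bound \<theta> p \<phi> A" "multiplier_bound \<theta> p \<psi> B"
  shows "multiplier_bound \<theta> p (\<lambda>m. \<phi> m + \<psi> m) (A + B)"
  unfolding multiplier_bound_def
proof (intro conjI allI impI)
  show "slowly_growing (\<lambda>m. \<phi> m + \<psi> m)" "0 \<le> A + B"
    using assms by (auto simp: multiplier_bound_def slowly_growing_add)
  fix c :: "'a lattice \<Rightarrow> complex" assume c: "rapidly_decreasing c"
  have r: "rapidly_decreasing (\<lambda>m. \<phi> m * c m)" "rapidly_decreasing (\<lambda>m. \<psi> m * c m)"
    using assms c by (auto simp: multiplier_bound_def rapidly_decreasing_mult)
  have "Lp_norm \<theta> p (nc_series \<theta> (\<lambda>m. \<phi> m * c m + \<psi> m * c m))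
      \<le> Lp_norm \<theta> p (nc_series \<theta> (\<lambda>m. \<phi> m * c m)) + Lp_norm \<theta> p (nc_series \<theta> (\<lambda>m. \<psi> m * c m))"
    using p r by (simp add: nc_series_add Lp_norm_eq torus.Lp_triangle nc_series_cstar)
  also have "\<dots> \<le> A * Lp_norm \<theta> p (nc_series \<theta> c) + B * Lp_norm \<theta> p (nc_series \<theta> c)"
    using assms c by (intro add_mono) (auto simp: multiplier_bound_def)
  finally show "Lp_norm \<theta> p (nc_series \<theta> (\<lambda>m. (\<phi> m + \<psi> m) * c m)) \<le> (A + B) * Lp_norm \<theta> p (nc_series \<theta> c)"
    by (simp add: distrib_right)
qed

lemma multiplier_bound_sum:
  assumes p: "1 < p" and "\<And>i. i \<in> I \<Longrightarrow> multiplier_bound \<theta> p (\<phi> i) (A i)"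
  shows "multiplier_bound \<theta> p (\<lambda>m. \<Sum>i\<in>I. \<phi> i m) (\<Sum>i\<in>I. A i)"
  using assms(2)
proof (induction I rule: infinite_finite_induct)
  case (insert i I)
  then show ?case by (simp add: multiplier_bound_add[OF p])
qed (use multiplier_bound_scale[OF p, of \<theta> 0] in auto)

lemma multiplier_bound_prod:
  assumes p: "1 < p" and "\<And>i. i \<in> I \<Longrightarrow> multiplier_bound \<theta> p (\<phi> i) (A i)"
  shows "multiplier_bound \<theta> p (\<lambda>m. \<Prod>i\<in>I. \<phi> i m) (\<Prod>i\<in>I. A i)"
  using assms(2)
proof (induction I rule: infinite_finite_induct)
  case (insert i I)
  then show ?case by (simp add: multiplier_bound_mult)
qed (use multiplier_bound_scale[OF p, of \<theta> 1] in auto)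

lemma multiplier_bound_power:
  assumes "1 < p" "multiplier_bound \<theta> p \<phi> A"
  shows "multiplier_bound \<theta> p (\<lambda>m. \<phi> m ^ k) (A ^ k)"
  using multiplier_bound_prod[OF assms(1), of "{..<k}" \<theta> "\<lambda>_. \<phi>" "\<lambda>_. A"] assms(2) by simp

lemma multiplier_bound_mono:
  "multiplier_bound \<theta> p \<phi> A \<Longrightarrow> A \<le> B \<Longrightarrow> multiplier_bound \<theta> p \<phi> B"
  unfolding multiplier_bound_def by (meson Lp_norm_nonneg mult_right_mono order_trans)

text \<open>Dominated convergence: the L^p norm is at most the operator norm, hence at most the sum
  of the moduli of the coefficients, and g against the rapidly decreasing c gives a summable
  majorant.\<close>

lemma multiplier_bound_limit:
  assumes p: "1 < p" and mb: "\<And>n. multiplier_bound \<theta> p (\<phi> n) A"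
    and lim: "\<And>m. (\<lambda>n. \<phi> n m) \<longlonglongrightarrow> \<psi> m"
    and dom: "\<And>n m. cmod (\<phi> n m) \<le> g m" and g: "slowly_growing (\<lambda>m. of_real (g m))"
  shows "multiplier_bound \<theta> p \<psi> A"
  unfolding multiplier_bound_def
proof (intro conjI allI impI)
  have dom': "cmod (\<psi> m) \<le> g m" for m
    by (rule LIMSEQ_le_const2[OF tendsto_norm[OF lim]]) (use dom in auto)
  have g0: "0 \<le> g m" for m using dom'[of m] norm_ge_zero order_trans by blast
  obtain K N where K: "\<And>m. g m \<le> K * (1 + sqrt (int_norm_sq m)) ^ N"
    using g g0 by (auto simp: slowly_growing_def)
  have grow: "slowly_growing f" if "\<And>m. cmod (f m) \<le> g m" for f
    unfolding slowly_growing_def using order_trans[OF that K] by blast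
  show "slowly_growing \<psi>" by (rule grow[OF dom'])
  show "0 \<le> A" using mb by (simp add: multiplier_bound_def)
  fix c :: "'a lattice \<Rightarrow> complex" assume c: "rapidly_decreasing c"
  \<comment> \<open>The factor 2 accounts for \<psi> and \<open>\<phi> n\<close>, both of modulus at
    most g.\<close>
  define G where "G m = 2 * (g m * cmod (c m))" for m
  have "(\<lambda>m. cmod (of_real (g m) * c m)) summable_on UNIV"
    by (intro rapid_summable rapidly_decreasing_mult g c)
  then have "(\<lambda>m. 2 * cmod (of_real (g m) * c m)) summable_on UNIV" by (rule summable_on_cmult_right)
  then have G: "G summable_on UNIV" using g0 by (simp add: G_def[abs_def] norm_mult)
  let ?N = "\<lambda>f. Lp_norm \<theta> p (nc_series \<theta> f)"
  \<comment> \<open>F separates a finite head, on which n tends to infinity, from a tail bounded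
    uniformly in n; F exhausts the lattice only afterwards.\<close>
  have bound: "?N (\<lambda>m. \<psi> m * c m) \<le> (infsum G UNIV - sum G F) + A * ?N c" if F: "finite F" for F
  proof -
    have each: "?N (\<lambda>m. \<psi> m * c m) \<le> (\<Sum>m\<in>F. cmod (\<psi> m - \<phi> n m) * cmod (c m)) + (infsum G UNIV - sum G F) + A * ?N c" for n
    proof -
      define d where "d m = (\<psi> m - \<phi> n m) * c m" for m
      have r: "rapidly_decreasing (\<lambda>m. \<phi> n m * c m)" "rapidly_decreasing (\<lambda>m. \<psi> m * c m)"
        using dom dom' by (auto intro!: rapidly_decreasing_mult c grow)
      have d: "rapidly_decreasing d"
        using rapidly_decreasing_add[OF r(2) rapidly_decreasing_scale[OF r(1), of "-1"]]
        by (simp add: d_def[abs_def] algebra_simps)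
      have "?N (\<lambda>m. \<psi> m * c m) = ?N (\<lambda>m. d m + \<phi> n m * c m)" by (simp add: d_def algebra_simps)
      also have "\<dots> \<le> ?N d + ?N (\<lambda>m. \<phi> n m * c m)"
        using p r d by (simp add: nc_series_add Lp_norm_eq torus.Lp_triangle nc_series_cstar)
      also have "?N (\<lambda>m. \<phi> n m * c m) \<le> A * ?N c"
        using mb[of n] c by (simp add: multiplier_bound_def)
      also have "?N d \<le> (\<Sum>\<^sub>\<infinity>m. cmod (d m))"
        using p d torus.Lp_le_norm[OF nc_series_cstar[OF d], of p \<theta>] norm_nc_series_le[OF d, of \<theta>]
        by (simp add: Lp_norm_eq)
      also have "\<dots> = (\<Sum>\<^sub>\<infinity>m\<in>F. cmod (d m)) + (\<Sum>\<^sub>\<infinity>m\<in>UNIV - F. cmod (d m))"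
        using infsum_Diff[OF rapid_summable[OF d] summable_on_finite[OF F]] by simp
      also have "(\<Sum>\<^sub>\<infinity>m\<in>UNIV - F. cmod (d m)) \<le> (\<Sum>\<^sub>\<infinity>m\<in>UNIV - F. G m)"
      proof (rule infsum_mono)
        show "(\<lambda>m. cmod (d m)) summable_on UNIV - F" "G summable_on UNIV - F"
          using rapid_summable[OF d] G by (auto intro: summable_on_subset_banach)
        show "cmod (d m) \<le> G m" for m
          using norm_triangle_ineq4[of "\<psi> m" "\<phi> n m"] dom[of n m] dom'[of m]
            mult_right_mono[of "cmod (\<psi> m - \<phi> n m)" "2 * g m" "cmod (c m)"]
          by (simp add: d_def G_def norm_mult mult.assoc)
      qed
      also have "(\<Sum>\<^sub>\<infinity>m\<in>UNIV - F. G m) = infsum G UNIV - sum G F"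
        using infsum_Diff[OF G summable_on_finite[OF F]] F by simp
      finally show ?thesis using F by (simp add: d_def norm_mult)
    qed
    have "(\<lambda>n. (\<Sum>m\<in>F. cmod (\<psi> m - \<phi> n m) * cmod (c m)) + (infsum G UNIV - sum G F) + A * ?N c)
        \<longlonglongrightarrow> (\<Sum>m\<in>F. cmod (\<psi> m - \<psi> m) * cmod (c m)) + (infsum G UNIV - sum G F) + A * ?N c"
      by (intro tendsto_intros lim)
    then have "?N (\<lambda>m. \<psi> m * c m) \<le> (\<Sum>m\<in>F. cmod (\<psi> m - \<psi> m) * cmod (c m)) + (infsum G UNIV - sum G F) + A * ?N c"
      by (rule LIMSEQ_le_const) (use each in blast)
    then show ?thesis by simp
  qed
  have "((\<lambda>F. (infsum G UNIV - sum G F) + A * ?N c) \<longlongrightarrow> (infsum G UNIV - infsum G UNIV) + A * ?N c) (finite_subsets_at_top UNIV)"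
    using has_sum_infsum[OF G] by (intro tendsto_intros) (simp add: has_sum_def)
  then have "?N (\<lambda>m. \<psi> m * c m) \<le> (infsum G UNIV - infsum G UNIV) + A * ?N c"
    by (rule tendsto_lowerbound) (auto intro!: eventually_finite_subsets_at_top_weakI bound)
  then show "?N (\<lambda>m. \<psi> m * c m) \<le> A * ?N c" by simp
qed

section \<open>Heat multipliers in one direction\<close>

text \<open>The exponent is n although the step is y / sqrt(n + 1): a walk of n + 1 steps leaves
  cos^n beside the sine in \<open>binomial_first_moment\<close>, and one missing factor cos does not
  change the limit.\<close>

lemma cos_power_limit: "(\<lambda>n::nat. cos (y / sqrt (real (Suc n))) ^ n) \<longlonglongrightarrow> exp (- y\<^sup>2 / 2)"
proof -
  \<comment> \<open>The asymptotic expansion is made for a positive argument; evenness and the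
    trivial case 0 give the rest.\<close>
  have pos: "(\<lambda>n::nat. cos (x / sqrt (real (Suc n))) ^ n) \<longlonglongrightarrow> exp (- x\<^sup>2 / 2)" if "x > 0" for x :: real
    using that by (real_asymp simp: power2_eq_square)
  show ?thesis
    using pos[of y] pos[of "- y"] by (cases y "0 :: real" rule: linorder_cases) auto
qed

lemma sin_quotient_limit: "(\<lambda>n::nat. sin (y / sqrt (real (Suc n))) * sqrt (real (Suc n))) \<longlonglongrightarrow> y"
proof -
  have pos: "(\<lambda>n::nat. sin (x / sqrt (real (Suc n))) * sqrt (real (Suc n))) \<longlonglongrightarrow> x" if "x > 0" for x :: real
    using that by real_asymp
  show ?thesis
    using pos[of y] tendsto_minus[OF pos[of "- y"]] by (cases y "0 :: real" rule: linorder_cases) auto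
qed

text \<open>One step of the symmetric walk: the average of the gauge automorphisms by h and by
  -h.\<close>

lemma multiplier_bound_cos:
  assumes p: "1 < p"
  shows "multiplier_bound \<theta> p (\<lambda>m. of_real (cos (h * of_int (m $ j)))) 1"
proof -
  have "multiplier_bound \<theta> p (\<lambda>m. (1 / 2) * cis (h * of_int (m $ j)) + (1 / 2) * cis ((- h) * of_int (m $ j)))
      (cmod (1 / 2) * 1 + cmod (1 / 2) * 1)"
    by (intro multiplier_bound_add[OF p] multiplier_bound_mult multiplier_bound_scale[OF p] multiplier_bound_gauge[OF p])
  moreover have "(1 / 2) * cis x + (1 / 2) * cis (- x) = of_real (cos x)" for x
    by (simp add: complex_eq_iff)
  ultimately show ?thesis by simp
qed

lemma multiplier_bound_heat:
  assumes p: "1 < p" and l: "0 \<le> l"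
  shows "multiplier_bound \<theta> p (\<lambda>m. of_real (exp (- l * (of_int (m $ j))\<^sup>2))) 1"
proof -
  \<comment> \<open>Chosen so that s^2 / 2 = l in the Gaussian limit.\<close>
  define s where "s = sqrt (2 * l)"
  define \<phi> where "\<phi> n m = complex_of_real (cos (s / sqrt (real (Suc n)) * of_int (m $ j))) ^ n" for n and m :: "'a lattice"
  show ?thesis
  proof (rule multiplier_bound_limit[OF p, where \<phi> = \<phi> and g = "\<lambda>_. 1"])
    show "multiplier_bound \<theta> p (\<phi> n) 1" for n
      unfolding \<phi>_def using multiplier_bound_power[OF p multiplier_bound_cos[OF p, of \<theta> "s / sqrt (real (Suc n))" j], of n] by simp
    fix m :: "'a lattice"
    have "(\<lambda>n. cos ((s * of_int (m $ j)) / sqrt (real (Suc n))) ^ n) \<longlonglongrightarrow> exp (- (s * of_int (m $ j))\<^sup>2 / 2)"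
      by (rule cos_power_limit)
    moreover have "- (s * of_int (m $ j))\<^sup>2 / 2 = - l * (of_int (m $ j))\<^sup>2"
      using l by (simp add: s_def power_mult_distrib)
    ultimately have "(\<lambda>n. cos ((s * of_int (m $ j)) / sqrt (real (Suc n))) ^ n) \<longlonglongrightarrow> exp (- l * (of_int (m $ j))\<^sup>2)"
      by (simp only:)
    from tendsto_of_real[OF this, where 'a = complex]
    show "(\<lambda>n. \<phi> n m) \<longlonglongrightarrow> of_real (exp (- l * (of_int (m $ j))\<^sup>2))"
      by (simp add: \<phi>_def)
    show "cmod (\<phi> n m) \<le> 1" for n by (simp add: \<phi>_def norm_power power_le_one)
  qed (rule slowly_growing_bounded[where K = 1], simp)
qed

text \<open>The operator z d/dz - w d/dw applied to the binomial expansion of (z + w)^(n + 1). At z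
  = e^(ix) and w = e^(-ix) the factor z - w produces the sine.\<close>

lemma binomial_first_moment:
  fixes z w :: complex
  shows "(\<Sum>k\<le>Suc n. of_nat (Suc n choose k) * (2 * of_nat k - of_nat (Suc n)) * (z ^ k * w ^ (Suc n - k)))
    = of_nat (Suc n) * (z - w) * (z + w) ^ n"
proof -
  have 1: "(\<Sum>k\<le>Suc n. of_nat k * of_nat (Suc n choose k) * (z ^ k * w ^ (Suc n - k))) = of_nat (Suc n) * z * (z + w) ^ n"
  proof -
    have "(\<Sum>k\<le>Suc n. of_nat k * of_nat (Suc n choose k) * (z ^ k * w ^ (Suc n - k)))
        = (\<Sum>k\<le>n. of_nat (Suc k * (Suc n choose Suc k)) * (z ^ Suc k * w ^ (n - k)))"
      by (subst sum.atMost_Suc_shift) (simp only: of_nat_0 mult_zero_left add_0_left of_nat_mult diff_Suc_Suc)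
    also have "\<dots> = (\<Sum>k\<le>n. of_nat (Suc n) * z * (of_nat (n choose k) * z ^ k * w ^ (n - k)))"
      unfolding Suc_times_binomial by (intro sum.cong) (simp_all add: mult_ac del: of_nat_Suc mult_Suc)
    finally show ?thesis by (simp only: sum_distrib_left[symmetric] binomial_ring)
  qed
  have 2: "(\<Sum>k\<le>Suc n. of_nat (Suc n - k) * of_nat (Suc n choose k) * (z ^ k * w ^ (Suc n - k))) = of_nat (Suc n) * w * (z + w) ^ n"
  proof -
    have "(\<Sum>k\<le>Suc n. of_nat (Suc n - k) * of_nat (Suc n choose k) * (z ^ k * w ^ (Suc n - k)))
        = (\<Sum>k\<le>n. of_nat ((Suc n - k) * (Suc n choose k)) * (z ^ k * w ^ (Suc n - k)))"
      by (simp only: sum.atMost_Suc diff_self_eq_0 of_nat_0 mult_zero_left add_0_right of_nat_mult)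
    also have "\<dots> = (\<Sum>k\<le>n. of_nat (Suc n) * w * (of_nat (n choose k) * z ^ k * w ^ (n - k)))"
      unfolding binomial_absorb_comp by (intro sum.cong) (simp_all add: mult_ac Suc_diff_le del: of_nat_Suc mult_Suc)
    finally show ?thesis by (simp only: sum_distrib_left[symmetric] binomial_ring)
  qed
  have "(\<Sum>k\<le>Suc n. of_nat (Suc n choose k) * (2 * of_nat k - of_nat (Suc n)) * (z ^ k * w ^ (Suc n - k)))
     = (\<Sum>k\<le>Suc n. of_nat k * of_nat (Suc n choose k) * (z ^ k * w ^ (Suc n - k)))
       - (\<Sum>k\<le>Suc n. of_nat (Suc n - k) * of_nat (Suc n choose k) * (z ^ k * w ^ (Suc n - k)))"
    unfolding sum_subtractf[symmetric]
    by (intro sum.cong) (simp_all add: of_nat_diff algebra_simps)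
  then show ?thesis unfolding 1 2 by (simp add: algebra_simps)
qed

text \<open>Under the symmetric binomial law 2 k - n has variance n; the pointwise bound u \<le> u^2
  / (2 sqrt n) + sqrt n / 2 takes the place of Cauchy-Schwarz.\<close>

lemma binomial_abs_moment_le:
  assumes n: "0 < n"
  shows "(\<Sum>k\<le>n. real (n choose k) * \<bar>2 * real k - real n\<bar>) \<le> sqrt n * 2 ^ n"
proof -
  have B: "real (n choose k) = 2 ^ n * Bernstein n k (1 / 2)" if "k \<le> n" for k
    using that by (simp add: Bernstein_def power_add[symmetric] power_divide)
  have "(\<Sum>k\<le>n. (2 * real k - real n)\<^sup>2 * Bernstein n k (1 / 2))
      = 4 * (\<Sum>k\<le>n. real k * (real k - 1) * Bernstein n k (1 / 2)) + (4 - 4 * real n) * (\<Sum>k\<le>n. real k * Bernstein n k (1 / 2))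
        + (real n)\<^sup>2 * (\<Sum>k\<le>n. Bernstein n k (1 / 2))"
    unfolding sum_distrib_left sum.distrib[symmetric] by (intro sum.cong) (simp_all add: power2_eq_square algebra_simps)
  also have "\<dots> = n"
    unfolding sum_kk_Bernstein sum_k_Bernstein sum_Bernstein by (simp add: power2_eq_square algebra_simps)
  finally have var: "(\<Sum>k\<le>n. (2 * real k - real n)\<^sup>2 * Bernstein n k (1 / 2)) = n" .
  have "(\<Sum>k\<le>n. real (n choose k) * \<bar>2 * real k - real n\<bar>)
      \<le> (\<Sum>k\<le>n. 2 ^ n * (((2 * real k - real n)\<^sup>2 * Bernstein n k (1 / 2)) / (2 * sqrt n) + Bernstein n k (1 / 2) * (sqrt n / 2)))"
  proof (intro sum_mono)
    fix k assume k: "k \<in> {..n}"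
    define u where "u = \<bar>2 * real k - real n\<bar>"
    have "0 \<le> (u - sqrt n)\<^sup>2" by simp
    then have "2 * u * sqrt n \<le> u\<^sup>2 + n" by (simp add: power2_diff)
    then have "u \<le> u\<^sup>2 / (2 * sqrt n) + sqrt n / 2"
      using n by (simp add: field_simps)
    then have "real (n choose k) * u \<le> real (n choose k) * (u\<^sup>2 / (2 * sqrt n) + sqrt n / 2)"
      by (intro mult_left_mono) auto
    then show "real (n choose k) * \<bar>2 * real k - real n\<bar>
        \<le> 2 ^ n * (((2 * real k - real n)\<^sup>2 * Bernstein n k (1 / 2)) / (2 * sqrt n) + Bernstein n k (1 / 2) * (sqrt n / 2))"
      using k by (simp add: u_def B algebra_simps)
  qed
  also have "\<dots> = 2 ^ n * (real n / (2 * sqrt n) + 1 * (sqrt n / 2))"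
    by (simp only: sum_distrib_left[symmetric] sum.distrib sum_divide_distrib[symmetric] sum_distrib_right[symmetric] var sum_Bernstein)
  also have "real n / (2 * sqrt n) = sqrt n / 2"
    using n by (simp add: field_simps)
  finally show ?thesis by (simp add: mult.commute)
qed

lemma multiplier_bound_sin_cos:
  assumes p: "1 < p"
  shows "multiplier_bound \<theta> p (\<lambda>m. \<i> * of_real (sin (h * of_int (m $ j)) * cos (h * of_int (m $ j)) ^ n)) (1 / sqrt (Suc n))"
proof -
  \<comment> \<open>The coefficients of \<open>binomial_first_moment\<close> divided by 2^(n + 1) (n
    + 1): the right side (n + 1) (2 i sin) (2 cos)^n becomes i sin cos^n, and the absolute sum is at
    most sqrt(n + 1) / (n + 1).\<close>
  define b where "b k = of_nat (Suc n choose k) * (2 * real k - real (Suc n)) / (2 ^ Suc n * real (Suc n))" for k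
  have "multiplier_bound \<theta> p (\<lambda>m. \<Sum>k\<le>Suc n. of_real (b k) * cis (h * (2 * real k - real (Suc n)) * of_int (m $ j)))
     (\<Sum>k\<le>Suc n. cmod (of_real (b k)) * 1)"
    by (intro multiplier_bound_sum[OF p] multiplier_bound_mult multiplier_bound_scale[OF p] multiplier_bound_gauge[OF p])
  moreover have "(\<Sum>k\<le>Suc n. of_real (b k) * cis (h * (2 * real k - real (Suc n)) * of_int (m $ j)))
      = \<i> * of_real (sin (h * of_int (m $ j)) * cos (h * of_int (m $ j)) ^ n)" for m :: "'a lattice"
  proof -
    define x where "x = h * of_int (m $ j)"
    have cis: "cis (h * (2 * real k - real (Suc n)) * of_int (m $ j)) = cis x ^ k * cis (- x) ^ (Suc n - k)" if "k \<le> Suc n" for k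
    proof -
      have eq: "real k * x + real (Suc n - k) * (- x) = h * (2 * real k - real (Suc n)) * of_int (m $ j)"
        using that by (simp add: x_def of_nat_diff algebra_simps del: of_nat_Suc)
      show ?thesis by (simp only: Complex.DeMoivre cis_mult eq)
    qed
    have "(\<Sum>k\<le>Suc n. of_real (b k) * cis (h * (2 * real k - real (Suc n)) * of_int (m $ j)))
        = (\<Sum>k\<le>Suc n. (1 / (2 ^ Suc n * of_nat (Suc n))) * (of_nat (Suc n choose k) * (2 * of_nat k - of_nat (Suc n)) * (cis x ^ k * cis (- x) ^ (Suc n - k))))"
      by (intro sum.cong) (simp_all add: cis b_def del: of_nat_Suc)
    also have "\<dots> = (1 / (2 ^ Suc n * of_nat (Suc n))) * (of_nat (Suc n) * (cis x - cis (- x)) * (cis x + cis (- x)) ^ n)"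
      unfolding sum_distrib_left[symmetric] binomial_first_moment ..
    also have "cis x - cis (- x) = 2 * \<i> * of_real (sin x)" by (simp add: complex_eq_iff)
    also have "cis x + cis (- x) = 2 * of_real (cos x)" by (simp add: complex_eq_iff)
    finally show ?thesis by (simp add: x_def[symmetric] power_mult_distrib del: of_nat_Suc)
  qed
  moreover have "(\<Sum>k\<le>Suc n. cmod (of_real (b k)) * 1) \<le> 1 / sqrt (Suc n)"
  proof -
    have "(\<Sum>k\<le>Suc n. cmod (of_real (b k)) * 1) = (\<Sum>k\<le>Suc n. real (Suc n choose k) * \<bar>2 * real k - real (Suc n)\<bar>) / (2 ^ Suc n * real (Suc n))"
      unfolding sum_divide_distrib norm_of_real by (intro sum.cong) (simp_all add: b_def abs_mult del: of_nat_Suc)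
    also have "\<dots> \<le> (sqrt (real (Suc n)) * 2 ^ Suc n) / (2 ^ Suc n * real (Suc n))"
      by (intro divide_right_mono binomial_abs_moment_le) auto
    also have "\<dots> = 1 / sqrt (Suc n)"
      by (simp add: field_simps del: of_nat_Suc)
    finally show ?thesis .
  qed
  ultimately show ?thesis using multiplier_bound_mono by fastforce
qed

text \<open>The prefactor 1 / h_n = sqrt(n + 1) / s compensates the bound 1 / sqrt(n + 1), so all
  approximants share the bound 1 / s. They are dominated by the modulus of \<open>m $ j\<close>
  because |sin(h x)| \<le> h |x|.\<close>

lemma multiplier_bound_deriv_heat:
  assumes p: "1 < p" and l: "0 < l"
  shows "multiplier_bound \<theta> p (\<lambda>m. \<i> * of_real (of_int (m $ j) * exp (- l * (of_int (m $ j))\<^sup>2))) (1 / sqrt (2 * l))"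
proof -
  define s where "s = sqrt (2 * l)"
  have s: "s > 0" using l by (simp add: s_def)
  define h where "h n = s / sqrt (real (Suc n))" for n :: nat
  have h: "h n > 0" for n using s by (simp add: h_def)
  define \<phi> where "\<phi> n m = of_real (1 / h n) * (\<i> * of_real (sin (h n * of_int (m $ j)) * cos (h n * of_int (m $ j)) ^ n))" for n and m :: "'a lattice"
  show ?thesis
  proof (rule multiplier_bound_limit[OF p, where \<phi> = \<phi> and g = "\<lambda>m. \<bar>of_int (m $ j)\<bar>"])
    show "multiplier_bound \<theta> p (\<phi> n) (1 / sqrt (2 * l))" for n
    proof -
      have "multiplier_bound \<theta> p (\<phi> n) (cmod (of_real (1 / h n)) * (1 / sqrt (Suc n)))"
        unfolding \<phi>_def by (intro multiplier_bound_mult multiplier_bound_scale[OF p] multiplier_bound_sin_cos[OF p])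
      moreover have "cmod (of_real (1 / h n)) * (1 / sqrt (Suc n)) = 1 / sqrt (2 * l)"
        using s by (simp add: h_def s_def[symmetric] norm_divide del: of_nat_Suc)
      ultimately show ?thesis by simp
    qed
    fix m :: "'a lattice"
    define x where "x = real_of_int (m $ j)"
    have "(\<lambda>n. (sin ((s * x) / sqrt (real (Suc n))) * sqrt (real (Suc n))) * (1 / s) * cos ((s * x) / sqrt (real (Suc n))) ^ n)
       \<longlonglongrightarrow> (s * x) * (1 / s) * exp (- (s * x)\<^sup>2 / 2)"
      by (intro tendsto_intros cos_power_limit sin_quotient_limit)
    moreover have "(s * x) * (1 / s) * exp (- (s * x)\<^sup>2 / 2) = x * exp (- l * x\<^sup>2)"
      using s l by (simp add: s_def power_mult_distrib)
    ultimately have lim: "(\<lambda>n. (sin ((s * x) / sqrt (real (Suc n))) * sqrt (real (Suc n))) * (1 / s) * cos ((s * x) / sqrt (real (Suc n))) ^ n)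
       \<longlonglongrightarrow> x * exp (- l * x\<^sup>2)" by simp
    have "\<phi> n m = \<i> * of_real ((sin ((s * x) / sqrt (real (Suc n))) * sqrt (real (Suc n))) * (1 / s) * cos ((s * x) / sqrt (real (Suc n))) ^ n)" for n
      by (simp add: \<phi>_def h_def x_def[symmetric] mult_ac del: of_nat_Suc)
    then show "(\<lambda>n. \<phi> n m) \<longlonglongrightarrow> \<i> * of_real (of_int (m $ j) * exp (- l * (of_int (m $ j))\<^sup>2))"
      unfolding x_def[symmetric] by (simp only:) (intro tendsto_mult tendsto_const tendsto_of_real lim)
    show "cmod (\<phi> n m) \<le> \<bar>of_int (m $ j)\<bar>" for n
    proof -
      have "cmod (\<phi> n m) = (\<bar>sin (h n * x)\<bar> / h n) * \<bar>cos (h n * x)\<bar> ^ n"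
        using h[of n] by (simp add: \<phi>_def norm_mult norm_divide norm_power x_def)
      also have "\<dots> \<le> (\<bar>sin (h n * x)\<bar> / h n) * 1"
        using h[of n] by (intro mult_left_mono power_le_one) auto
      also have "\<bar>sin (h n * x)\<bar> \<le> \<bar>h n * x\<bar>" by (rule abs_sin_x_le_abs_x)
      finally show ?thesis using h[of n] by (simp add: abs_mult divide_right_mono x_def)
    qed
  qed (use slowly_growing_coord[of j] in \<open>simp add: slowly_growing_def\<close>)
qed

section \<open>Smoothing estimates\<close>

lemma nc_deriv_series:
  "rapidly_decreasing c \<Longrightarrow>
    nc_deriv \<theta> j (nc_series \<theta> c) = nc_series \<theta> (\<lambda>m. 2 * pi * \<i> * of_int (m $ j) * c m)"
  by (simp add: nc_deriv_def coeff_series)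

lemma heat_series:
  "rapidly_decreasing c \<Longrightarrow>
    heat \<theta> t (nc_series \<theta> c) = nc_series \<theta> (\<lambda>m. of_real (exp (- 4 * pi\<^sup>2 * int_norm_sq m * t)) * c m)"
  by (simp add: heat_def coeff_series)

lemma slowly_growing_deriv: "slowly_growing (\<lambda>m. 2 * pi * \<i> * of_int (m $ j))"
  by (intro slowly_growing_mult slowly_growing_coord slowly_growing_bounded[of _ "cmod (2 * pi * \<i>)"]) auto

lemma slowly_growing_heat: "0 \<le> t \<Longrightarrow> slowly_growing (\<lambda>m. of_real (exp (- 4 * pi\<^sup>2 * int_norm_sq m * t)))"
  by (rule slowly_growing_bounded[of _ 1]) simp

section \<open>Symbols of higher derivatives under the heat semigroup\<close>

definition deriv_symbol :: "'n::finite multiindex \<Rightarrow> 'n lattice \<Rightarrow> complex" where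
  "deriv_symbol \<alpha> m = (\<Prod>j\<in>UNIV. (2 * pi * \<i> * of_int (m $ j)) ^ (\<alpha> $ j))"

lemma slowly_growing_deriv_symbol: "slowly_growing (deriv_symbol \<alpha>)"
  unfolding deriv_symbol_def[abs_def] by (intro slowly_growing_prod slowly_growing_power slowly_growing_deriv)

lemma deriv_symbol_add: "deriv_symbol (\<alpha> + \<beta>) m = deriv_symbol \<alpha> m * deriv_symbol \<beta> m"
  by (simp add: deriv_symbol_def power_add prod.distrib)

lemma nc_deriv_multi_series:
  assumes c: "rapidly_decreasing c"
  shows "nc_deriv_multi \<theta> \<alpha> (nc_series \<theta> c) = nc_series \<theta> (\<lambda>m. deriv_symbol \<alpha> m * c m)"
proof -
  let ?d = "\<lambda>j m. 2 * pi * \<i> * of_int (m $ j) :: complex"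
  have pow: "(nc_deriv \<theta> j ^^ k) (nc_series \<theta> c) = nc_series \<theta> (\<lambda>m. ?d j m ^ k * c m)"
    if "rapidly_decreasing c" for j k c
  proof (induction k)
    case (Suc k)
    have "rapidly_decreasing (\<lambda>m. ?d j m ^ k * c m)"
      by (intro rapidly_decreasing_mult slowly_growing_power slowly_growing_deriv that)
    then show ?case by (simp add: Suc nc_deriv_series mult.assoc)
  qed simp
  have "foldr (\<lambda>j. nc_deriv \<theta> j ^^ (\<alpha> $ j)) xs (nc_series \<theta> c)
      = nc_series \<theta> (\<lambda>m. (\<Prod>j\<in>set xs. ?d j m ^ (\<alpha> $ j)) * c m)" if "distinct xs" for xs
    using that
  proof (induction xs)
    case (Cons j xs)
    have "rapidly_decreasing (\<lambda>m. (\<Prod>j\<in>set xs. ?d j m ^ (\<alpha> $ j)) * c m)"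
      by (intro rapidly_decreasing_mult slowly_growing_prod slowly_growing_power slowly_growing_deriv c)
    with Cons show ?case by (simp add: pow mult.assoc)
  qed simp
  from this[of "sorted_list_of_set UNIV"] show ?thesis
    by (simp add: nc_deriv_multi_def deriv_symbol_def)
qed

text \<open>Each of the k equal Gaussian factors contributes sqrt(k / (2 t)), the powers of \<pi>
  cancelling. Bounding k by r, which will be the total order, gives all directions a common base, so
  that their exponents simply add up.\<close>

lemma multiplier_bound_direction:
  assumes p: "1 < p" and t: "0 < t" and k: "k \<le> r"
  shows "multiplier_bound \<theta> p
    (\<lambda>m. (2 * pi * \<i> * of_int (m $ j)) ^ k * of_real (exp (- (4 * pi\<^sup>2 * t) * (of_int (m $ j))\<^sup>2))) (sqrt (r / t) ^ k)"
proof (cases "k = 0")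
  case True
  then show ?thesis using multiplier_bound_heat[OF p, of "4 * pi\<^sup>2 * t" \<theta> j] t by simp
next
  case False
  define l where "l = 4 * pi\<^sup>2 * t / k"
  have l: "0 < l" using t False by (simp add: l_def)
  have "multiplier_bound \<theta> p
      (\<lambda>m. (of_real (2 * pi) * (\<i> * of_real (of_int (m $ j) * exp (- l * (of_int (m $ j))\<^sup>2)))) ^ k)
      ((cmod (of_real (2 * pi)) * (1 / sqrt (2 * l))) ^ k)"
    by (intro multiplier_bound_power[OF p] multiplier_bound_mult multiplier_bound_scale[OF p] multiplier_bound_deriv_heat[OF p l])
  moreover have "(of_real (2 * pi) * (\<i> * of_real (of_int (m $ j) * exp (- l * (of_int (m $ j))\<^sup>2)))) ^ k
      = (2 * pi * \<i> * of_int (m $ j)) ^ k * of_real (exp (- (4 * pi\<^sup>2 * t) * (of_int (m $ j))\<^sup>2))" for m :: "'a lattice"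
  proof -
    have "- (4 * pi\<^sup>2 * t) * (of_int (m $ j))\<^sup>2 = real k * (- l * (of_int (m $ j))\<^sup>2)"
      using False by (simp add: l_def)
    then have "exp (- (4 * pi\<^sup>2 * t) * (of_int (m $ j))\<^sup>2) = exp (- l * (of_int (m $ j))\<^sup>2) ^ k"
      by (simp only: exp_of_nat_mult)
    then show ?thesis by (simp add: power_mult_distrib mult_ac)
  qed
  moreover have "(cmod (of_real (2 * pi)) * (1 / sqrt (2 * l))) ^ k \<le> sqrt (r / t) ^ k"
  proof (rule power_mono)
    have "cmod (of_real (2 * pi)) * (1 / sqrt (2 * l)) = sqrt ((2 * pi)\<^sup>2 / (2 * l))"
      unfolding real_sqrt_divide real_sqrt_abs by simp
    also have "(2 * pi)\<^sup>2 / (2 * l) = k / (2 * t)"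
      using t False by (simp add: l_def power_mult_distrib field_simps)
    also have "sqrt (k / (2 * t)) \<le> sqrt (r / t)"
      using t k by (intro real_sqrt_le_mono frac_le) auto
    finally show "cmod (of_real (2 * pi)) * (1 / sqrt (2 * l)) \<le> sqrt (r / t)" .
  qed (use l in simp)
  ultimately show ?thesis using multiplier_bound_mono by (simp only:)
qed

lemma multiplier_bound_deriv_symbol_heat:
  fixes \<gamma> :: "'n::{finite,linorder} multiindex"
  assumes p: "1 < p" and t: "0 < t" and \<gamma>: "(\<Sum>j\<in>UNIV. \<gamma> $ j) = r"
  shows "multiplier_bound \<theta> p (\<lambda>m. deriv_symbol \<gamma> m * of_real (exp (- 4 * pi\<^sup>2 * int_norm_sq m * t))) (sqrt (r / t) ^ r)"
proof -
  have "multiplier_bound \<theta> p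
    (\<lambda>m. \<Prod>j\<in>UNIV. (2 * pi * \<i> * of_int (m $ j)) ^ (\<gamma> $ j) * of_real (exp (- (4 * pi\<^sup>2 * t) * (of_int (m $ j))\<^sup>2)))
    (\<Prod>j\<in>UNIV. sqrt (r / t) ^ (\<gamma> $ j))"
    by (intro multiplier_bound_prod[OF p] multiplier_bound_direction[OF p t])
      (auto simp: \<gamma>[symmetric] intro: member_le_sum)
  moreover have "(\<Prod>j\<in>UNIV. of_real (exp (- (4 * pi\<^sup>2 * t) * (of_int (m $ j))\<^sup>2)))
      = complex_of_real (exp (- 4 * pi\<^sup>2 * int_norm_sq m * t))" for m :: "'n lattice"
    unfolding of_real_prod[symmetric] exp_sum[symmetric, OF finite_class.finite_UNIV]
    by (simp add: int_norm_sq_def sum_distrib_left sum_distrib_right sum_negf mult_ac)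
  ultimately show ?thesis
    by (simp add: deriv_symbol_def prod.distrib power_sum[symmetric] \<gamma>)
qed

text \<open>Of the k + r derivatives, k stay on a and r are spent on the heat factor.\<close>

lemma multiindex_split:
  fixes \<beta> :: "'n::finite multiindex"
  assumes "(\<Sum>j\<in>UNIV. \<beta> $ j) = k + r"
  shows "\<exists>\<alpha> \<gamma>. \<beta> = \<alpha> + \<gamma> \<and> (\<Sum>j\<in>UNIV. \<alpha> $ j) = k \<and> (\<Sum>j\<in>UNIV. \<gamma> $ j) = r"
  using assms
proof (induction r arbitrary: \<beta>)
  case 0
  then show ?case by (intro exI[of _ \<beta>] exI[of _ 0]) simp
next
  case (Suc r)
  then obtain j where j: "\<beta> $ j > 0" by (metis add_Suc_right gr0I nat.distinct(1) sum.neutral)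
  define \<beta>' where "\<beta>' = (\<chi> i. if i = j then \<beta> $ i - 1 else \<beta> $ i)"
  have \<beta>: "\<beta> = \<beta>' + axis j 1" using j by (auto simp: \<beta>'_def vec_eq_iff axis_def)
  have ax: "(\<Sum>i\<in>UNIV. axis j (1::nat) $ i) = 1" by (simp add: axis_def)
  have "(\<Sum>i\<in>UNIV. \<beta>' $ i) = k + r"
    using Suc.prems ax by (simp add: \<beta> sum.distrib)
  from Suc.IH[OF this] obtain \<alpha> \<gamma> where *: "\<beta>' = \<alpha> + \<gamma>" "(\<Sum>j\<in>UNIV. \<alpha> $ j) = k" "(\<Sum>j\<in>UNIV. \<gamma> $ j) = r"
    by blast
  then show ?case
    using ax by (intro exI[of _ \<alpha>] exI[of _ "\<gamma> + axis j 1"]) (simp add: \<beta> sum.distrib add.assoc)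
qed

lemma finite_multiindex: "finite {\<alpha> :: 'n::finite multiindex. (\<Sum>j\<in>UNIV. \<alpha> $ j) = k}"
proof (rule finite_subset)
  show "{\<alpha> :: 'n multiindex. (\<Sum>j\<in>UNIV. \<alpha> $ j) = k} \<subseteq> vec_lambda ` (Pi\<^sub>E UNIV (\<lambda>_. {..k}))"
  proof
    fix \<alpha> :: "'n multiindex" assume "\<alpha> \<in> {\<alpha>. (\<Sum>j\<in>UNIV. \<alpha> $ j) = k}"
    then have "\<alpha> $ j \<le> k" for j using member_le_sum[of j UNIV "\<lambda>j. \<alpha> $ j"] by simp
    then have "vec_nth \<alpha> \<in> Pi\<^sub>E UNIV (\<lambda>_. {..k})" by auto
    then show "\<alpha> \<in> vec_lambda ` (Pi\<^sub>E UNIV (\<lambda>_. {..k}))" by (rule rev_image_eqI) simp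
  qed
qed (auto intro!: finite_imageI finite_PiE)

section \<open>Smoothing in Sobolev seminorms and norms\<close>

lemma sobolev_seminorm_L2:
  "sobolev_seminorm \<theta> k p a = L2_set (\<lambda>\<alpha>. Lp_norm \<theta> p (nc_deriv_multi \<theta> \<alpha> a)) {\<alpha>. (\<Sum>j\<in>UNIV. \<alpha> $ j) = k}"
  by (simp add: sobolev_seminorm_def L2_set_def)

lemma sobolev_seminorm_nonneg: "0 \<le> sobolev_seminorm \<theta> k p a"
  by (simp add: sobolev_seminorm_L2 L2_set_nonneg)

text \<open>\<open>sqrt r ^ r\<close> is the multiplier bound at t = 1, the cardinality comes from
  the l^2 sum over multi-indices of order k + r, and the summand 1 makes positivity immediate. The
  type argument carries the dimension.\<close>

definition smoothing_const :: "'n::finite itself \<Rightarrow> nat \<Rightarrow> nat \<Rightarrow> real" where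
  "smoothing_const _ k r = 1 + sqrt r ^ r * sqrt (card {\<beta> :: 'n multiindex. (\<Sum>j\<in>UNIV. \<beta> $ j) = k + r})"

lemma smoothing_const_pos: "0 < smoothing_const TYPE('n::finite) k r"
  by (simp add: smoothing_const_def add_pos_nonneg)

lemma sobolev_seminorm_heat:
  fixes \<theta> :: "'n::{finite,linorder} rmatrix"
  assumes p: "1 < p" and t: "0 < t" and a: "a \<in> smooth_alg \<theta>"
  shows "sobolev_seminorm \<theta> (k + r) p (heat \<theta> t a)
    \<le> smoothing_const TYPE('n) k r / t powr (real r / 2) * sobolev_seminorm \<theta> k p a"
proof -
  obtain c where a: "a = nc_series \<theta> c" and c: "rapidly_decreasing c"
    using a by (auto simp: smooth_alg_def)
  let ?e = "\<lambda>m. complex_of_real (exp (- 4 * pi\<^sup>2 * int_norm_sq m * t))"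
  let ?S = "sobolev_seminorm \<theta> k p a"
  let ?I = "{\<beta> :: 'n multiindex. (\<Sum>j\<in>UNIV. \<beta> $ j) = k + r}"
  have e: "slowly_growing ?e"
    using t by (intro slowly_growing_heat) simp
  have each: "Lp_norm \<theta> p (nc_deriv_multi \<theta> \<beta> (heat \<theta> t a)) \<le> sqrt (r / t) ^ r * ?S" if \<beta>: "\<beta> \<in> ?I" for \<beta>
  proof -
    obtain \<alpha> \<gamma> where split: "\<beta> = \<alpha> + \<gamma>" "(\<Sum>j\<in>UNIV. \<alpha> $ j) = k" "(\<Sum>j\<in>UNIV. \<gamma> $ j) = r"
      using multiindex_split[of \<beta> k r] \<beta> by auto
    have "nc_deriv_multi \<theta> \<beta> (heat \<theta> t a) = nc_series \<theta> (\<lambda>m. (deriv_symbol \<gamma> m * ?e m) * (deriv_symbol \<alpha> m * c m))"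
      unfolding a heat_series[OF c] nc_deriv_multi_series[OF rapidly_decreasing_mult[OF e c]] split(1) deriv_symbol_add
      by (simp only: mult_ac)
    moreover have "rapidly_decreasing (\<lambda>m. deriv_symbol \<alpha> m * c m)"
      by (intro rapidly_decreasing_mult slowly_growing_deriv_symbol c)
    ultimately have "Lp_norm \<theta> p (nc_deriv_multi \<theta> \<beta> (heat \<theta> t a))
        \<le> sqrt (r / t) ^ r * Lp_norm \<theta> p (nc_deriv_multi \<theta> \<alpha> a)"
      using multiplier_bound_deriv_symbol_heat[OF p t split(3), of \<theta>]
      by (simp add: multiplier_bound_def a nc_deriv_multi_series[OF c])
    also have "\<dots> \<le> sqrt (r / t) ^ r * ?S"
      unfolding sobolev_seminorm_L2 using t split(2) by (intro mult_left_mono member_le_L2_set finite_multiindex) auto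
    finally show ?thesis .
  qed
  have "sobolev_seminorm \<theta> (k + r) p (heat \<theta> t a) \<le> L2_set (\<lambda>\<beta>. sqrt (r / t) ^ r * ?S) ?I"
    unfolding sobolev_seminorm_L2[of \<theta> "k + r"] using each by (intro L2_set_mono) (auto simp: Lp_norm_nonneg)
  also have "\<dots> = sqrt (card ?I) * (sqrt (r / t) ^ r * ?S)"
    using t by (simp add: L2_set_constant sobolev_seminorm_nonneg)
  also have "sqrt (r / t) ^ r = sqrt r ^ r / t powr (real r / 2)"
  proof -
    have "t powr (real r / 2) = (t powr (1 / 2)) powr real r" by (simp add: powr_powr)
    also have "\<dots> = sqrt t ^ r" using t by (simp add: powr_half_sqrt powr_realpow)
    finally show ?thesis by (simp add: real_sqrt_divide power_divide)
  qed
  also have "sqrt (card ?I) * (sqrt r ^ r / t powr (real r / 2) * ?S) = (sqrt r ^ r * sqrt (card ?I)) / t powr (real r / 2) * ?S"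
    by simp
  also have "\<dots> \<le> smoothing_const TYPE('n) k r / t powr (real r / 2) * ?S"
    unfolding smoothing_const_def by (intro mult_right_mono divide_right_mono) (auto simp: sobolev_seminorm_nonneg)
  finally show ?thesis .
qed

lemma sobolev_norm_nonneg: "0 \<le> sobolev_norm \<theta> k p a"
  by (simp add: sobolev_norm_def sum_nonneg sobolev_seminorm_nonneg)

lemma sobolev_seminorm_le_norm: "j \<le> k \<Longrightarrow> sobolev_seminorm \<theta> j p a \<le> sobolev_norm \<theta> k p a"
  unfolding sobolev_norm_def by (rule member_le_sum) (auto simp: sobolev_seminorm_nonneg)

text \<open>Orders up to k are estimated without gain of derivatives, orders k + i by t^(-i/2) \<le>
  1 + t^(-r/2). The latter holds for t \<le> 1 by monotonicity in the exponent and for t > 1 because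
  the left side is at most 1.\<close>

lemma sobolev_norm_heat:
  fixes \<theta> :: "'n::{finite,linorder} rmatrix"
  assumes p: "1 < p" and t: "0 < t" and a: "a \<in> smooth_alg \<theta>"
  shows "sobolev_norm \<theta> (k + r) p (heat \<theta> t a)
    \<le> ((\<Sum>j\<le>k. smoothing_const TYPE('n) j 0) + (\<Sum>i\<le>r. smoothing_const TYPE('n) k i))
        * (1 + t powr (- real r / 2)) * sobolev_norm \<theta> k p a"
proof -
  let ?c = "smoothing_const TYPE('n)" and ?T = "1 + t powr (- real r / 2)" and ?N = "sobolev_norm \<theta> k p a"
  let ?h = "\<lambda>j. sobolev_seminorm \<theta> j p (heat \<theta> t a)"
  have c0: "0 \<le> ?c j i" for j i using smoothing_const_pos less_imp_le by blast
  have low: "?h j \<le> ?c j 0 * ?T * ?N" if "j \<le> k" for j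
  proof -
    have "?h j \<le> ?c j 0 / t powr 0 * sobolev_seminorm \<theta> j p a"
      using sobolev_seminorm_heat[OF p t a, of j 0] by simp
    also have "\<dots> \<le> ?c j 0 * ?N"
      using t that by (simp add: c0 mult_left_mono sobolev_seminorm_le_norm)
    also have "\<dots> \<le> (?c j 0 * ?T) * ?N"
      using mult_left_mono[of 1 ?T "?c j 0"] c0 by (intro mult_right_mono sobolev_norm_nonneg) simp
    finally show ?thesis .
  qed
  have high: "?h (k + i) \<le> ?c k i * ?T * ?N" if "i \<le> r" for i
  proof -
    have "1 / t powr (real i / 2) \<le> ?T"
    proof (cases "t \<le> 1")
      case True
      have "t powr (- real i / 2) \<le> t powr (- real r / 2)"
        using True t that by (intro powr_mono') auto
      then show ?thesis by (simp add: powr_minus_divide[symmetric])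
    next
      case False
      then have "1 \<le> t powr (real i / 2)" by (intro ge_one_powr_ge_zero) auto
      then have "1 / t powr (real i / 2) \<le> 1" by (simp add: divide_simps)
      also have "1 \<le> ?T" by simp
      finally show ?thesis .
    qed
    then have "?c k i * (1 / t powr (real i / 2)) * sobolev_seminorm \<theta> k p a \<le> ?c k i * ?T * ?N"
      by (intro mult_mono) (auto simp: c0 sobolev_seminorm_nonneg sobolev_norm_nonneg intro: sobolev_seminorm_le_norm)
    then show ?thesis
      using sobolev_seminorm_heat[OF p t a, of k i] by simp
  qed
  \<comment> \<open>Order k is counted in both sums, which only enlarges the bound.\<close>
  have "sobolev_norm \<theta> (k + r) p (heat \<theta> t a) \<le> (\<Sum>j\<le>k. ?h j) + (\<Sum>i\<le>r. ?h (k + i))"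
  proof -
    have "(\<Sum>i\<le>r. ?h (k + i)) = sum ?h {k..k + r}"
      by (rule sum.reindex_bij_witness[of _ "\<lambda>j. j - k" "\<lambda>i. k + i"]) auto
    moreover have "sum ?h {..k + r} \<le> sum ?h {..k} + sum ?h {k..k + r}"
    proof -
      have "{..k + r} = {..k} \<union> {k<..k + r}" by auto
      then have "sum ?h {..k + r} = sum ?h {..k} + sum ?h {k<..k + r}"
        by (simp only:) (rule sum.union_disjoint; auto)
      also have "sum ?h {k<..k + r} \<le> sum ?h {k..k + r}"
        by (rule sum_mono2) (auto simp: sobolev_seminorm_nonneg)
      finally show ?thesis by simp
    qed
    ultimately show ?thesis by (simp add: sobolev_norm_def)
  qed
  also have "\<dots> \<le> (\<Sum>j\<le>k. ?c j 0 * ?T * ?N) + (\<Sum>i\<le>r. ?c k i * ?T * ?N)"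
    by (intro add_mono sum_mono low high) auto
  also have "\<dots> = ((\<Sum>j\<le>k. ?c j 0) + (\<Sum>i\<le>r. ?c k i)) * ?T * ?N"
    by (simp only: sum_distrib_right[symmetric] distrib_right)
  finally show ?thesis .
qed

section \<open>Extension to completions\<close>

locale seminormed_space =
  fixes V :: "'a op set" and N :: "'a op \<Rightarrow> real"
  assumes add_closed: "x \<in> V \<Longrightarrow> y \<in> V \<Longrightarrow> x + y \<in> V"
    and scale_closed: "x \<in> V \<Longrightarrow> op_scaleC z x \<in> V"
    and triangle: "x \<in> V \<Longrightarrow> y \<in> V \<Longrightarrow> N (x + y) \<le> N x + N y"
    and homogeneous: "x \<in> V \<Longrightarrow> N (op_scaleC z x) = cmod z * N x"
begin

lemma minus_closed: "x \<in> V \<Longrightarrow> - x \<in> V"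
  unfolding uminus_op_scaleC by (rule scale_closed)

lemma diff_closed: "x \<in> V \<Longrightarrow> y \<in> V \<Longrightarrow> x - y \<in> V"
  using add_closed[of x "- y"] minus_closed[of y] by simp

lemma N_minus: "x \<in> V \<Longrightarrow> N (- x) = N x"
  unfolding uminus_op_scaleC by (simp add: homogeneous)

lemma N_minus_commute: "x \<in> V \<Longrightarrow> y \<in> V \<Longrightarrow> N (x - y) = N (y - x)"
  using N_minus[of "x - y"] diff_closed[of x y] by simp

lemma N_zero: "x \<in> V \<Longrightarrow> N 0 = 0"
  using homogeneous[of x 0] by simp

lemma N_nonneg: "x \<in> V \<Longrightarrow> 0 \<le> N x"
  using triangle[of x "- x"] minus_closed[of x] N_minus[of x] N_zero[of x] by simp

lemma N_diff_triangle: "x \<in> V \<Longrightarrow> y \<in> V \<Longrightarrow> z \<in> V \<Longrightarrow> N (x - z) \<le> N (x - y) + N (y - z)"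
  using triangle[of "x - y" "y - z"] by (simp add: diff_closed)

lemma N_diff_abs: "x \<in> V \<Longrightarrow> y \<in> V \<Longrightarrow> \<bar>N x - N y\<bar> \<le> N (x - y)"
  using triangle[of "x - y" y] triangle[of "y - x" x] N_minus_commute[of x y] by (simp add: diff_closed)

lemma cauchy_seqs_V: "x \<in> cauchy_seqs V N \<Longrightarrow> x i \<in> V"
  by (auto simp: cauchy_seqs_def)

lemma cauchy_seqsD:
  "x \<in> cauchy_seqs V N \<Longrightarrow> 0 < e \<Longrightarrow> \<exists>M. \<forall>i\<ge>M. \<forall>j\<ge>M. N (x i - x j) < e"
  by (simp add: cauchy_seqs_def)

lemma cauchy_seqs_const: "a \<in> V \<Longrightarrow> (\<lambda>_. a) \<in> cauchy_seqs V N"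
  using N_zero[of a] by (auto simp: cauchy_seqs_def)

lemma cauchy_seqs_add:
  assumes x: "x \<in> cauchy_seqs V N" and y: "y \<in> cauchy_seqs V N"
  shows "(\<lambda>i. x i + y i) \<in> cauchy_seqs V N"
  unfolding cauchy_seqs_def
proof (intro CollectI conjI allI impI)
  show "range (\<lambda>i. x i + y i) \<subseteq> V" using x y by (auto intro: add_closed cauchy_seqs_V)
  fix e :: real assume "0 < e"
  then obtain M1 M2 where M1: "\<And>i j. i \<ge> M1 \<Longrightarrow> j \<ge> M1 \<Longrightarrow> N (x i - x j) < e / 2"
    and M2: "\<And>i j. i \<ge> M2 \<Longrightarrow> j \<ge> M2 \<Longrightarrow> N (y i - y j) < e / 2"
    using cauchy_seqsD[OF x, of "e / 2"] cauchy_seqsD[OF y, of "e / 2"] by (meson half_gt_zero)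
  have "N ((x i + y i) - (x j + y j)) < e" if "i \<ge> max M1 M2" "j \<ge> max M1 M2" for i j
  proof -
    have "N ((x i + y i) - (x j + y j)) \<le> N (x i - x j) + N (y i - y j)"
      unfolding add_diff_add using x y by (intro triangle diff_closed cauchy_seqs_V)
    then show ?thesis using M1[of i j] M2[of i j] that by simp
  qed
  then show "\<exists>M. \<forall>i\<ge>M. \<forall>j\<ge>M. N ((x i + y i) - (x j + y j)) < e" by blast
qed

lemma cauchy_seqs_scale:
  assumes x: "x \<in> cauchy_seqs V N"
  shows "(\<lambda>i. op_scaleC z (x i)) \<in> cauchy_seqs V N"
  unfolding cauchy_seqs_def
proof (intro CollectI conjI allI impI)
  show "range (\<lambda>i. op_scaleC z (x i)) \<subseteq> V" using x by (auto intro: scale_closed cauchy_seqs_V)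
  fix e :: real assume "0 < e"
  then have "0 < e / (cmod z + 1)" by (simp add: add_nonneg_pos)
  then obtain M where M: "\<And>i j. i \<ge> M \<Longrightarrow> j \<ge> M \<Longrightarrow> N (x i - x j) < e / (cmod z + 1)"
    using cauchy_seqsD[OF x] by meson
  have "N (op_scaleC z (x i) - op_scaleC z (x j)) < e" if "i \<ge> M" "j \<ge> M" for i j
  proof -
    have "N (op_scaleC z (x i) - op_scaleC z (x j)) = cmod z * N (x i - x j)"
      unfolding op_scaleC_diff[symmetric] using x by (intro homogeneous diff_closed cauchy_seqs_V)
    also have "\<dots> \<le> (cmod z + 1) * N (x i - x j)"
      using x by (intro mult_right_mono N_nonneg diff_closed cauchy_seqs_V) auto
    also have "\<dots> < e" using M[OF that] add_nonneg_pos[OF norm_ge_zero[of z] zero_less_one]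
      by (simp only: pos_less_divide_eq mult.commute)
    finally show ?thesis .
  qed
  then show "\<exists>M. \<forall>i\<ge>M. \<forall>j\<ge>M. N (op_scaleC z (x i) - op_scaleC z (x j)) < e" by blast
qed

lemma null_rel_iff:
  "(x, y) \<in> null_rel V N \<longleftrightarrow> x \<in> cauchy_seqs V N \<and> y \<in> cauchy_seqs V N \<and> (\<lambda>i. N (x i - y i)) \<longlonglongrightarrow> 0"
  by (simp add: null_rel_def)

lemma null_relI:
  assumes "x \<in> cauchy_seqs V N" "y \<in> cauchy_seqs V N" "\<And>i. N (x i - y i) \<le> f i" "f \<longlonglongrightarrow> 0"
  shows "(x, y) \<in> null_rel V N"
proof -
  have "0 \<le> N (x i - y i)" for i using assms by (intro N_nonneg diff_closed cauchy_seqs_V)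
  then have "(\<lambda>i. N (x i - y i)) \<longlonglongrightarrow> 0"
    by (intro Lim_null_comparison[OF _ assms(4)]) (use assms(3) in auto)
  then show ?thesis using assms by (simp add: null_rel_iff)
qed

lemma equiv_null_rel: "equiv (cauchy_seqs V N) (null_rel V N)"
proof (rule equivI)
  show "null_rel V N \<subseteq> cauchy_seqs V N \<times> cauchy_seqs V N" by (auto simp: null_rel_def)
  show "refl_on (cauchy_seqs V N) (null_rel V N)"
    by (rule refl_onI) (use N_zero cauchy_seqs_V in \<open>fastforce simp: null_rel_iff\<close>)
  show "sym (null_rel V N)"
    by (rule symI) (auto simp: null_rel_iff cauchy_seqs_V N_minus_commute)
  show "trans (null_rel V N)"
  proof (rule transI)
    fix x y z assume xy: "(x, y) \<in> null_rel V N" and yz: "(y, z) \<in> null_rel V N"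
    show "(x, z) \<in> null_rel V N"
    proof (rule null_relI)
      show "(\<lambda>i. N (x i - y i) + N (y i - z i)) \<longlonglongrightarrow> 0"
        using tendsto_add[of "\<lambda>i. N (x i - y i)" 0] xy yz by (fastforce simp: null_rel_iff)
    qed (use xy yz in \<open>auto simp: null_rel_iff intro!: N_diff_triangle cauchy_seqs_V\<close>)
  qed
qed

section \<open>Equivalence classes, their operations and their norm\<close>

abbreviation cls :: "(nat \<Rightarrow> 'a op) \<Rightarrow> (nat \<Rightarrow> 'a op) set" where
  "cls x \<equiv> null_rel V N `` {x}"

text \<open>Operations on the completion are defined through all representatives at once; this
  evaluates them on a single one.\<close>

lemma Image_null_rel_eq:
  assumes "A \<subseteq> cls x" "A \<noteq> {}"
  shows "null_rel V N `` A = cls x"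
proof -
  have "cls u = cls x" if "u \<in> A" for u
    using that assms equiv_class_eq[OF equiv_null_rel, of x u] by auto
  moreover have "null_rel V N `` A = (\<Union>u\<in>A. cls u)" by auto
  ultimately show ?thesis using assms(2) by auto
qed

lemma cls_self: "x \<in> cauchy_seqs V N \<Longrightarrow> x \<in> cls x"
  by (rule equiv_class_self[OF equiv_null_rel])

lemma completion_cls: "x \<in> cauchy_seqs V N \<Longrightarrow> cls x \<in> completion V N"
  unfolding completion_def by (rule quotientI)

lemma completion_cases:
  assumes "X \<in> completion V N"
  obtains x where "x \<in> cauchy_seqs V N" "X = cls x"
  using assms unfolding completion_def by (rule quotientE)

lemma compl_add_cls:
  assumes "x \<in> cauchy_seqs V N" "y \<in> cauchy_seqs V N"
  shows "compl_add V N (cls x) (cls y) = cls (\<lambda>i. x i + y i)"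
  unfolding compl_add_def
proof (rule Image_null_rel_eq)
  show "{\<lambda>i. u i + v i |u v. u \<in> cls x \<and> v \<in> cls y} \<subseteq> cls (\<lambda>i. x i + y i)"
  proof clarsimp
    fix u v assume u: "(x, u) \<in> null_rel V N" and v: "(y, v) \<in> null_rel V N"
    show "(\<lambda>i. x i + y i, \<lambda>i. u i + v i) \<in> null_rel V N"
    proof (rule null_relI)
      show "(\<lambda>i. N (x i - u i) + N (y i - v i)) \<longlonglongrightarrow> 0"
        using tendsto_add[of "\<lambda>i. N (x i - u i)" 0] u v by (fastforce simp: null_rel_iff)
      show "N ((x i + y i) - (u i + v i)) \<le> N (x i - u i) + N (y i - v i)" for i
        unfolding add_diff_add using u v by (intro triangle diff_closed cauchy_seqs_V) (auto simp: null_rel_iff)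
    qed (use u v in \<open>auto simp: null_rel_iff intro: cauchy_seqs_add\<close>)
  qed
qed (use assms cls_self in blast)

lemma compl_scale_cls:
  assumes "x \<in> cauchy_seqs V N"
  shows "compl_scale V N z (cls x) = cls (\<lambda>i. op_scaleC z (x i))"
  unfolding compl_scale_def
proof (rule Image_null_rel_eq)
  show "{\<lambda>i. op_scaleC z (u i) |u. u \<in> cls x} \<subseteq> cls (\<lambda>i. op_scaleC z (x i))"
  proof clarsimp
    fix u assume u: "(x, u) \<in> null_rel V N"
    show "(\<lambda>i. op_scaleC z (x i), \<lambda>i. op_scaleC z (u i)) \<in> null_rel V N"
    proof (rule null_relI)
      show "(\<lambda>i. cmod z * N (x i - u i)) \<longlonglongrightarrow> 0"
        using u by (auto simp: null_rel_iff intro: tendsto_mult_right_zero)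
      show "N (op_scaleC z (x i) - op_scaleC z (u i)) \<le> cmod z * N (x i - u i)" for i
        unfolding op_scaleC_diff[symmetric] using u
        by (intro eq_refl homogeneous diff_closed cauchy_seqs_V) (auto simp: null_rel_iff)
    qed (use u in \<open>auto simp: null_rel_iff intro: cauchy_seqs_scale\<close>)
  qed
qed (use assms cls_self in blast)

text \<open>The content is that the definite description in \<open>compl_norm\<close> denotes: by
  the reverse triangle inequality the norms along a Cauchy sequence converge, and equivalent
  sequences give the same limit.\<close>

lemma compl_norm_cls:
  assumes x: "x \<in> cauchy_seqs V N"
  shows "(\<lambda>i. N (x i)) \<longlonglongrightarrow> compl_norm N (cls x)"
proof -
  have "Cauchy (\<lambda>i. N (x i))"
  proof (rule metric_CauchyI)
    fix e :: real assume "0 < e"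
    then obtain M where M: "\<And>i j. i \<ge> M \<Longrightarrow> j \<ge> M \<Longrightarrow> N (x i - x j) < e"
      using cauchy_seqsD[OF x] by meson
    then have "dist (N (x i)) (N (x j)) < e" if "i \<ge> M" "j \<ge> M" for i j
      using N_diff_abs[of "x i" "x j"] cauchy_seqs_V[OF x] M[OF that] by (simp add: dist_real_def)
    then show "\<exists>M. \<forall>m\<ge>M. \<forall>n\<ge>M. dist (N (x m)) (N (x n)) < e" by blast
  qed
  then obtain L where L: "(\<lambda>i. N (x i)) \<longlonglongrightarrow> L"
    using Cauchy_convergent convergent_def by blast
  have all: "(\<lambda>i. N (u i)) \<longlonglongrightarrow> L" if u: "u \<in> cls x" for u
  proof -
    have n: "(\<lambda>i. N (x i - u i)) \<longlonglongrightarrow> 0" and uc: "u \<in> cauchy_seqs V N" using u by (auto simp: null_rel_iff)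
    have "(\<lambda>i. N (x i) - N (u i)) \<longlonglongrightarrow> 0"
      by (rule Lim_null_comparison[OF _ n]) (use N_diff_abs cauchy_seqs_V[OF x] cauchy_seqs_V[OF uc] in auto)
    from tendsto_diff[OF L this] show ?thesis by simp
  qed
  have "compl_norm N (cls x) = L"
    unfolding compl_norm_def
    by (rule the_equality) (use all cls_self[OF x] L LIMSEQ_unique in blast)+
  with L show ?thesis by simp
qed

end

text \<open>A bounded linear map preserves Cauchy sequences and null sequences. T is the image of
  all representatives, so no choice is made, and \<open>Image_null_rel_eq\<close> computes it from
  any one of them.\<close>

lemma completion_extension:
  fixes V :: "'a op set"
  assumes "seminormed_space V N" and "seminormed_space V N'"
    and S: "\<And>x. x \<in> V \<Longrightarrow> S x \<in> V"
    and S_add: "\<And>x y. x \<in> V \<Longrightarrow> y \<in> V \<Longrightarrow> S (x + y) = S x + S y"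
    and S_scale: "\<And>x z. x \<in> V \<Longrightarrow> S (op_scaleC z x) = op_scaleC z (S x)"
    and S_bound: "\<And>x. x \<in> V \<Longrightarrow> N' (S x) \<le> B * N x"
  shows "\<exists>T. compl_bounded_linear V N N' T \<and> (\<forall>a\<in>V. T (compl_embed V N a) = compl_embed V N' (S a))"
proof -
  interpret A: seminormed_space V N by fact
  interpret B: seminormed_space V N' by fact
  have S_diff: "S (x - y) = S x - S y" if "x \<in> V" "y \<in> V" for x y
    using S_add[of x "op_scaleC (-1) y"] S_scale[of y "-1"] A.scale_closed[of y "-1"] that
    by (simp add: uminus_op_scaleC[symmetric])
  have S_diff_bound: "N' (S x - S y) \<le> B * N (x - y)" if "x \<in> V" "y \<in> V" for x y
    using S_bound[OF A.diff_closed[OF that]] S_diff[OF that] by simp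
  have S_cauchy: "(\<lambda>i. S (x i)) \<in> cauchy_seqs V N'" if x: "x \<in> cauchy_seqs V N" for x
    unfolding cauchy_seqs_def
  proof (intro CollectI conjI allI impI)
    show "range (\<lambda>i. S (x i)) \<subseteq> V" using A.cauchy_seqs_V[OF x] S by auto
    fix e :: real assume "0 < e"
    \<comment> \<open>B may be zero or negative, so |B| + 1 serves as a positive divisor.\<close>
    then have "0 < e / (\<bar>B\<bar> + 1)" by (simp add: add_nonneg_pos)
    then obtain M where M: "\<And>i j. i \<ge> M \<Longrightarrow> j \<ge> M \<Longrightarrow> N (x i - x j) < e / (\<bar>B\<bar> + 1)"
      using A.cauchy_seqsD[OF x] by meson
    have "N' (S (x i) - S (x j)) < e" if "i \<ge> M" "j \<ge> M" for i j
    proof -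
      have "N' (S (x i) - S (x j)) \<le> B * N (x i - x j)"
        by (intro S_diff_bound A.cauchy_seqs_V[OF x])
      also have "\<dots> \<le> (\<bar>B\<bar> + 1) * N (x i - x j)"
        by (intro mult_right_mono A.N_nonneg A.diff_closed A.cauchy_seqs_V[OF x]) auto
      also have "\<dots> < e" using M[OF that] add_nonneg_pos[OF abs_ge_zero[of B] zero_less_one]
        by (simp only: pos_less_divide_eq mult.commute)
      finally show ?thesis .
    qed
    then show "\<exists>M. \<forall>i\<ge>M. \<forall>j\<ge>M. N' (S (x i) - S (x j)) < e" by blast
  qed
  define T where "T X = null_rel V N' `` {\<lambda>i. S (x i) | x. x \<in> X}" for X
  have T_cls: "T (A.cls x) = B.cls (\<lambda>i. S (x i))" if x: "x \<in> cauchy_seqs V N" for x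
    unfolding T_def
  proof (rule B.Image_null_rel_eq)
    show "{\<lambda>i. S (u i) |u. u \<in> A.cls x} \<subseteq> B.cls (\<lambda>i. S (x i))"
    proof clarsimp
      fix u assume u: "(x, u) \<in> null_rel V N"
      show "(\<lambda>i. S (x i), \<lambda>i. S (u i)) \<in> null_rel V N'"
      proof (rule B.null_relI)
        show "(\<lambda>i. B * N (x i - u i)) \<longlonglongrightarrow> 0"
          using u by (auto simp: A.null_rel_iff intro: tendsto_mult_right_zero)
        show "N' (S (x i) - S (u i)) \<le> B * N (x i - u i)" for i
          using u by (intro S_diff_bound A.cauchy_seqs_V) (auto simp: A.null_rel_iff)
      qed (use u in \<open>auto simp: A.null_rel_iff intro: S_cauchy\<close>)
    qed
  qed (use x A.cls_self in blast)
  have "compl_bounded_linear V N N' T"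
    unfolding compl_bounded_linear_def
  proof (intro conjI ballI allI)
    show "T \<in> completion V N \<rightarrow> completion V N'"
    proof
      fix X assume "X \<in> completion V N"
      then show "T X \<in> completion V N'"
        by (elim A.completion_cases) (simp add: T_cls S_cauchy B.completion_cls)
    qed
    fix X assume "X \<in> completion V N"
    then obtain x where x: "x \<in> cauchy_seqs V N" "X = A.cls x" by (elim A.completion_cases)
    show "T (compl_scale V N z X) = compl_scale V N' z (T X)" for z
      using x by (simp add: A.compl_scale_cls B.compl_scale_cls T_cls S_cauchy A.cauchy_seqs_scale S_scale A.cauchy_seqs_V)
    fix Y assume "Y \<in> completion V N"
    then obtain y where y: "y \<in> cauchy_seqs V N" "Y = A.cls y" by (elim A.completion_cases)
    show "T (compl_add V N X Y) = compl_add V N' (T X) (T Y)"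
      using x y by (simp add: A.compl_add_cls B.compl_add_cls T_cls S_cauchy A.cauchy_seqs_add S_add A.cauchy_seqs_V)
  next
    have "compl_norm N' (T X) \<le> B * compl_norm N X" if X: "X \<in> completion V N" for X
    proof -
      obtain x where x: "x \<in> cauchy_seqs V N" "X = A.cls x" using X by (elim A.completion_cases)
      have "(\<lambda>i. N' (S (x i))) \<longlonglongrightarrow> compl_norm N' (T X)"
        using B.compl_norm_cls[OF S_cauchy[OF x(1)]] x by (simp add: T_cls)
      moreover have "(\<lambda>i. B * N (x i)) \<longlonglongrightarrow> B * compl_norm N X"
        using A.compl_norm_cls[OF x(1)] x by (intro tendsto_intros) simp
      ultimately show ?thesis
        by (rule LIMSEQ_le) (use S_bound A.cauchy_seqs_V[OF x(1)] in blast)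
    qed
    then show "\<exists>B. \<forall>X\<in>completion V N. compl_norm N' (T X) \<le> B * compl_norm N X" by blast
  qed
  moreover have "T (compl_embed V N a) = compl_embed V N' (S a)" if "a \<in> V" for a
    using T_cls[OF A.cauchy_seqs_const[OF that]] by (simp add: compl_embed_def)
  ultimately show ?thesis by blast
qed

section \<open>The heat semigroup on Sobolev spaces\<close>

lemma smooth_alg_add: "a \<in> smooth_alg \<theta> \<Longrightarrow> b \<in> smooth_alg \<theta> \<Longrightarrow> a + b \<in> smooth_alg \<theta>"
  by (auto simp: smooth_alg_def nc_series_add[symmetric] intro!: imageI rapidly_decreasing_add)

lemma smooth_alg_op_scaleC: "a \<in> smooth_alg \<theta> \<Longrightarrow> op_scaleC z a \<in> smooth_alg \<theta>"
  by (auto simp: smooth_alg_def nc_series_scale[symmetric] intro!: imageI rapidly_decreasing_scale)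

lemma heat_smooth: "0 \<le> t \<Longrightarrow> a \<in> smooth_alg \<theta> \<Longrightarrow> heat \<theta> t a \<in> smooth_alg \<theta>"
  unfolding smooth_alg_def using rapidly_decreasing_mult[OF slowly_growing_heat] by (force simp: heat_series)

lemma heat_add:
  assumes "0 \<le> t" "a \<in> smooth_alg \<theta>" "b \<in> smooth_alg \<theta>"
  shows "heat \<theta> t (a + b) = heat \<theta> t a + heat \<theta> t b"
proof -
  obtain c d where cd: "rapidly_decreasing c" "rapidly_decreasing d" "a = nc_series \<theta> c" "b = nc_series \<theta> d"
    using assms by (auto simp: smooth_alg_def)
  show ?thesis
    using cd rapidly_decreasing_mult[OF slowly_growing_heat[OF assms(1)] cd(1)]
      rapidly_decreasing_mult[OF slowly_growing_heat[OF assms(1)] cd(2)]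
    by (simp add: nc_series_add[symmetric] heat_series rapidly_decreasing_add distrib_left)
qed

lemma heat_op_scaleC:
  assumes "0 \<le> t" "a \<in> smooth_alg \<theta>"
  shows "heat \<theta> t (op_scaleC z a) = op_scaleC z (heat \<theta> t a)"
proof -
  obtain c where c: "rapidly_decreasing c" "a = nc_series \<theta> c"
    using assms by (auto simp: smooth_alg_def)
  show ?thesis
    using c rapidly_decreasing_mult[OF slowly_growing_heat[OF assms(1)] c(1)]
    by (simp add: nc_series_scale[symmetric] heat_series rapidly_decreasing_scale mult_ac)
qed

lemma Lp_norm_deriv_add:
  assumes "1 < p" "a \<in> smooth_alg \<theta>" "b \<in> smooth_alg \<theta>"
  shows "Lp_norm \<theta> p (nc_deriv_multi \<theta> \<alpha> (a + b)) \<le> Lp_norm \<theta> p (nc_deriv_multi \<theta> \<alpha> a) + Lp_norm \<theta> p (nc_deriv_multi \<theta> \<alpha> b)"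
proof -
  obtain c d where cd: "rapidly_decreasing c" "rapidly_decreasing d" "a = nc_series \<theta> c" "b = nc_series \<theta> d"
    using assms by (auto simp: smooth_alg_def)
  note r = rapidly_decreasing_mult[OF slowly_growing_deriv_symbol[of \<alpha>] cd(1)] rapidly_decreasing_mult[OF slowly_growing_deriv_symbol[of \<alpha>] cd(2)]
  have "nc_deriv_multi \<theta> \<alpha> (a + b) = nc_deriv_multi \<theta> \<alpha> a + nc_deriv_multi \<theta> \<alpha> b"
    using cd r by (simp add: nc_series_add[symmetric] nc_deriv_multi_series rapidly_decreasing_add distrib_left)
  then show ?thesis
    using cd r assms(1) by (simp add: Lp_norm_eq nc_deriv_multi_series torus.Lp_triangle nc_series_cstar)
qed

lemma Lp_norm_deriv_op_scaleC:
  assumes "1 < p" "a \<in> smooth_alg \<theta>"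
  shows "Lp_norm \<theta> p (nc_deriv_multi \<theta> \<alpha> (op_scaleC z a)) = cmod z * Lp_norm \<theta> p (nc_deriv_multi \<theta> \<alpha> a)"
proof -
  obtain c where c: "rapidly_decreasing c" "a = nc_series \<theta> c"
    using assms by (auto simp: smooth_alg_def)
  note r = rapidly_decreasing_mult[OF slowly_growing_deriv_symbol[of \<alpha>] c(1)]
  have "nc_deriv_multi \<theta> \<alpha> (op_scaleC z a) = op_scaleC z (nc_deriv_multi \<theta> \<alpha> a)"
    using c r by (simp add: nc_series_scale[symmetric] nc_deriv_multi_series rapidly_decreasing_scale mult_ac)
  then show ?thesis
    using c r assms(1) by (simp add: Lp_norm_eq nc_deriv_multi_series torus.Lp_op_scaleC nc_cstar_op_scaleC nc_series_cstar)
qed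

lemma sobolev_norm_seminormed:
  assumes p: "1 < p"
  shows "seminormed_space (smooth_alg \<theta>) (sobolev_norm \<theta> k p)"
proof
  show "sobolev_norm \<theta> k p (a + b) \<le> sobolev_norm \<theta> k p a + sobolev_norm \<theta> k p b"
    if ab: "a \<in> smooth_alg \<theta>" "b \<in> smooth_alg \<theta>" for a b
  proof -
    have "sobolev_seminorm \<theta> j p (a + b) \<le> sobolev_seminorm \<theta> j p a + sobolev_seminorm \<theta> j p b" for j
      unfolding sobolev_seminorm_L2
      by (rule order_trans[OF L2_set_mono L2_set_triangle_ineq]) (auto simp: Lp_norm_nonneg Lp_norm_deriv_add[OF p ab])
    then show ?thesis
      unfolding sobolev_norm_def sum.distrib[symmetric] by (intro sum_mono)
  qed
  show "sobolev_norm \<theta> k p (op_scaleC z a) = cmod z * sobolev_norm \<theta> k p a" if a: "a \<in> smooth_alg \<theta>" for a z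
    unfolding sobolev_norm_def sobolev_seminorm_L2 sum_distrib_left
    by (intro sum.cong) (simp_all add: Lp_norm_deriv_op_scaleC[OF p a] L2_set_right_distrib)
qed (auto intro: smooth_alg_add smooth_alg_op_scaleC)

theorem corollary3p7:
  fixes k r :: nat
  shows "\<exists>C>0. \<forall>(\<theta> :: 'n::{finite,linorder} rmatrix) (p :: real).
    transpose \<theta> = - \<theta> \<and> 1 < p \<longrightarrow>
      (\<forall>a\<in>smooth_alg \<theta>. \<forall>t>0.
         sobolev_seminorm \<theta> (k + r) p (heat \<theta> t a)
           \<le> C / t powr (real r / 2) * sobolev_seminorm \<theta> k p a) \<and>
      (\<forall>a\<in>smooth_alg \<theta>. \<forall>t>0.
         sobolev_norm \<theta> (k + r) p (heat \<theta> t a)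
           \<le> C * (1 + t powr (- real r / 2)) * sobolev_norm \<theta> k p a) \<and>
      (\<forall>t>0. \<exists>T.
         compl_bounded_linear (smooth_alg \<theta>) (sobolev_norm \<theta> k p) (sobolev_norm \<theta> (k + r) p) T \<and>
         (\<forall>a\<in>smooth_alg \<theta>.
            T (compl_embed (smooth_alg \<theta>) (sobolev_norm \<theta> k p) a)
              = compl_embed (smooth_alg \<theta>) (sobolev_norm \<theta> (k + r) p) (heat \<theta> t a)))"
proof -
  let ?c = "smoothing_const TYPE('n)"
  \<comment> \<open>The constant of \<open>sobolev_norm_heat\<close>; its second sum contains
    \<open>?c k r\<close>, so it also dominates the constant of the seminorm estimate.\<close>
  define C where "C = (\<Sum>j\<le>k. ?c j 0) + (\<Sum>i\<le>r. ?c k i)"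
  have c0: "0 \<le> ?c j i" for j i using smoothing_const_pos less_imp_le by blast
  have "?c k r \<le> (\<Sum>i\<le>r. ?c k i)" by (rule member_le_sum) (auto simp: c0)
  also have "\<dots> \<le> C" by (simp add: C_def sum_nonneg c0)
  finally have cC: "?c k r \<le> C" .
  show ?thesis
  proof (intro exI[of _ C] conjI allI impI)
    show "0 < C" using cC smoothing_const_pos[of k r] by (rule less_le_trans[rotated])
    fix \<theta> :: "'n rmatrix" and p :: real
    assume "transpose \<theta> = - \<theta> \<and> 1 < p"
    then have p: "1 < p" by simp
    show "\<forall>a\<in>smooth_alg \<theta>. \<forall>t>0.
         sobolev_seminorm \<theta> (k + r) p (heat \<theta> t a) \<le> C / t powr (real r / 2) * sobolev_seminorm \<theta> k p a"
    proof (intro ballI allI impI)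
      fix a t assume a: "a \<in> smooth_alg \<theta>" and t: "(0::real) < t"
      show "sobolev_seminorm \<theta> (k + r) p (heat \<theta> t a) \<le> C / t powr (real r / 2) * sobolev_seminorm \<theta> k p a"
        using cC by (intro order_trans[OF sobolev_seminorm_heat[OF p t a]] mult_right_mono divide_right_mono sobolev_seminorm_nonneg) auto
    qed
    show norm: "\<forall>a\<in>smooth_alg \<theta>. \<forall>t>0.
         sobolev_norm \<theta> (k + r) p (heat \<theta> t a) \<le> C * (1 + t powr (- real r / 2)) * sobolev_norm \<theta> k p a"
      unfolding C_def using sobolev_norm_heat[OF p] by blast
    fix t :: real assume t: "0 < t"
    show "\<exists>T. compl_bounded_linear (smooth_alg \<theta>) (sobolev_norm \<theta> k p) (sobolev_norm \<theta> (k + r) p) T \<and>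
         (\<forall>a\<in>smooth_alg \<theta>. T (compl_embed (smooth_alg \<theta>) (sobolev_norm \<theta> k p) a)
              = compl_embed (smooth_alg \<theta>) (sobolev_norm \<theta> (k + r) p) (heat \<theta> t a))"
      by (rule completion_extension[where B = "C * (1 + t powr (- real r / 2))"])
        (use p t norm in \<open>auto simp: sobolev_norm_seminormed heat_smooth heat_add heat_op_scaleC\<close>)
  qed
qed

end
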